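(* Let $x_*\in X$ be a local minimizer of $\min_{x\in X} f(x)$ s.t. $c(x)=y_*$, and suppose that Assumptions (A) and (B) of the context hold at $x_*$ (i.e. on a neighbourhood $U_{x_*}$ of $x_*$). Assume that $x_0\in X$ is sufficiently close to $x_*$, i.e. that $\|R_{x_*}^{-1}(x_0)-0_{x_*}\|_{x_*}$ is sufficiently small. Then the local SQP method described in the context, started at $x_0$, creates a sequence $x_k\in X$, defined by $x_{k+1}=R_{x_k}(\Delta x_k)$, that converges quadratically towards $x_*$. This means: denoting $\mathbf x_k:=R_{x_*}^{-1}(x_k)$, there is a constant $\beta_*$ such that $$\|\mathbf x_{k+1}-0_{x_*}\|_{x_*}\le \beta_*\,\|\mathbf x_k-0_{x_*}\|_{x_*}^2 \quad\text{for all } k.$$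
   Context: **Setting.** $X,Y$ are Hilbert manifolds of class $C^2$ (modelled over Hilbert spaces), $f:X\to\mathbb R$ and $c:X\to Y$ are twice continuously differentiable, $y_*\in Y$. Each tangent space $T_xX$ carries a scalar product $\langle\cdot,\cdot\rangle_x$ making it a Hilbert space whose topology is compatible with that of $X$ (it need not come from a Riemannian metric); $\|\cdot\|_x$ is the induced norm, $\|\ell\|_{x,*}=\sup_{v\ne0}\ell(v)/\|v\|_x$ the dual norm, $B^x_\rho=\{w\in T_xX:\|w\|_x<\rho\}$, $0_x$ the zero of $T_xX$, and $M_x:T_xX\to T_xX^*$, $v\mapsto\langle v,\cdot\rangle_x$. **Retractions and stratifications.** A local retraction at $x$ is a $C^2$-map $R_x:V_x\to X$ on a neighbourhood $V_x$ of $0_x$ in $T_xX$ with $R_x(0_x)=x$, $T_{0_x}R_x=\mathrm{id}_{T_xX}$. A local stratification at $y$ is a $C^2$-map $S_y:U_y\to T_yY$ on a neighbourhood $U_y$ of $y$ in $Y$ with $S_y(y)=0_y$, $T_yS_y=\mathrm{id}_{T_yY}$; it is globally defined if $U_y=Y$. For each $x\in X$ local retractions $R_x^\circ$, $R_x$ (domain of $R_x$: $V_x$), a local stratification $S^\circ_{c(x)}$ and a globally defined stratification $S_{c(x)}$ are given. For each $x$, $V_x^i\subset V_x$ is a neighbourhood of $0_x$ such that $R_x:V_x^i\to R_x(V_x^i)$ is a diffeomorphism onto a neighbourhood of $x$; $R_x^{-1}$ denotes the inverse of this restriction. **Pullbacks.** $\mathbf f:=f\circ R_x$, $\mathbf c(\delta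 x):=S_{c(x)}(c(R_x(\delta x)))-S_{c(x)}(y_* )\in T_{c(x)}Y$, $\mathbf L(\delta x,p):=\mathbf f(\delta x)+p\,\mathbf c(\delta x)$ for $p\in T_{c(x)}Y^*$. $\mathbf L^\circ$ is defined in the same way with $R_x^\circ,S_{c(x)}^\circ$ (only its derivatives are used). Primes denote derivatives with respect to $\delta x$. First derivatives at $0_x$ do not depend on the chosen retraction/stratification and are written $f'(0_x)$, $c'(0_x)$, $L'(0_x,p)=f'(0_x)+p\,c'(0_x)$. The transition mapping is $\Phi_x:=(R_x^\circ)^{-1}\circ R_x$ near $0_x$ (local inverse). **Pseudo-inverse and multiplier.** For a surjective bounded linear $A:T_xX\to T_{c(x)}Y$, $A^-:T_{c(x)}Y\to(\ker A)^\perp$ is the right inverse of $A$ with range $(\ker A)^\perp$. If $c'(0_x)$ is surjective, $p_x:=-f'(0_x)c'(0_x)^-\in T_{c(x)}Y^*$; equivalently, with some $v\in T_xX$ it solves $M_xv+c'(0_x)^*p_x+f'(0_x)=0$, $c'(0_x)v=0$. **Lagrange-Newton step.** $\Delta x\in T_xX$ is the first component of the solution $(\Delta x,\Delta p)\in T_xX\times T_{c(x)}Y^*$ of $$(\mathbf L^\circ)''(0_x,p_x)\Delta x+c'(0_x)^*\Delta p+L'(0_x,p_x)=0,\qquad c'(0_x)\Delta x+\mathbf c(0_x)=0.$$ **Local SQP method.** Given the current iterate $x$: compute $p_x$, then $\Delta x$; if $\Delta x\notin V_x$, terminate; otherwise replace $x$ by $R_x(\Delta x)$ and repeat. $\Delta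 x_k$ denotes the step at $x_k$. **Non-degeneracy.** The family $R_x$ is invertible over $M\subset X$ if $M\subset R_x(V_x^i)$ for all $x\in M$; then for $x_1,x_2\in M$ put $\Theta_{x_1\to x_2}:=R_{x_2}^{-1}\circ R_{x_1}$ on $R_{x_1}^{-1}(M)$. The family $(R_x,\|\cdot\|_x)$ is non-degenerate in a neighbourhood $U_{x_*}$ of $x_*$ if $R_x$ is invertible over an open set $O\supset U_{x_*}$, there is $\rho>0$ with $R_x(B_\rho^x)\subset O$ for all $x\in U_{x_*}$, and there is $\gamma$ with $\|\Theta_{x_1\to x_2}(v)-\Theta_{x_1\to x_2}(w)\|_{x_2}\le\gamma\|v-w\|_{x_1}$ for all $x_1,x_2\in U_{x_*}$, $v,w\in B_\rho^{x_1}$. **Assumption (A).** $(R_x,\|\cdot\|_x)$ is non-degenerate on a neighbourhood $U_{x_*}$ of $x_*$ and there are constants $\rho_0>0$, $\omega_{\mathbf f'},\omega_{\mathbf c},\omega^*_{\mathbf c}$, independent of $x$, such that for all $x\in U_{x_*}$ and all $v,\delta x\in T_xX$ with $\|\delta x\|_x\le\rho_0$ (such $\delta x$ being understood to lie in the domain of the pullbacks): - $\|\mathbf f'(\delta x)-f'(0_x)\|_{x,*}\le\omega_{\mathbf f'}\|\delta x\|_x$; - $c'(0_x)$ is surjective and $\|c'(0_x)^-(\mathbf c'(\delta x)-c'(0_x))v\|_x\le\omega_{\mathbf c}\|\delta x\|_x\|v\|_x$; - with $\mathbf x_*:=R_x^{-1}(x_* )$, $\mathbf c'(\mathbf x_*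 )$ is surjective and $\|\mathbf c'(\mathbf x_* )^-(\mathbf c'(\mathbf x_* )-c'(0_x))v\|_x\le\omega_{\mathbf c}^*\|\mathbf x_*-0_x\|_x\|v\|_x$. **Assumption (B).** $(R_x,\|\cdot\|_x)$ is non-degenerate on $U_{x_*}$ and there are constants $\rho_0>0$, $\omega_{\mathbf L}$, $\alpha>0$, $M_{L}$, $M_\Phi$ such that for all $x\in U_{x_*}$: - $|(\mathbf L''(\delta x,p_x)-\mathbf L''(0_x,p_x))(v,w)|\le\omega_{\mathbf L}\|\delta x\|_x\|v\|_x\|w\|_x$ for all $\delta x,v,w\in T_xX$, $\|\delta x\|_x\le\rho_0$; - $(\mathbf L^\circ)''(0_x,p_x)(v,v)\ge\alpha\|v\|_x^2$ for all $v\in\ker c'(0_x)$; - $|(\mathbf L^\circ)''(0_x,p_x)(v,w)|\le M_L\|v\|_x\|w\|_x$ for all $v,w\in T_xX$; - $\|\Phi_x''(0_x)(v,w)\|_x\le M_\Phi\|v\|_x\|w\|_x$ for all $v,w\in T_xX$. *)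

theory Defs
  imports "HOL-Analysis.Analysis"
begin

definition D :: "('a::real_normed_vector \<Rightarrow> 'b::real_normed_vector) \<Rightarrow> 'a \<Rightarrow> 'a \<Rightarrow>\<^sub>L 'b" where
  "D g x = Blinfun (frechet_derivative g (at x))"

definition D2 :: "('a::real_normed_vector \<Rightarrow> 'b::real_normed_vector) \<Rightarrow> 'a \<Rightarrow> 'a \<Rightarrow>\<^sub>L 'a \<Rightarrow>\<^sub>L 'b" where
  "D2 g x = D (D g) x"

text \<open>Only meant for open \<open>S\<close>.\<close>

definition C2_on :: "'a::real_normed_vector set \<Rightarrow> ('a \<Rightarrow> 'b::real_normed_vector) \<Rightarrow> bool" where
  "C2_on S g \<longleftrightarrow> (\<exists>(g' :: 'a \<Rightarrow> 'a \<Rightarrow>\<^sub>L 'b) (g'' :: 'a \<Rightarrow> 'a \<Rightarrow>\<^sub>L 'a \<Rightarrow>\<^sub>L 'b).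
     (\<forall>x\<in>S. (g has_derivative blinfun_apply (g' x)) (at x)) \<and>
     (\<forall>x\<in>S. (g' has_derivative blinfun_apply (g'' x)) (at x)) \<and>
     continuous_on S g'')"

text \<open>
  A manifold is a type \<open>'x\<close> with an atlas over the model space \<open>'e\<close>; a chart is given by its
  open domain and its coordinate map. Each point \<open>x\<close> has a distinguished chart \<open>chart_at M x\<close>,
  through which the tangent space at \<open>x\<close> is identified with \<open>'e\<close> (as a topological vector space).
  The choice of these charts is arbitrary; no dependence on \<open>x\<close> of any regularity is required.
\<close>

type_synonym ('x, 'e) chart = "'x set \<times> ('x \<Rightarrow> 'e)"

record ('x, 'e) manifold =
  atlas :: "('x, 'e) chart set"
  chart_at :: "'x \<Rightarrow> ('x, 'e) chart"

definition is_chart :: "('x::topological_space, 'e::real_normed_vector) chart \<Rightarrow> bool" where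
  "is_chart = (\<lambda>(U, \<phi>). open U \<and> open (\<phi> ` U) \<and> homeomorphism U (\<phi> ` U) \<phi> (inv_into U \<phi>))"

definition C2_manifold :: "('x::t2_space, 'e::{real_inner, banach}) manifold \<Rightarrow> bool" where
  "C2_manifold M \<longleftrightarrow>
     (\<forall>\<kappa>\<in>atlas M. is_chart \<kappa>) \<and>
     (\<forall>(U, \<phi>)\<in>atlas M. \<forall>(V, \<psi>)\<in>atlas M. C2_on (\<phi> ` (U \<inter> V)) (\<psi> \<circ> inv_into U \<phi>)) \<and>
     (\<forall>x. chart_at M x \<in> atlas M \<and> x \<in> fst (chart_at M x))"

definition vec_manifold :: "('e, 'e) manifold" where
  "vec_manifold = \<lparr>atlas = {(UNIV, id)}, chart_at = (\<lambda>_. (UNIV, id))\<rparr>"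

definition C2_map_on ::
  "('x::topological_space, 'e::real_normed_vector) manifold \<Rightarrow>
   ('y::topological_space, 'f::real_normed_vector) manifold \<Rightarrow> 'x set \<Rightarrow> ('x \<Rightarrow> 'y) \<Rightarrow> bool" where
  "C2_map_on M N S g \<longleftrightarrow> open S \<and> continuous_on S g \<and>
     (\<forall>(U, \<phi>)\<in>atlas M. \<forall>(V, \<psi>)\<in>atlas N.
        C2_on (\<phi> ` {x \<in> U \<inter> S. g x \<in> V}) (\<psi> \<circ> g \<circ> inv_into U \<phi>))"

definition tangent_map ::
  "('x, 'e::real_normed_vector) manifold \<Rightarrow> ('y, 'f::real_normed_vector) manifold \<Rightarrow>
   ('x \<Rightarrow> 'y) \<Rightarrow> 'x \<Rightarrow> 'e \<Rightarrow>\<^sub>L 'f" where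
  "tangent_map M N g x =
     (case chart_at M x of (U, \<phi>) \<Rightarrow> case chart_at N (g x) of (V, \<psi>) \<Rightarrow>
        D (\<psi> \<circ> g \<circ> inv_into U \<phi>) (\<phi> x))"

definition local_retraction ::
  "('x::topological_space, 'e::real_normed_vector) manifold \<Rightarrow> 'x \<Rightarrow> 'e set \<Rightarrow> ('e \<Rightarrow> 'x) \<Rightarrow> bool" where
  "local_retraction M x V R \<longleftrightarrow> 0 \<in> V \<and> C2_map_on vec_manifold M V R \<and>
     R 0 = x \<and> tangent_map vec_manifold M R 0 = id_blinfun"

definition local_stratification ::
  "('y::topological_space, 'f::real_normed_vector) manifold \<Rightarrow> 'y \<Rightarrow> 'y set \<Rightarrow> ('y \<Rightarrow> 'f) \<Rightarrow> bool" where
  "local_stratification N y U S \<longleftrightarrow> y \<in> U \<and> C2_map_on N vec_manifold U S \<and>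
     S y = 0 \<and> tangent_map N vec_manifold S y = id_blinfun"

definition diffeo_nhd ::
  "('x::topological_space, 'e::real_normed_vector) manifold \<Rightarrow> 'e set \<Rightarrow> ('e \<Rightarrow> 'x) \<Rightarrow> bool" where
  "diffeo_nhd M W R \<longleftrightarrow> 0 \<in> W \<and> C2_map_on vec_manifold M W R \<and> inj_on R W \<and>
     C2_map_on M vec_manifold (R ` W) (inv_into W R)"

text \<open>Equivalence with the norm of the model space makes the scalar product complete.\<close>

definition compatible_scalar_product :: "('e::{real_inner, banach} \<Rightarrow> 'e \<Rightarrow> real) \<Rightarrow> bool" where
  "compatible_scalar_product b \<longleftrightarrow> bilinear b \<and> (\<forall>v w. b v w = b w v) \<and> (\<forall>v. v \<noteq> 0 \<longrightarrow> b v v > 0) \<and>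
     (\<exists>m>0. \<exists>C. \<forall>v. m * norm v \<le> sqrt (b v v) \<and> sqrt (b v v) \<le> C * norm v)"

definition ip_norm :: "('e \<Rightarrow> 'e \<Rightarrow> real) \<Rightarrow> 'e \<Rightarrow> real" where
  "ip_norm b v = sqrt (b v v)"

text \<open>The vector \<open>v = 0\<close> contributes \<open>0 / 0 = 0\<close>; this only matters on the zero space.\<close>

definition dual_norm :: "('e::real_normed_vector \<Rightarrow> 'e \<Rightarrow> real) \<Rightarrow> ('e \<Rightarrow>\<^sub>L real) \<Rightarrow> real" where
  "dual_norm b l = (SUP v. l v / ip_norm b v)"

definition pseudo_inverse ::
  "('e::real_normed_vector \<Rightarrow> 'e \<Rightarrow> real) \<Rightarrow> ('e \<Rightarrow>\<^sub>L 'f::real_normed_vector) \<Rightarrow> 'f \<Rightarrow> 'e" where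
  "pseudo_inverse b A w = (THE v. A v = w \<and> (\<forall>u. A u = 0 \<longrightarrow> b v u = 0))"

text \<open>
  \<open>retr\<close>, \<open>strat\<close> stand for \<open>R\<close>, \<open>S\<close>, and \<open>retr0\<close>, \<open>strat0\<close> for \<open>R\<^sup>\<circ>\<close>, \<open>S\<^sup>\<circ>\<close>. Retractions are indexed
  by points of \<open>'x\<close>, stratifications by points of \<open>'y\<close>; only those at points \<open>c x\<close> matter.
\<close>

record ('x, 'y, 'e, 'f) problem =
  mfX :: "('x, 'e) manifold"
  mfY :: "('y, 'f) manifold"
  scal :: "'x \<Rightarrow> 'e \<Rightarrow> 'e \<Rightarrow> real"
  obj :: "'x \<Rightarrow> real"
  constr :: "'x \<Rightarrow> 'y"
  target :: "'y"
  retr :: "'x \<Rightarrow> 'e \<Rightarrow> 'x"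
  retr_dom :: "'x \<Rightarrow> 'e set"
  retr_inv_dom :: "'x \<Rightarrow> 'e set"
  retr0 :: "'x \<Rightarrow> 'e \<Rightarrow> 'x"
  retr0_dom :: "'x \<Rightarrow> 'e set"
  strat :: "'y \<Rightarrow> 'y \<Rightarrow> 'f"
  strat0 :: "'y \<Rightarrow> 'y \<Rightarrow> 'f"
  strat0_dom :: "'y \<Rightarrow> 'y set"

definition sqp_setting ::
  "('x::t2_space, 'y::t2_space, 'e::{real_inner, banach}, 'f::{real_inner, banach}) problem \<Rightarrow> bool" where
  "sqp_setting P \<longleftrightarrow>
     C2_manifold (mfX P) \<and> C2_manifold (mfY P) \<and>
     (\<forall>x. compatible_scalar_product (scal P x)) \<and>
     C2_map_on (mfX P) vec_manifold UNIV (obj P) \<and>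
     C2_map_on (mfX P) (mfY P) UNIV (constr P) \<and>
     (\<forall>x. local_retraction (mfX P) x (retr_dom P x) (retr P x)) \<and>
     (\<forall>x. retr_inv_dom P x \<subseteq> retr_dom P x \<and> diffeo_nhd (mfX P) (retr_inv_dom P x) (retr P x)) \<and>
     (\<forall>x. local_retraction (mfX P) x (retr0_dom P x) (retr0 P x)) \<and>
     (\<forall>x. local_stratification (mfY P) (constr P x) UNIV (strat P (constr P x))) \<and>
     (\<forall>x. local_stratification (mfY P) (constr P x) (strat0_dom P (constr P x)) (strat0 P (constr P x)))"

definition local_minimizer :: "('x::topological_space, 'y, 'e, 'f) problem \<Rightarrow> 'x \<Rightarrow> bool" where
  "local_minimizer P xs \<longleftrightarrow> constr P xs = target P \<and>
     (\<exists>N. open N \<and> xs \<in> N \<and> (\<forall>x\<in>N. constr P x = target P \<longrightarrow> obj P xs \<le> obj P x))"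

definition tnorm :: "('x, 'y, 'e, 'f) problem \<Rightarrow> 'x \<Rightarrow> 'e \<Rightarrow> real" where
  "tnorm P x = ip_norm (scal P x)"

definition retr_inv :: "('x, 'y, 'e, 'f) problem \<Rightarrow> 'x \<Rightarrow> 'x \<Rightarrow> 'e" where
  "retr_inv P x = inv_into (retr_inv_dom P x) (retr P x)"

context
  fixes P :: "('x::t2_space, 'y::t2_space, 'e::{real_inner, banach}, 'f::{real_inner, banach}) problem"
begin

definition pb_obj :: "'x \<Rightarrow> 'e \<Rightarrow> real" where
  "pb_obj x d = obj P (retr P x d)"

definition pb_constr :: "'x \<Rightarrow> 'e \<Rightarrow> 'f" where
  "pb_constr x d = strat P (constr P x) (constr P (retr P x d)) - strat P (constr P x) (target P)"

definition lagrangian :: "'x \<Rightarrow> ('f \<Rightarrow>\<^sub>L real) \<Rightarrow> 'e \<Rightarrow> real" where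
  "lagrangian x p d = pb_obj x d + p (pb_constr x d)"

text \<open>Only derivatives in \<open>d\<close> at \<open>0\<close> are used, so it is harmless that \<open>target P\<close> may lie outside the
  domain of \<open>strat0\<close>.\<close>

definition lagrangian0 :: "'x \<Rightarrow> ('f \<Rightarrow>\<^sub>L real) \<Rightarrow> 'e \<Rightarrow> real" where
  "lagrangian0 x p d = obj P (retr0 P x d) +
     p (strat0 P (constr P x) (constr P (retr0 P x d)) - strat0 P (constr P x) (target P))"

text \<open>The local inverse of \<open>retr0 P x\<close> is taken on some neighbourhood on which that map is a
  diffeomorphism; the germ of the transition mapping at \<open>0\<close> does not depend on the choice.\<close>

definition transition :: "'x \<Rightarrow> 'e \<Rightarrow> 'e" where
  "transition x =
     inv_into (SOME W. W \<subseteq> retr0_dom P x \<and> diffeo_nhd (mfX P) W (retr0 P x)) (retr0 P x) \<circ> retr P x"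

definition multiplier :: "'x \<Rightarrow> 'f \<Rightarrow>\<^sub>L real" where
  "multiplier x =
     Blinfun (\<lambda>w. - D (pb_obj x) 0 (pseudo_inverse (scal P x) (D (pb_constr x) 0) w))"

definition lagrange_newton :: "'x \<Rightarrow> 'e \<times> ('f \<Rightarrow>\<^sub>L real) \<Rightarrow> bool" where
  "lagrange_newton x = (\<lambda>(dx, dp).
     D2 (lagrangian0 x (multiplier x)) 0 dx + (dp o\<^sub>L D (pb_constr x) 0)
       + D (lagrangian x (multiplier x)) 0 = 0 \<and>
     D (pb_constr x) 0 dx + pb_constr x 0 = 0)"

text \<open>\<open>x\<close> and \<open>dx\<close> are the iterates and the steps of a run started at \<open>x0\<close> in which all quantities
  are well-defined and which never terminates.\<close>

definition sqp_run :: "'x \<Rightarrow> (nat \<Rightarrow> 'x) \<Rightarrow> (nat \<Rightarrow> 'e) \<Rightarrow> bool" where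
  "sqp_run x0 x dx \<longleftrightarrow> x 0 = x0 \<and>
     (\<forall>k. surj (blinfun_apply (D (pb_constr (x k)) 0)) \<and>
          (\<exists>!s. lagrange_newton (x k) s) \<and>
          (\<exists>dp. lagrange_newton (x k) (dx k, dp)) \<and>
          dx k \<in> retr_dom P (x k) \<and>
          x (Suc k) = retr P (x k) (dx k))"

definition invertible_over :: "'x set \<Rightarrow> bool" where
  "invertible_over M \<longleftrightarrow> (\<forall>x\<in>M. M \<subseteq> retr P x ` retr_inv_dom P x)"

definition trans_map :: "'x \<Rightarrow> 'x \<Rightarrow> 'e \<Rightarrow> 'e" where
  "trans_map x1 x2 = retr_inv P x2 \<circ> retr P x1"

definition nondegenerate :: "'x set \<Rightarrow> bool" where
  "nondegenerate U \<longleftrightarrow>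
     (\<exists>O' \<rho> \<gamma>. open O' \<and> U \<subseteq> O' \<and> invertible_over O' \<and> \<rho> > 0 \<and>
        (\<forall>x\<in>U. \<forall>v. tnorm P x v < \<rho> \<longrightarrow> v \<in> retr_dom P x \<and> retr P x v \<in> O') \<and>
        (\<forall>x1\<in>U. \<forall>x2\<in>U. \<forall>v w. tnorm P x1 v < \<rho> \<longrightarrow> tnorm P x1 w < \<rho> \<longrightarrow>
           tnorm P x2 (trans_map x1 x2 v - trans_map x1 x2 w) \<le> \<gamma> * tnorm P x1 (v - w)))"

definition assumption_A :: "'x \<Rightarrow> 'x set \<Rightarrow> bool" where
  "assumption_A xs U \<longleftrightarrow> nondegenerate U \<and>
     (\<exists>\<rho>0 \<omega>f \<omega>c \<omega>c'. \<rho>0 > 0 \<and>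
       (\<forall>x\<in>U.
          (\<forall>d\<in>retr_dom P x. tnorm P x d \<le> \<rho>0 \<longrightarrow>
             dual_norm (scal P x) (D (pb_obj x) d - D (pb_obj x) 0) \<le> \<omega>f * tnorm P x d) \<and>
          surj (blinfun_apply (D (pb_constr x) 0)) \<and>
          (\<forall>d\<in>retr_dom P x. \<forall>v. tnorm P x d \<le> \<rho>0 \<longrightarrow>
             tnorm P x (pseudo_inverse (scal P x) (D (pb_constr x) 0)
                          ((D (pb_constr x) d - D (pb_constr x) 0) v))
               \<le> \<omega>c * tnorm P x d * tnorm P x v) \<and>
          (let z = retr_inv P x xs in
             surj (blinfun_apply (D (pb_constr x) z)) \<and>
             (\<forall>v. tnorm P x (pseudo_inverse (scal P x) (D (pb_constr x) z)
                               ((D (pb_constr x) z - D (pb_constr x) 0) v))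
                    \<le> \<omega>c' * tnorm P x z * tnorm P x v))))"

definition assumption_B :: "'x set \<Rightarrow> bool" where
  "assumption_B U \<longleftrightarrow> nondegenerate U \<and>
     (\<exists>\<rho>0 \<omega>L \<alpha> ML M\<Phi>. \<rho>0 > 0 \<and> \<alpha> > 0 \<and>
       (\<forall>x\<in>U.
          (\<forall>d\<in>retr_dom P x. \<forall>v w. tnorm P x d \<le> \<rho>0 \<longrightarrow>
             \<bar>(D2 (lagrangian x (multiplier x)) d - D2 (lagrangian x (multiplier x)) 0) v w\<bar>
               \<le> \<omega>L * tnorm P x d * tnorm P x v * tnorm P x w) \<and>
          (\<forall>v. D (pb_constr x) 0 v = 0 \<longrightarrow>
             D2 (lagrangian0 x (multiplier x)) 0 v v \<ge> \<alpha> * (tnorm P x v)\<^sup>2) \<and>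
          (\<forall>v w. \<bar>D2 (lagrangian0 x (multiplier x)) 0 v w\<bar> \<le> ML * tnorm P x v * tnorm P x w) \<and>
          (\<forall>v w. tnorm P x (D2 (transition x) 0 v w) \<le> M\<Phi> * tnorm P x v * tnorm P x w)))"

end

end

theory Submission
  imports Defs
begin

text \<open>
  Fix an iterate \<open>x\<close> near \<open>x\<^sub>*\<close> and let \<open>z = R\<^sub>x\<^sup>-\<^sup>1 x\<^sub>*\<close>. In the chart \<open>R\<^sub>x\<close> the derivative
  \<open>f'(z)\<close> vanishes on the kernel of \<open>c'(z)\<close>, so \<open>L'(0, p\<^sub>x)\<close> and \<open>L'(z, p\<^sub>x)\<close> are
  \<open>O(|z|)\<close>; since \<open>c'(z)\<close> is itself \<open>O(|z|)\<close> on \<open>ker c'(0)\<close>, the restriction of \<open>L'(z, p\<^sub>x)\<close> to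
  \<open>ker c'(0)\<close> is even \<open>O(|z|\<^sup>2)\<close>. The second derivatives of the Lagrangians for \<open>(R, S)\<close> and
  \<open>(R\<^sup>o, S\<^sup>o)\<close> differ on \<open>ker c'(0)\<close> only by \<open>L'(0, p\<^sub>x) \<Phi>''\<close>, which is \<open>O(|z|)\<close> as well.
  Testing the Lagrange-Newton equation with the tangential part of \<open>\<Delta>x - z\<close> and using
  coercivity on \<open>ker c'(0)\<close> gives \<open>|\<Delta>x - z| = O(|z|\<^sup>2)\<close>, with constants independent of \<open>x\<close>.
  Non-degeneracy transports this bound to the chart at \<open>x\<^sub>*\<close>.
\<close>


section \<open>Bounded surjections and scalar products on Hilbert spaces\<close>

text \<open>Charts, retractions and scalar products may vary with \<open>x\<close> in any manner, so
  a constant is uniform only if it is assembled from those of (A), (B) and non-degeneracy. This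
  shapes three points. Residuals in the tangent spaces of \<open>Y\<close> are never estimated in a
  norm of their own: they are sent to the tangent space of \<open>X\<close> by the pseudo-inverse of
  c'(0) and measured there. A bound on f'(0) that is uniform in \<open>x\<close> is not among the
  assumptions: it is derived by writing the pullback of f at \<open>x\<close> as the pullback at
  \<open>xs\<close> after the map \<Theta>, whose Lipschitz constant \<gamma> suffices. Finally,
  stationarity at z needs care because the stratification is centred at c(x), whereas the feasible
  points lie over the target; the smallness of z keeps c' surjective on the whole segment from 0 to
  z, and this carries nondegeneracy of the stratification from c(x) to the target.\<close>

text \<open>Each correction halves the residual, so the corrections form a dominated geometric
  series that converges by completeness of \<open>'a\<close>. The gauge \<open>N\<close> is left
  abstract because residuals are later measured in two ways: by the norm of the range, and by the
  scalar-product norm of the pseudo-inverse. \<open>K'\<close> turns decay of \<open>N\<close> into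
  convergence in norm.\<close>

lemma solve_by_successive_approximation:
  fixes A :: "'a::banach \<Rightarrow>\<^sub>L 'b::real_normed_vector" and N :: "'b \<Rightarrow> real"
  assumes step: "\<And>w. \<exists>v. norm v \<le> K * N w \<and> N (w - A v) \<le> N w / 2"
    and N: "\<And>w. norm w \<le> K' * N w" and K: "0 \<le> K" "0 \<le> K'"
  shows "\<exists>v. A v = w \<and> norm v \<le> 2 * K * N w"
proof -
  obtain h where h: "\<And>w. norm (h w) \<le> K * N w" "\<And>w. N (w - A (h w)) \<le> N w / 2"
    using step by metis
  define r where "r k = ((\<lambda>u. u - A (h u)) ^^ k) w" for k
  have r_Suc: "r (Suc k) = r k - A (h (r k))" for k
    by (simp add: r_def)
  have Nr: "N (r k) \<le> N w * (1/2) ^ k" for k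
  proof (induction k)
    case 0
    then show ?case by (simp add: r_def)
  next
    case (Suc k)
    have "N (r (Suc k)) \<le> N (r k) / 2"
      using h(2) by (simp add: r_Suc)
    then show ?case using Suc by simp
  qed
  have hr: "norm (h (r k)) \<le> K * N w * (1/2) ^ k" for k
    using h(1)[of "r k"] mult_left_mono[OF Nr[of k] K(1)] by (simp add: mult.assoc)
  have sums: "(\<lambda>k. K * N w * (1/2) ^ k) sums (K * N w * 2)"
    using sums_mult[OF geometric_sums[of "1/2::real"], of "K * N w"] by simp
  have summable: "summable (\<lambda>k. norm (h (r k)))"
    by (rule summable_comparison_test'[OF sums_summable[OF sums], of 0]) (simp add: hr)
  have "(\<lambda>k. norm (r k)) \<longlonglongrightarrow> 0"
  proof (rule tendsto_sandwich[of "\<lambda>_. 0"])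
    have "norm (r k) \<le> K' * N w * (1/2) ^ k" for k
      using N[of "r k"] mult_left_mono[OF Nr[of k] K(2)] by (simp add: mult.assoc)
    then show "\<forall>\<^sub>F k in sequentially. norm (r k) \<le> K' * N w * (1/2) ^ k"
      by simp
    show "(\<lambda>k. K' * N w * (1/2) ^ k) \<longlonglongrightarrow> 0"
      by (intro tendsto_mult_right_zero LIMSEQ_realpow_zero) auto
  qed auto
  then have r0: "r \<longlonglongrightarrow> 0"
    by (simp add: tendsto_norm_zero_iff)
  have "(\<lambda>k. r k - r (Suc k)) sums (r 0 - 0)"
    using r0 by (rule telescope_sums')
  then have "(\<lambda>k. A (h (r k))) sums w"
    by (simp add: r_Suc) (simp add: r_def)
  moreover have "(\<lambda>k. A (h (r k))) sums A (\<Sum>k. h (r k))"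
    using summable_norm_cancel[OF summable]
    by (intro bounded_linear.sums[OF blinfun.bounded_linear_right] summable_sums)
  ultimately have "A (\<Sum>k. h (r k)) = w"
    by (rule sums_unique2[symmetric])
  moreover have "norm (\<Sum>k. h (r k)) \<le> K * N w * 2"
    using summable_norm[OF summable] suminf_le[OF hr summable sums_summable[OF sums]]
      sums_unique[OF sums] by simp
  ultimately show ?thesis
    by (intro exI[of _ "\<Sum>k. h (r k)"]) simp
qed

text \<open>Open mapping theorem in quantitative form: by Baire some closed set \<open>T n\<close>
  has interior, which yields solutions up to an arbitrarily small error; successive approximation
  then removes the error.\<close>

lemma surj_blinfun_bounded_solution:
  fixes A :: "'a::banach \<Rightarrow>\<^sub>L 'b::banach"
  assumes "surj (blinfun_apply A)"
  obtains K where "K > 0" "\<And>w. \<exists>v. A v = w \<and> norm v \<le> K * norm w"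
proof -
  define T where "T n = closure (A ` cball 0 (real n))" for n
  have "\<Union>(range T) = UNIV"
  proof -
    have "w \<in> \<Union>(range T)" for w
    proof -
      obtain v where v: "w = A v" using assms by blast
      obtain n where "norm v \<le> real n" using real_arch_simple by blast
      then have "w \<in> A ` cball 0 (real n)" using v by auto
      then show ?thesis using closure_subset by (fastforce simp: T_def)
    qed
    then show ?thesis by blast
  qed
  moreover have "interior (\<Union>(range T)) = {}" if "\<And>n. interior (T n) = {}"
  proof -
    have "euclidean interior_of \<Union>(range T) = {}"
    proof (rule Baire_category_alt)
      show "completely_metrizable_space (euclidean :: 'b topology) \<or>
          locally_compact_space (euclidean :: 'b topology) \<and> regular_space (euclidean :: 'b topology)"
        using completely_metrizable_space_euclidean by blast
    qed (use that in \<open>auto simp: T_def\<close>)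
    then show ?thesis by simp
  qed
  ultimately obtain n where "interior (T n) \<noteq> {}"
    by (metis interior_UNIV UNIV_not_empty)
  then obtain y r where r: "r > 0" "ball y r \<subseteq> T n"
    by (metis ex_in_conv mem_interior)
  \<comment> \<open>\<open>T n\<close> contains a ball about some \<open>y\<close>, not about 0.
    Subtracting an approximate preimage of \<open>y\<close> from one of \<open>y + w\<close> moves
    the centre to 0 and doubles the radius \<open>n\<close>.\<close>
  have approx: "\<exists>v. norm v \<le> 2 * real n \<and> norm (A v - w) < e" if "norm w < r" "e > 0" for w e
  proof -
    have "y + w \<in> T n" "y \<in> T n"
      using r that by (auto simp: subset_eq dist_norm)
    then have "\<exists>u\<in>A ` cball 0 (real n). dist u (y + w) < e/2" "\<exists>u\<in>A ` cball 0 (real n). dist u y < e/2"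
      unfolding T_def closure_approachable using \<open>e > 0\<close> half_gt_zero by blast+
    then obtain a b where "norm a \<le> n" "dist (A a) (y + w) < e/2" "norm b \<le> n" "dist (A b) y < e/2"
      by auto
    moreover have "norm (A (a - b) - w) \<le> norm (A a - (y + w)) + norm (A b - y)"
      using norm_triangle_ineq4[of "A a - (y + w)" "A b - y"]
      by (simp add: blinfun.diff_right algebra_simps)
    ultimately show ?thesis
      using norm_triangle_ineq4[of a b] by (intro exI[of _ "a - b"]) (auto simp: dist_norm)
  qed
  \<comment> \<open>\<open>s\<close> below scales \<open>w\<close> to norm \<open>r / 2\<close>;
    undoing the scaling turns the size \<open>2 * n\<close> of the preimage into
    \<open>4 * n / r * norm w\<close>. The summand 1 keeps \<open>K\<close> positive when
    \<open>n = 0\<close>.\<close>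
  define K where "K = 4 * real n / r + 1"
  have "K > 0" using r by (simp add: K_def add_nonneg_pos)
  have step: "\<exists>v. norm v \<le> K * norm w \<and> norm (w - A v) \<le> norm w / 2" for w
  proof (cases "w = 0")
    case True
    then show ?thesis by (intro exI[of _ 0]) simp
  next
    case False
    define s where "s = r / (2 * norm w)"
    have s: "s > 0" using False r by (simp add: s_def)
    have "norm (s *\<^sub>R w) < r" using False r by (simp add: s_def)
    then obtain v where v: "norm v \<le> 2 * real n" "norm (A v - s *\<^sub>R w) < s * norm w / 2"
      using approx[of "s *\<^sub>R w" "s * norm w / 2"] s False by auto
    have "norm (w - A (v /\<^sub>R s)) \<le> norm w / 2"
    proof -
      have "w - A (v /\<^sub>R s) = - ((A v - s *\<^sub>R w) /\<^sub>R s)"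
        using s by (simp add: blinfun.scaleR_right scaleR_diff_right)
      then have "norm (w - A (v /\<^sub>R s)) = norm (A v - s *\<^sub>R w) / s"
        using s by (simp only: norm_minus_cancel) (simp add: divide_inverse)
      also have "\<dots> \<le> norm w / 2" using v s by (simp add: field_simps)
      finally show ?thesis .
    qed
    moreover have "norm (v /\<^sub>R s) \<le> K * norm w"
    proof -
      have "norm (v /\<^sub>R s) = norm v / s" using s by (simp add: divide_inverse)
      also have "\<dots> \<le> 2 * real n / s" using v s by (simp add: divide_right_mono)
      also have "\<dots> = 4 * real n / r * norm w" using r by (simp add: s_def)
      also have "\<dots> \<le> K * norm w" by (simp add: K_def distrib_right)
      finally show ?thesis .
    qed
    ultimately show ?thesis by blast
  qed
  have "\<exists>v. A v = w \<and> norm v \<le> 2 * K * norm w" for w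
    by (rule solve_by_successive_approximation[where K' = 1]) (use step \<open>K > 0\<close> in auto)
  with that[of "2 * K"] \<open>K > 0\<close> show thesis by simp
qed

text \<open>A surjection that is also injective satisfies \<open>norm v <= K * norm (A v)\<close>,
  and such a lower bound excludes kernel vectors of nearby operators. For the converse,
  \<open>B\<close> inherits solvability from \<open>A\<close> with the constant
  \<open>2 * K\<close>, and the roles are exchanged; the factor 3 in the threshold leaves the ratio
  2/3 there. Along a path of surjections injectivity is thus locally constant.\<close>

lemma surj_blinfun_perturbation:
  fixes A :: "'a::banach \<Rightarrow>\<^sub>L 'b::banach"
  assumes "surj (blinfun_apply A)"
  shows "\<exists>e>0. \<forall>B. norm (B - A) < e \<longrightarrow> (inj (blinfun_apply B) \<longleftrightarrow> inj (blinfun_apply A))"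
proof -
  obtain K where K: "K > 0" "\<And>w. \<exists>v. A v = w \<and> norm v \<le> K * norm w"
    using surj_blinfun_bounded_solution[OF assms] by blast
  have inj_iff: "inj (blinfun_apply B) \<longleftrightarrow> (\<forall>v. B v = 0 \<longrightarrow> v = 0)" for B :: "'a \<Rightarrow>\<^sub>L 'b"
    by (simp add: blinfun.bounded_linear_right bounded_linear.linear linear_injective_0)
  have "inj (blinfun_apply B) \<longleftrightarrow> inj (blinfun_apply A)" if B: "norm (B - A) < 1 / (3 * K)" for B
  proof
    have small: "norm ((B - A) v) \<le> norm v / (3 * K)" for v
      using norm_blinfun[of "B - A" v] mult_right_mono[OF less_imp_le[OF B], of "norm v"] by simp
    assume A: "inj (blinfun_apply A)"
    have "v = 0" if "B v = 0" for v
    proof -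
      obtain u where "A u = A v" "norm u \<le> K * norm (A v)" using K(2) by blast
      then have "norm v \<le> K * norm (A v)" using A by (metis injD)
      also have "A v = - ((B - A) v)" using that by (simp add: blinfun.diff_left)
      also have "K * norm (- ((B - A) v)) \<le> K * (norm v / (3 * K))"
        using small K(1) by (intro mult_left_mono) auto
      also have "\<dots> = norm v / 3" using K(1) by simp
      finally show "v = 0" by simp
    qed
    then show "inj (blinfun_apply B)" by (simp add: inj_iff)
  next
    have small: "norm ((B - A) v) \<le> norm v / (3 * K)" for v
      using norm_blinfun[of "B - A" v] mult_right_mono[OF less_imp_le[OF B], of "norm v"] by simp
    assume injB: "inj (blinfun_apply B)"
    have step: "\<exists>v. norm v \<le> K * norm w \<and> norm (w - B v) \<le> norm w / 2" for w
    proof -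
      obtain v where v: "A v = w" "norm v \<le> K * norm w" using K(2) by blast
      have "norm (w - B v) = norm ((B - A) v)"
        using v by (simp add: blinfun.diff_left norm_minus_commute)
      also have "\<dots> \<le> norm v / (3 * K)" by (rule small)
      also have "\<dots> \<le> norm w / 3" using v K(1) by (simp add: field_simps)
      finally have "norm (w - B v) \<le> norm w / 2" by (rule order_trans) simp
      with v show ?thesis by blast
    qed
    have sol: "\<exists>v. B v = w \<and> norm v \<le> 2 * K * norm w" for w
      by (rule solve_by_successive_approximation[where K' = 1]) (use step K(1) in auto)
    have "v = 0" if "A v = 0" for v
    proof -
      obtain u where u: "B u = B v" "norm u \<le> 2 * K * norm (B v)" using sol by blast
      have "norm v \<le> 2 * K * norm (B v)" using u injB by (metis injD)
      also have "B v = (B - A) v" using that by (simp add: blinfun.diff_left)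
      also have "2 * K * norm ((B - A) v) \<le> 2 * K * (norm v / (3 * K))"
        using small K(1) by (intro mult_left_mono) auto
      also have "\<dots> = 2 / 3 * norm v" using K(1) by simp
      finally show "v = 0" by simp
    qed
    then show "inj (blinfun_apply A)" by (simp add: inj_iff)
  qed
  moreover have "1 / (3 * K) > 0" using K(1) by simp
  ultimately show ?thesis by blast
qed

text \<open>The solution minimises \<open>a v v - 2 * l v\<close> over \<open>K\<close>; the parallelogram identity makes
  every minimising sequence a Cauchy sequence.\<close>

lemma symmetric_coercive_solution:
  fixes a :: "'a::banach \<Rightarrow> 'a \<Rightarrow> real"
  assumes a: "bounded_bilinear a" and sym: "\<And>v w. a v w = a w v"
    and K: "subspace K" "closed K" and \<mu>: "\<mu> > 0" "\<And>v. v \<in> K \<Longrightarrow> \<mu> * (norm v)\<^sup>2 \<le> a v v"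
    and l: "bounded_linear l"
  shows "\<exists>v\<in>K. \<forall>w\<in>K. a v w = l w"
proof -
  interpret a: bounded_bilinear a by (rule a)
  interpret l: bounded_linear l by (rule l)
  define J where "J v = a v v - 2 * l v" for v
  obtain C where C: "\<And>v. norm (l v) \<le> norm v * C" using l.bounded by blast
  have bdd: "- C\<^sup>2 / \<mu> \<le> J v" if "v \<in> K" for v
  proof -
    have "0 \<le> (\<mu> * norm v - C)\<^sup>2 / \<mu>" using \<mu> by simp
    also have "\<dots> = \<mu> * (norm v)\<^sup>2 - 2 * (norm v * C) + C\<^sup>2 / \<mu>"
      using \<mu>(1) by (simp add: power2_eq_square field_simps)
    finally have "- C\<^sup>2 / \<mu> \<le> \<mu> * (norm v)\<^sup>2 - 2 * (norm v * C)" by simp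
    also have "\<dots> \<le> J v" using C[of v] \<mu>(2)[OF that] by (simp add: J_def)
    finally show ?thesis .
  qed
  define m where "m = Inf (J ` K)"
  have "K \<noteq> {}" using K(1) subspace_0 by blast
  have bddK: "bdd_below (J ` K)" using bdd unfolding bdd_below_def by blast
  have m_le: "m \<le> J v" if "v \<in> K" for v
    unfolding m_def using bddK that by (simp add: cInf_lower)
  have "\<exists>v\<in>K. J v < m + inverse (real (Suc n))" for n
  proof -
    have "m < m + inverse (real (Suc n))" by simp
    then show ?thesis using cInf_lessD[of "J ` K"] \<open>K \<noteq> {}\<close> by (force simp: m_def simp del: of_nat_Suc)
  qed
  then obtain v where v: "\<And>n. v n \<in> K" "\<And>n. J (v n) < m + inverse (real (Suc n))" by metis
  \<comment> \<open>The midpoint of \<open>x\<close> and \<open>y\<close> lies in \<open>K\<close>,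
    so its \<open>J\<close>-value is at least \<open>m\<close>; this controls the term with the
    negative sign.\<close>
  have par: "\<mu> * (norm (x - y))\<^sup>2 \<le> 2 * J x + 2 * J y - 4 * m" if "x \<in> K" "y \<in> K" for x y
  proof -
    have "x - y \<in> K" "(1/2) *\<^sub>R (x + y) \<in> K" using K(1) that
      by (auto intro: subspace_diff subspace_scale subspace_add)
    then have "\<mu> * (norm (x - y))\<^sup>2 \<le> a (x - y) (x - y)" "m \<le> J ((1/2) *\<^sub>R (x + y))"
      using \<mu>(2) m_le by auto
    moreover have "a (x - y) (x - y) = 2 * J x + 2 * J y - 4 * J ((1/2) *\<^sub>R (x + y))"
      unfolding J_def
      by (simp add: a.diff_left a.diff_right a.add_left a.add_right a.scaleR_left a.scaleR_right
          l.add l.scaleR sym[of y x] algebra_simps)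
    ultimately show ?thesis by simp
  qed
  have "Cauchy v"
  proof (rule metric_CauchyI)
    fix e :: real assume e: "e > 0"
    obtain n0 where n0: "inverse (real (Suc n0)) < \<mu> * e\<^sup>2 / 4"
      using reals_Archimedean[of "\<mu> * e\<^sup>2 / 4"] e \<mu> by auto
    have "dist (v i) (v j) < e" if "i \<ge> n0" "j \<ge> n0" for i j
    proof -
      have "inverse (real (Suc i)) \<le> inverse (real (Suc n0))"
        "inverse (real (Suc j)) \<le> inverse (real (Suc n0))"
        using that by (auto intro!: le_imp_inverse_le)
      then have "\<mu> * (norm (v i - v j))\<^sup>2 < \<mu> * e\<^sup>2"
        using par[OF v(1)[of i] v(1)[of j]] v(2)[of i] v(2)[of j] n0 by linarith
      then show ?thesis using \<mu>(1) e power_less_imp_less_base by (fastforce simp: dist_norm)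
    qed
    then show "\<exists>M. \<forall>i\<ge>M. \<forall>j\<ge>M. dist (v i) (v j) < e" by blast
  qed
  then obtain u where u: "v \<longlonglongrightarrow> u" using Cauchy_convergent convergent_def by blast
  have uK: "u \<in> K" using closed_sequentially[OF K(2)] v(1) u by blast
  have "(\<lambda>n. J (v n)) \<longlonglongrightarrow> J u"
    unfolding J_def using u by (intro tendsto_intros a.tendsto l.tendsto)
  moreover have "(\<lambda>n. m + inverse (real (Suc n))) \<longlonglongrightarrow> m"
    using tendsto_add[OF tendsto_const[of m] LIMSEQ_inverse_real_of_nat] by simp
  ultimately have Ju: "J u \<le> m"
    by (rule LIMSEQ_le) (use v(2) in \<open>auto intro: less_imp_le\<close>)
  have "a u w = l w" if w: "w \<in> K" for w
  proof (rule ccontr)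
    assume ne: "a u w \<noteq> l w"
    define g where "g = a u w - l w"
    \<comment> \<open>\<open>t = - g / q\<close> minimises \<open>2 * t * g + t\<^sup>2 * q\<close>.
      The summand 1 makes \<open>q\<close> positive also for \<open>w = 0\<close> and can only
      enlarge the quadratic term.\<close>
    define q where "q = a w w + 1"
    have "0 \<le> \<mu> * (norm w)\<^sup>2" using \<mu>(1) by simp
    then have q: "q > 0" using \<mu>(2)[OF w] by (simp add: q_def)
    define t where "t = - g / q"
    have "u + t *\<^sub>R w \<in> K" using K(1) uK w by (auto intro: subspace_scale subspace_add)
    then have "J u \<le> J (u + t *\<^sub>R w)" using Ju m_le by force
    moreover have "J (u + t *\<^sub>R w) = J u + 2 * t * g + t\<^sup>2 * a w w"
      unfolding J_def g_def
      by (simp add: a.add_left a.add_right a.scaleR_left a.scaleR_right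
          l.add l.scaleR sym[of w u] algebra_simps power2_eq_square)
    ultimately have "0 \<le> 2 * t * g + t\<^sup>2 * a w w" by simp
    also have "\<dots> \<le> 2 * t * g + t\<^sup>2 * q" by (simp add: q_def distrib_left)
    also have "\<dots> = - (g\<^sup>2 / q)" using q by (simp add: t_def power2_eq_square field_simps)
    finally have "g\<^sup>2 / q \<le> 0" by simp
    moreover have "g\<^sup>2 / q > 0" using q ne by (simp add: g_def)
    ultimately show False by simp
  qed
  then show ?thesis using uK by blast
qed

section \<open>The norm and the dual norm of a compatible scalar product\<close>

locale compatible_product =
  fixes b :: "'e::{real_inner, banach} \<Rightarrow> 'e \<Rightarrow> real"
  assumes compatible: "compatible_scalar_product b"
begin

lemma bilinear: "bilinear b"
  using compatible unfolding compatible_scalar_product_def by (rule conjunct1)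

lemma sym: "b v w = b w v"
  using compatible unfolding compatible_scalar_product_def by blast

lemma pos: "v \<noteq> 0 \<Longrightarrow> b v v > 0"
  using compatible unfolding compatible_scalar_product_def by blast

lemmas expand = bilinear_ladd[OF bilinear] bilinear_radd[OF bilinear] bilinear_lmul[OF bilinear]
  bilinear_rmul[OF bilinear] bilinear_lsub[OF bilinear] bilinear_rsub[OF bilinear]
  bilinear_lneg[OF bilinear] bilinear_rneg[OF bilinear] bilinear_lzero[OF bilinear]
  bilinear_rzero[OF bilinear]

lemma nonneg: "0 \<le> b v v"
  using pos[of v] by (cases "v = 0") (auto simp: expand)

lemma ip_norm_power2: "(ip_norm b v)\<^sup>2 = b v v"
  using nonneg by (simp add: ip_norm_def)

lemma ip_norm_nonneg [simp]: "0 \<le> ip_norm b v"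
  using nonneg by (simp add: ip_norm_def)

lemma ip_norm_eq_0 [simp]: "ip_norm b v = 0 \<longleftrightarrow> v = 0"
  using pos[of v] by (cases "v = 0") (auto simp: ip_norm_def expand)

lemma ip_norm_pos: "v \<noteq> 0 \<Longrightarrow> 0 < ip_norm b v"
  using ip_norm_nonneg[of v] ip_norm_eq_0[of v] by linarith

lemma ip_norm_0 [simp]: "ip_norm b 0 = 0"
  by simp

lemma ip_norm_scaleR: "ip_norm b (t *\<^sub>R v) = \<bar>t\<bar> * ip_norm b v"
proof -
  have "b (t *\<^sub>R v) (t *\<^sub>R v) = t\<^sup>2 * b v v" by (simp add: expand power2_eq_square)
  then show ?thesis by (simp add: ip_norm_def real_sqrt_mult)
qed

lemma ip_norm_minus [simp]: "ip_norm b (- v) = ip_norm b v"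
  by (simp add: ip_norm_def expand)

lemma Cauchy_Schwarz: "\<bar>b v w\<bar> \<le> ip_norm b v * ip_norm b w"
proof (cases "w = 0")
  case True
  then show ?thesis by (simp add: expand)
next
  case False
  then have w: "b w w > 0" by (rule pos)
  have "0 \<le> b (v - (b v w / b w w) *\<^sub>R w) (v - (b v w / b w w) *\<^sub>R w)" by (rule nonneg)
  also have "\<dots> = b v v - (b v w)\<^sup>2 / b w w"
    using w by (simp add: expand sym[of w v] power2_eq_square)
  finally have "(b v w)\<^sup>2 \<le> b v v * b w w" using w by (simp add: field_simps)
  then have "sqrt ((b v w)\<^sup>2) \<le> sqrt (b v v * b w w)" by (rule real_sqrt_le_mono)
  then show ?thesis by (simp only: real_sqrt_abs ip_norm_def real_sqrt_mult)
qed

lemma ip_norm_triangle: "ip_norm b (v + w) \<le> ip_norm b v + ip_norm b w"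
proof (rule power2_le_imp_le)
  have "(ip_norm b (v + w))\<^sup>2 = b v v + 2 * b v w + b w w"
    by (simp add: ip_norm_power2 expand sym[of w v])
  also have "\<dots> \<le> (ip_norm b v + ip_norm b w)\<^sup>2"
    using Cauchy_Schwarz[of v w] by (simp add: power2_sum ip_norm_power2)
  finally show "(ip_norm b (v + w))\<^sup>2 \<le> (ip_norm b v + ip_norm b w)\<^sup>2" .
qed simp

lemma norm_equiv:
  obtains m C where "m > 0" "C > 0" "\<And>v. m * norm v \<le> ip_norm b v" "\<And>v. ip_norm b v \<le> C * norm v"
proof -
  obtain m C where mC: "m > 0" "\<And>v. m * norm v \<le> ip_norm b v" "\<And>v. ip_norm b v \<le> C * norm v"
    using compatible unfolding compatible_scalar_product_def ip_norm_def by blast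
  have "ip_norm b v \<le> max C 1 * norm v" for v
    using mC(3)[of v] by (rule order_trans) (simp add: mult_right_mono)
  with mC that[of m "max C 1"] show thesis by simp
qed

lemma bounded_bilinear: "bounded_bilinear b"
proof -
  obtain m C where mC: "m > 0" "C > 0" "\<And>v. m * norm v \<le> ip_norm b v" "\<And>v. ip_norm b v \<le> C * norm v"
    by (rule norm_equiv) blast
  have "norm (b v w) \<le> norm v * norm w * (C * C)" for v w
  proof -
    have "\<bar>b v w\<bar> \<le> (C * norm v) * (C * norm w)"
      using Cauchy_Schwarz[of v w] mult_mono[OF mC(4)[of v] mC(4)[of w]] mC(2) by fastforce
    then show ?thesis by (simp add: mult_ac)
  qed
  then show ?thesis
    by (intro bounded_bilinear.intro exI[of _ "C * C"] allI) (auto simp: expand)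
qed

lemma ip_norm_less_open: "open {v. ip_norm b v < r}"
proof -
  interpret bounded_bilinear b by (rule bounded_bilinear)
  show ?thesis
    unfolding ip_norm_def by (intro open_Collect_less continuous_intros continuous_on)
qed

text \<open>A supremum of reals bounds its members only if the set is bounded above; equivalence
  with the norm of \<open>'e\<close> supplies the bound \<open>norm l / m\<close>.\<close>

lemma blinfun_le_dual_norm: "blinfun_apply l v \<le> dual_norm b l * ip_norm b v"
proof (cases "v = 0")
  case False
  obtain m C where mC: "m > 0" "C > 0" "\<And>v. m * norm v \<le> ip_norm b v" "\<And>v. ip_norm b v \<le> C * norm v"
    by (rule norm_equiv) blast
  have bound: "l u / ip_norm b u \<le> norm l / m" for u
  proof (cases "u = 0")
    case False
    have "l u \<le> norm l * norm u" using norm_blinfun[of l u] by simp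
    also have "\<dots> \<le> norm l * (ip_norm b u / m)"
      using mC(1) mC(3)[of u] by (intro mult_left_mono) (auto simp: field_simps)
    finally show ?thesis using ip_norm_pos[OF False] by (simp add: field_simps)
  qed (use mC in auto)
  have "l v / ip_norm b v \<le> dual_norm b l"
    unfolding dual_norm_def
    by (rule cSUP_upper) (use bound in \<open>auto simp: bdd_above_def\<close>)
  then show ?thesis using ip_norm_pos[OF False] by (simp add: field_simps)
qed simp

lemma abs_blinfun_le_dual_norm: "\<bar>blinfun_apply l v\<bar> \<le> dual_norm b l * ip_norm b v"
  using blinfun_le_dual_norm[of l v] blinfun_le_dual_norm[of l "- v"] by (simp add: blinfun.minus_right)

end

section \<open>The right inverse of a surjection with values orthogonal to its kernel\<close>

locale surjective_constraint = compatible_product b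
  for b :: "'e::{real_inner, banach} \<Rightarrow> 'e \<Rightarrow> real" +
  fixes A :: "'e \<Rightarrow>\<^sub>L 'f::banach"
  assumes surj: "surj (blinfun_apply A)"
begin

lemma subspace_kernel: "subspace {u. A u = 0}" and closed_kernel: "closed {u. A u = 0}"
  by (auto simp: subspace_def blinfun.bilinear_simps
      intro!: closed_Collect_eq continuous_intros)

text \<open>Take any preimage \<open>v0\<close> and subtract its orthogonal projection
  \<open>k\<close> onto the kernel, which \<open>symmetric_coercive_solution\<close> supplies for
  the scalar product itself. This gives the description in \<open>pseudo_inverse\<close> a
  referent.\<close>

lemma pseudo_inverse_ex1: "\<exists>!v. A v = w \<and> (\<forall>u. A u = 0 \<longrightarrow> b v u = 0)"
proof -
  obtain v0 where v0: "A v0 = w" using surj by (metis surjD)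
  obtain m C where mC: "m > 0" "C > 0" "\<And>v. m * norm v \<le> ip_norm b v" "\<And>v. ip_norm b v \<le> C * norm v"
    by (rule norm_equiv) blast
  have "m\<^sup>2 * (norm v)\<^sup>2 \<le> b v v" for v
    using power_mono[OF mC(3)[of v], of 2] mC(1) by (simp add: ip_norm_power2 power_mult_distrib)
  then obtain k where k: "A k = 0" "\<And>u. A u = 0 \<Longrightarrow> b k u = b v0 u"
    using symmetric_coercive_solution[OF bounded_bilinear sym subspace_kernel closed_kernel, of "m\<^sup>2" "b v0"]
      bounded_bilinear.bounded_linear_right[OF bounded_bilinear] mC(1) by auto
  show ?thesis
  proof
    show "A (v0 - k) = w \<and> (\<forall>u. A u = 0 \<longrightarrow> b (v0 - k) u = 0)"
      using v0 k by (simp add: blinfun.diff_right expand)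
    fix v assume v: "A v = w \<and> (\<forall>u. A u = 0 \<longrightarrow> b v u = 0)"
    have "A (v - (v0 - k)) = 0" using v v0 k by (simp add: blinfun.diff_right)
    then have "b v (v - (v0 - k)) = 0" "b v0 (v - (v0 - k)) = b k (v - (v0 - k))"
      using v k(2) by auto
    then have "b v (v - (v0 - k)) = 0" "b (v0 - k) (v - (v0 - k)) = 0"
      by (auto simp only: bilinear_lsub[OF bilinear])
    then have "b (v - (v0 - k)) (v - (v0 - k)) = 0"
      by (subst bilinear_lsub[OF bilinear]) simp
    then show "v = v0 - k" using pos[of "v - (v0 - k)"] by force
  qed
qed

abbreviation "pinv \<equiv> pseudo_inverse b A"

lemma apply_pinv [simp]: "A (pinv w) = w"
  using theI'[OF pseudo_inverse_ex1[of w]] unfolding pseudo_inverse_def by (rule conjunct1)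

lemma pinv_orth: "A u = 0 \<Longrightarrow> b (pinv w) u = 0"
  using theI'[OF pseudo_inverse_ex1[of w]] unfolding pseudo_inverse_def by simp

lemma pinv_unique: "A v = w \<Longrightarrow> (\<And>u. A u = 0 \<Longrightarrow> b v u = 0) \<Longrightarrow> pinv w = v"
  unfolding pseudo_inverse_def by (rule the1_equality[OF pseudo_inverse_ex1]) blast

lemma pinv_add: "pinv (v + w) = pinv v + pinv w"
  by (rule pinv_unique) (auto simp: blinfun.add_right expand pinv_orth)

lemma pinv_scaleR: "pinv (t *\<^sub>R w) = t *\<^sub>R pinv w"
  by (rule pinv_unique) (auto simp: blinfun.scaleR_right expand pinv_orth)

lemma pinv_projection: "A (v - pinv (A v)) = 0"
  by (simp add: blinfun.diff_right)

text \<open>\<open>v\<close> splits orthogonally into \<open>pinv (A v)\<close> and a kernel vector.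
  Both projections therefore have norm at most 1 in \<open>ip_norm b\<close>, so splitting into
  normal and tangential parts costs no factor that depends on the point.\<close>

lemma Pythagoras: "(ip_norm b v)\<^sup>2 = (ip_norm b (pinv (A v)))\<^sup>2 + (ip_norm b (v - pinv (A v)))\<^sup>2"
proof -
  define p where "p = pinv (A v)"
  have "b p (v - p) = 0" unfolding p_def by (rule pinv_orth[OF pinv_projection])
  then have "b p v = b p p" by (simp add: expand)
  then show ?thesis
    unfolding p_def[symmetric] by (simp add: ip_norm_power2 expand sym[of v p])
qed

lemma ip_norm_pinv_apply_le: "ip_norm b (pinv (A v)) \<le> ip_norm b v"
  by (rule power2_le_imp_le) (use Pythagoras[of v] in simp_all)

lemma ip_norm_projection_le: "ip_norm b (v - pinv (A v)) \<le> ip_norm b v"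
  by (rule power2_le_imp_le) (use Pythagoras[of v] in simp_all)

text \<open>\<open>pinv w\<close> is the preimage of least \<open>ip_norm\<close>, hence bounded by
  the one from the open mapping estimate. The constant \<open>C * K / m\<close> depends on the
  scalar product and on \<open>A\<close>, so it must stay out of the uniform estimates, which use
  only linearity and continuity.\<close>

lemma bounded_linear_pinv: "bounded_linear pinv"
proof -
  obtain m C where mC: "m > 0" "C > 0" "\<And>v. m * norm v \<le> ip_norm b v" "\<And>v. ip_norm b v \<le> C * norm v"
    by (rule norm_equiv) blast
  obtain K where K: "K > 0" "\<And>w. \<exists>v. A v = w \<and> norm v \<le> K * norm w"
    using surj_blinfun_bounded_solution[OF surj] by blast
  have "norm (pinv w) \<le> norm w * (C * K / m)" for w
  proof -
    obtain v where v: "A v = w" "norm v \<le> K * norm w" using K(2) by blast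
    have "m * norm (pinv w) \<le> C * norm v"
      using mC(3)[of "pinv w"] ip_norm_pinv_apply_le[of v] mC(4)[of v] v(1) by simp
    also have "\<dots> \<le> C * (K * norm w)" using v mC(2) by simp
    finally show ?thesis using mC(1) by (simp add: field_simps)
  qed
  then show ?thesis
    by (rule bounded_linear_intro[rotated 2]) (auto simp: pinv_add pinv_scaleR)
qed

end


section \<open>Twice continuously differentiable maps\<close>

lemma D_eqI: "(g has_derivative blinfun_apply L) (at x) \<Longrightarrow> D g x = L"
  unfolding D_def by (metis blinfun_apply_inverse frechet_derivative_at)

lemma has_derivative_D:
  assumes "(g has_derivative g') (at x)"
  shows "(g has_derivative blinfun_apply (D g x)) (at x)"
proof -
  have "blinfun_apply (Blinfun g') = g'"
    using has_derivative_bounded_linear[OF assms] by (rule bounded_linear_Blinfun_apply)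
  with assms D_eqI[of g "Blinfun g'" x] show ?thesis by metis
qed

lemma D_cong_open:
  assumes "open T" "x \<in> T" "\<And>y. y \<in> T \<Longrightarrow> f y = g y"
  shows "D f x = D g x"
proof -
  have "(f has_derivative L) (at x) \<longleftrightarrow> (g has_derivative L) (at x)" for L
    using assms has_derivative_transform_within_open[of f L x UNIV T g]
      has_derivative_transform_within_open[of g L x UNIV T f] by auto
  then show ?thesis by (simp add: D_def frechet_derivative_def)
qed

lemma D2_cong_open:
  assumes "open T" "x \<in> T" "\<And>y. y \<in> T \<Longrightarrow> f y = g y"
  shows "D2 f x = D2 g x"
  unfolding D2_def by (rule D_cong_open[OF assms(1,2)]) (rule D_cong_open[OF assms(1) _ assms(3)])

lemma C2_on_has_derivative:
  assumes "C2_on S g" "x \<in> S"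
  shows "(g has_derivative blinfun_apply (D g x)) (at x)"
  using assms has_derivative_D unfolding C2_on_def by blast

lemma C2_on_has_derivative_D:
  assumes "C2_on S g" "open S" "x \<in> S"
  shows "(D g has_derivative blinfun_apply (D2 g x)) (at x)"
proof -
  obtain g' g'' where g: "\<And>x. x \<in> S \<Longrightarrow> (g has_derivative blinfun_apply (g' x)) (at x)"
      "\<And>x. x \<in> S \<Longrightarrow> (g' has_derivative blinfun_apply (g'' x)) (at x)"
    using assms(1) unfolding C2_on_def by blast
  have "(D g has_derivative blinfun_apply (g'' x)) (at x)"
    using has_derivative_transform_within_open[OF g(2)[OF assms(3)] assms(2,3)] D_eqI[OF g(1)] by force
  then show ?thesis unfolding D2_def by (rule has_derivative_D)
qed

lemma C2_on_continuous_D2: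
  assumes "C2_on S g" "open S"
  shows "continuous_on S (D2 g)"
proof -
  obtain g' g'' where g: "\<And>x. x \<in> S \<Longrightarrow> (g has_derivative blinfun_apply (g' x)) (at x)"
      "\<And>x. x \<in> S \<Longrightarrow> (g' has_derivative blinfun_apply (g'' x)) (at x)" "continuous_on S g''"
    using assms(1) unfolding C2_on_def by blast
  have "D2 g x = g'' x" if "x \<in> S" for x
    unfolding D2_def
    by (rule D_eqI, rule has_derivative_transform_within_open[OF g(2)[OF that] assms(2) that])
      (use D_eqI[OF g(1)] in force)
  with g(3) show ?thesis by (metis continuous_on_cong)
qed

lemma C2_on_continuous:
  assumes "C2_on S g"
  shows "continuous_on S g"
  by (rule has_derivative_continuous_on, rule has_derivative_at_withinI)
    (rule C2_on_has_derivative[OF assms])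

lemma C2_on_continuous_D:
  assumes "C2_on S g" "open S"
  shows "continuous_on S (D g)"
  by (rule has_derivative_continuous_on, rule has_derivative_at_withinI)
    (rule C2_on_has_derivative_D[OF assms])

text \<open>\<open>D g\<close> and \<open>D2 g\<close> are determined by \<open>g\<close>, so they
  serve as witnesses on all of \<open>S\<close> and the local ones need not be matched with each
  other.\<close>

lemma C2_on_locally:
  assumes "\<And>x. x \<in> S \<Longrightarrow> \<exists>T. open T \<and> x \<in> T \<and> C2_on T g"
  shows "C2_on S g"
  unfolding C2_on_def
proof (intro exI[of _ "D g"] exI[of _ "D2 g"] conjI ballI)
  fix x assume "x \<in> S"
  then obtain T where "open T" "x \<in> T" "C2_on T g" using assms by blast
  then show "(g has_derivative blinfun_apply (D g x)) (at x)"
    "(D g has_derivative blinfun_apply (D2 g x)) (at x)"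
    by (auto intro: C2_on_has_derivative C2_on_has_derivative_D)
next
  have "isCont (D2 g) x" if "x \<in> S" for x
    using assms[OF that] C2_on_continuous_D2 continuous_on_eq_continuous_at by blast
  then show "continuous_on S (D2 g)"
    by (simp add: continuous_at_imp_continuous_on)
qed

lemma C2_on_subset: "C2_on S g \<Longrightarrow> T \<subseteq> S \<Longrightarrow> C2_on T g"
  unfolding C2_on_def by (meson continuous_on_subset subsetD)

lemma C2_on_cong:
  assumes "C2_on S f" "open S" "\<And>x. x \<in> S \<Longrightarrow> f x = g x"
  shows "C2_on S g"
proof -
  have Deq: "D g x = D f x" "D2 g x = D2 f x" if "x \<in> S" for x
    using D_cong_open[OF assms(2) that assms(3)] D2_cong_open[OF assms(2) that assms(3)] by auto
  show ?thesis
    unfolding C2_on_def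
  proof (intro exI[of _ "D f"] exI[of _ "D2 f"] conjI ballI)
    fix x assume x: "x \<in> S"
    show "(g has_derivative blinfun_apply (D f x)) (at x)"
      using has_derivative_transform_within_open[OF C2_on_has_derivative[OF assms(1) x] assms(2) x assms(3)] .
    show "(D f has_derivative blinfun_apply (D2 f x)) (at x)"
      using C2_on_has_derivative_D[OF assms(1,2) x] .
  qed (rule C2_on_continuous_D2[OF assms(1,2)])
qed

lemma C2_on_open_vimage:
  assumes "C2_on S f" "open S" "open T"
  shows "open {x\<in>S. f x \<in> T}"
  using continuous_open_preimage[OF C2_on_continuous[OF assms(1)] assms(2,3)]
  by (simp add: vimage_def Int_def)

lemma C2_on_affine:
  assumes "bounded_linear l"
  shows "C2_on S (\<lambda>x. l x + a)" and "D (\<lambda>x. l x + a) x = Blinfun l" and "D2 (\<lambda>x. l x + a) x = 0"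
proof -
  have l: "((\<lambda>x. l x + a) has_derivative blinfun_apply (Blinfun l)) (at x)" for x
    by (rule derivative_eq_intros bounded_linear_imp_has_derivative assms refl)+
      (simp add: bounded_linear_Blinfun_apply[OF assms])
  then have D: "D (\<lambda>x. l x + a) x = Blinfun l" for x by (rule D_eqI)
  then have "D (\<lambda>x. l x + a) = (\<lambda>x. Blinfun l)" by blast
  then have "(D (\<lambda>x. l x + a) has_derivative blinfun_apply 0) (at x)" for x
    by (simp add: zero_blinfun.rep_eq)
  moreover from this show "D2 (\<lambda>x. l x + a) x = 0" unfolding D2_def by (rule D_eqI)
  ultimately show "C2_on S (\<lambda>x. l x + a)"
    unfolding C2_on_def
    by (intro exI[of _ "D (\<lambda>x. l x + a)"] exI[of _ "\<lambda>_. 0"]) (auto simp: D l)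
  show "D (\<lambda>x. l x + a) x = Blinfun l" by (rule D)
qed

lemma C2_on_id: "C2_on S (\<lambda>x. x)"
  using C2_on_affine(1)[OF bounded_linear_ident, of S 0] by simp

lemma C2_on_add:
  assumes f: "C2_on S f" and g: "C2_on S g" and S: "open S"
  shows "C2_on S (\<lambda>x. f x + g x)"
    and "x \<in> S \<Longrightarrow> D (\<lambda>x. f x + g x) x = D f x + D g x"
    and "x \<in> S \<Longrightarrow> D2 (\<lambda>x. f x + g x) x = D2 f x + D2 g x"
proof -
  have 1: "((\<lambda>x. f x + g x) has_derivative blinfun_apply (D f x + D g x)) (at x)" if "x \<in> S" for x
    using C2_on_has_derivative[OF f that] C2_on_has_derivative[OF g that]
    by (auto intro!: derivative_eq_intros simp: blinfun.add_left)
  have 2: "((\<lambda>x. D f x + D g x) has_derivative blinfun_apply (D2 f x + D2 g x)) (at x)" if "x \<in> S" for x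
    using C2_on_has_derivative_D[OF f S that] C2_on_has_derivative_D[OF g S that]
    by (auto intro!: derivative_eq_intros simp: blinfun.add_left)
  show D: "D (\<lambda>x. f x + g x) x = D f x + D g x" if "x \<in> S" for x
    using 1[OF that] by (rule D_eqI)
  show "D2 (\<lambda>x. f x + g x) x = D2 f x + D2 g x" if "x \<in> S" for x
    unfolding D2_def
    using has_derivative_transform_within_open[OF 2[OF that] S that]
    by (intro D_eqI) (simp add: D D2_def)
  show "C2_on S (\<lambda>x. f x + g x)"
    unfolding C2_on_def
  proof (intro exI[of _ "\<lambda>x. D f x + D g x"] exI[of _ "\<lambda>x. D2 f x + D2 g x"] conjI ballI)
    show "continuous_on S (\<lambda>x. D2 f x + D2 g x)"
      by (intro continuous_on_add C2_on_continuous_D2[OF f S] C2_on_continuous_D2[OF g S])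
  qed (use 1 2 in auto)
qed

text \<open>The second derivative of a composite, in curried form. Building it from
  \<open>o\<^sub>L\<close> and its one-sided versions makes it an operator whose continuous
  dependence on the four factors follows from continuity rules; \<open>D2_comp_apply\<close>
  recovers the familiar expression.\<close>

definition D2_comp :: "('b::real_normed_vector \<Rightarrow>\<^sub>L 'b \<Rightarrow>\<^sub>L 'c::real_normed_vector) \<Rightarrow>
    ('a::real_normed_vector \<Rightarrow>\<^sub>L 'b) \<Rightarrow> ('b \<Rightarrow>\<^sub>L 'c) \<Rightarrow> ('a \<Rightarrow>\<^sub>L 'a \<Rightarrow>\<^sub>L 'b) \<Rightarrow> ('a \<Rightarrow>\<^sub>L 'a \<Rightarrow>\<^sub>L 'c)" where
  "D2_comp G2 F1 G1 F2 =
     (bounded_bilinear.prod_left (o\<^sub>L) F1 o\<^sub>L (G2 o\<^sub>L F1)) + (bounded_bilinear.prod_right (o\<^sub>L) G1 o\<^sub>L F2)"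

lemmas compose_prod_left = bounded_bilinear.prod_left.rep_eq[OF bounded_bilinear_blinfun_compose]
lemmas compose_prod_right = bounded_bilinear.prod_right.rep_eq[OF bounded_bilinear_blinfun_compose]
lemmas continuous_on_compose_prod [continuous_intros] =
  bounded_linear.continuous_on[OF bounded_bilinear.bounded_linear_prod_left[OF bounded_bilinear_blinfun_compose]]
  bounded_linear.continuous_on[OF bounded_bilinear.bounded_linear_prod_right[OF bounded_bilinear_blinfun_compose]]

lemma D2_comp_apply: "D2_comp G2 F1 G1 F2 h = (G2 (F1 h) o\<^sub>L F1) + (G1 o\<^sub>L F2 h)"
  unfolding D2_comp_def by (simp add: blinfun.add_left compose_prod_left compose_prod_right)

lemma C2_on_compose:
  assumes f: "C2_on S f" and g: "C2_on T g" and S: "open S" and T: "open T"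
    and ST: "\<And>x. x \<in> S \<Longrightarrow> f x \<in> T"
  shows "C2_on S (\<lambda>x. g (f x))"
    and "x \<in> S \<Longrightarrow> D (\<lambda>x. g (f x)) x = D g (f x) o\<^sub>L D f x"
    and "x \<in> S \<Longrightarrow> D2 (\<lambda>x. g (f x)) x v w = D2 g (f x) (D f x v) (D f x w) + D g (f x) (D2 f x v w)"
proof -
  let ?D2 = "\<lambda>x. D2_comp (D2 g (f x)) (D f x) (D g (f x)) (D2 f x)"
  have 1: "((\<lambda>x. g (f x)) has_derivative blinfun_apply (D g (f x) o\<^sub>L D f x)) (at x)" if "x \<in> S" for x
    using has_derivative_compose[OF C2_on_has_derivative[OF f that] C2_on_has_derivative[OF g ST[OF that]]]
    by (simp add: blinfun_compose.rep_eq o_def)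
  have 2: "((\<lambda>x. D g (f x) o\<^sub>L D f x) has_derivative blinfun_apply (?D2 x)) (at x)" if "x \<in> S" for x
  proof -
    have "((\<lambda>x. D g (f x)) has_derivative (\<lambda>h. D2 g (f x) (D f x h))) (at x)"
      by (rule has_derivative_compose[OF C2_on_has_derivative[OF f that]
            C2_on_has_derivative_D[OF g T ST[OF that]]])
    from bounded_bilinear.FDERIV[OF bounded_bilinear_blinfun_compose this C2_on_has_derivative_D[OF f S that]]
    show ?thesis by (rule has_derivative_eq_rhs) (auto simp: D2_comp_apply add.commute)
  qed
  have 3: "continuous_on S ?D2"
    unfolding D2_comp_def
    by (intro continuous_intros C2_on_continuous_D2[OF f S] C2_on_continuous_D[OF f S]
        continuous_on_compose2[OF C2_on_continuous_D2[OF g T]]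
        continuous_on_compose2[OF C2_on_continuous_D[OF g T]]
        C2_on_continuous[OF f]) (auto simp: ST)
  show D: "D (\<lambda>x. g (f x)) x = D g (f x) o\<^sub>L D f x" if "x \<in> S" for x
    using 1[OF that] by (rule D_eqI)
  have "D2 (\<lambda>x. g (f x)) x = ?D2 x" if "x \<in> S"
    unfolding D2_def
    using has_derivative_transform_within_open[OF 2[OF that] S that]
    by (intro D_eqI) (simp add: D D2_def)
  then show "D2 (\<lambda>x. g (f x)) x v w = D2 g (f x) (D f x v) (D f x w) + D g (f x) (D2 f x v w)" if "x \<in> S"
    using that by (simp add: D2_comp_apply blinfun.add_left)
  show "C2_on S (\<lambda>x. g (f x))"
    unfolding C2_on_def
    by (intro exI[of _ "\<lambda>x. D g (f x) o\<^sub>L D f x"] exI[of _ ?D2] conjI ballI 1 2 3)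
qed

lemma has_derivative_ray:
  assumes "(g has_derivative g') (at (a + s *\<^sub>R d))"
  shows "((\<lambda>s. g (a + s *\<^sub>R d)) has_derivative (\<lambda>h. h *\<^sub>R g' d)) (at s within T)"
proof -
  have "((\<lambda>s. a + s *\<^sub>R d) has_derivative (\<lambda>h. h *\<^sub>R d)) (at s)"
    by (auto intro!: derivative_eq_intros)
  then have "((\<lambda>s. g (a + s *\<^sub>R d)) has_derivative (\<lambda>h. g' (h *\<^sub>R d))) (at s)"
    by (rule has_derivative_compose) (rule assms)
  then show ?thesis
    by (simp add: has_derivative_at_withinI linear_cmul[OF bounded_linear.linear[OF has_derivative_bounded_linear[OF assms]]])
qed

text \<open>The double difference of \<open>g\<close> along \<open>t *\<^sub>R v\<close> and
  \<open>t *\<^sub>R w\<close> is unchanged when the two directions are exchanged, while up to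
  \<open>e * t\<^sup>2\<close> it equals \<open>t\<^sup>2 *\<^sub>R D2 g x v w\<close>. Symmetry is
  required later because the Lagrange-Newton equation on the kernel is solved by
  minimisation.\<close>

lemma symmetric_D2:
  fixes g :: "'a::real_normed_vector \<Rightarrow> 'b::real_normed_vector"
  assumes g: "C2_on S g" and S: "open S" and x: "x \<in> S"
  shows "D2 g x v w = D2 g x w v"
proof -
  have key: "\<exists>r>0. \<forall>t. 0 < t \<longrightarrow> t < r \<longrightarrow>
      norm ((g (x + t *\<^sub>R v + t *\<^sub>R w) - g (x + t *\<^sub>R w)) - (g (x + t *\<^sub>R v) - g x)
         - t\<^sup>2 *\<^sub>R D2 g x v w) \<le> e * t\<^sup>2" if e: "e > 0" for e v w
  proof -
    define n where "n = norm v + norm w + 1"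
    \<comment> \<open>The derivative of \<open>\<phi>\<close> below is \<open>t\<close> times an
      operator of norm at most \<open>2 * e' * (t * n)\<close>, applied to \<open>w\<close>. Its
      size is at most \<open>2 * e' * n\<^sup>2 * t\<^sup>2\<close>, which is
      \<open>e * t\<^sup>2\<close>.\<close>
    define e' where "e' = e / (2 * n * n)"
    have n: "n > 0" "norm v \<le> n" "norm w \<le> n" by (auto simp: n_def add_nonneg_pos)
    have e': "e' > 0" using e n by (simp add: e'_def)
    obtain r1 where r1: "r1 > 0" "\<And>y. norm (y - x) < r1 \<Longrightarrow>
        norm (D g y - D g x - D2 g x (y - x)) \<le> e' * norm (y - x)"
      using C2_on_has_derivative_D[OF g S x] e' unfolding has_derivative_at_alt by blast
    obtain r2 where r2: "r2 > 0" "ball x r2 \<subseteq> S" using S x open_contains_ball by blast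
    define r where "r = min r1 r2 / n"
    have bound: "norm ((g (x + t *\<^sub>R v + t *\<^sub>R w) - g (x + t *\<^sub>R w)) - (g (x + t *\<^sub>R v) - g x)
         - t\<^sup>2 *\<^sub>R D2 g x v w) \<le> e * t\<^sup>2" if t: "0 < t" "t < r" for t
    proof -
      have tn: "t * n < min r1 r2" using t n(1) by (simp add: r_def field_simps)
      \<comment> \<open>\<open>\<phi>\<close> follows, along \<open>w\<close>, the difference of
        \<open>g\<close> at points that are \<open>t *\<^sub>R v\<close> apart, less its expected
        value. The quantity to be bounded is \<open>\<phi> 1 - \<phi> 0\<close>.\<close>
      define \<phi> where "\<phi> s = g (x + t *\<^sub>R v + s *\<^sub>R (t *\<^sub>R w)) - g (x + s *\<^sub>R (t *\<^sub>R w)) - s *\<^sub>R (t\<^sup>2 *\<^sub>R D2 g x v w)" for s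
      have le: "norm (a *\<^sub>R (t *\<^sub>R v) + s *\<^sub>R (t *\<^sub>R w)) \<le> t * n" if "0 \<le> s" "s \<le> 1" "0 \<le> a" "a \<le> 1" for s a
      proof -
        have "norm (a *\<^sub>R (t *\<^sub>R v) + s *\<^sub>R (t *\<^sub>R w)) \<le> a * (t * norm v) + s * (t * norm w)"
          by (rule norm_triangle_le) (use that t in simp)
        also have "\<dots> \<le> 1 * (t * norm v) + 1 * (t * norm w)"
          using that t by (intro add_mono mult_right_mono) auto
        also have "\<dots> \<le> t * n" using t by (simp add: n_def distrib_left)
        finally show ?thesis .
      qed
      have le1: "norm (t *\<^sub>R v + s *\<^sub>R (t *\<^sub>R w)) \<le> t * n" and le0: "norm (s *\<^sub>R (t *\<^sub>R w)) \<le> t * n"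
        if "s \<in> {0..1}" for s
        using le[of s 1] le[of s 0] that by auto
      have inS: "x + t *\<^sub>R v + s *\<^sub>R (t *\<^sub>R w) \<in> S" "x + s *\<^sub>R (t *\<^sub>R w) \<in> S" if "s \<in> {0..1}" for s
      proof -
        have *: "x + h \<in> S" if "norm h \<le> t * n" for h
          using that tn by (intro r2(2)[THEN subsetD]) (simp add: dist_norm)
        show "x + t *\<^sub>R v + s *\<^sub>R (t *\<^sub>R w) \<in> S" "x + s *\<^sub>R (t *\<^sub>R w) \<in> S"
          using *[OF le1[OF that]] *[OF le0[OF that]] by (simp_all add: add.assoc)
      qed
      let ?L = "\<lambda>s. t *\<^sub>R ((D g (x + t *\<^sub>R v + s *\<^sub>R (t *\<^sub>R w)) - D g (x + s *\<^sub>R (t *\<^sub>R w)) - t *\<^sub>R D2 g x v) w)"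
      have deriv: "(\<phi> has_derivative (\<lambda>h. h *\<^sub>R ?L s)) (at s within {0..1})" if s: "s \<in> {0..1}" for s
      proof -
        have "(\<phi> has_derivative (\<lambda>h. h *\<^sub>R D g (x + t *\<^sub>R v + s *\<^sub>R (t *\<^sub>R w)) (t *\<^sub>R w)
            - h *\<^sub>R D g (x + s *\<^sub>R (t *\<^sub>R w)) (t *\<^sub>R w) - h *\<^sub>R (t\<^sup>2 *\<^sub>R D2 g x v w))) (at s within {0..1})"
          unfolding \<phi>_def
          by (intro has_derivative_diff has_derivative_ray C2_on_has_derivative[OF g] inS s
              has_derivative_scaleR_left has_derivative_ident)
        then show ?thesis
          by (rule has_derivative_eq_rhs)
            (simp add: blinfun.bilinear_simps scaleR_diff_right power2_eq_square fun_eq_iff)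
      qed
      have B: "norm (D g (x + t *\<^sub>R v + s *\<^sub>R (t *\<^sub>R w)) - D g (x + s *\<^sub>R (t *\<^sub>R w)) - t *\<^sub>R D2 g x v) \<le> e' * (t * n) + e' * (t * n)"
        if s: "s \<in> {0..1}" for s
      proof -
        let ?a = "t *\<^sub>R v + s *\<^sub>R (t *\<^sub>R w)" and ?b = "s *\<^sub>R (t *\<^sub>R w)"
        have a: "norm (D g (x + ?a) - D g x - D2 g x ?a) \<le> e' * (t * n)"
          using r1(2)[of "x + ?a"] le1[OF s] tn e'
          by (auto intro: order_trans[OF _ mult_left_mono[OF le1[OF s]]])
        have b: "norm (D g (x + ?b) - D g x - D2 g x ?b) \<le> e' * (t * n)"
          using r1(2)[of "x + ?b"] le0[OF s] tn e'
          by (auto intro: order_trans[OF _ mult_left_mono[OF le0[OF s]]] simp del: norm_scaleR)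
        have "D g (x + t *\<^sub>R v + ?b) - D g (x + ?b) - t *\<^sub>R D2 g x v
            = (D g (x + ?a) - D g x - D2 g x ?a) - (D g (x + ?b) - D g x - D2 g x ?b)"
          by (simp add: blinfun.add_right blinfun.scaleR_right algebra_simps)
        also have "norm \<dots> \<le> e' * (t * n) + e' * (t * n)"
          by (rule order_trans[OF norm_triangle_ineq4 add_mono[OF a b]])
        finally show ?thesis .
      qed
      have L: "norm (?L s) \<le> e * t\<^sup>2" if "s \<in> {0..1}" for s
      proof -
        let ?B = "D g (x + t *\<^sub>R v + s *\<^sub>R (t *\<^sub>R w)) - D g (x + s *\<^sub>R (t *\<^sub>R w)) - t *\<^sub>R D2 g x v"

        have "norm (?L s) = t * norm (?B w)" using t by simp
        also have "\<dots> \<le> t * (norm ?B * norm w)"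
          using t by (intro mult_left_mono norm_blinfun) simp
        also have "\<dots> \<le> t * ((e' * (t * n) + e' * (t * n)) * n)"
          using t e' n B[OF that] by (intro mult_left_mono mult_mono) auto
        also have "\<dots> = e * t\<^sup>2" using n(1) by (simp add: e'_def power2_eq_square)
        finally show ?thesis .
      qed
      have "onorm (\<lambda>h. h *\<^sub>R ?L s) \<le> e * t\<^sup>2" if "s \<in> {0..1}" for s
      proof (rule onorm_bound)
        show "norm (h *\<^sub>R ?L s) \<le> e * t\<^sup>2 * norm h" for h
          using mult_right_mono[OF L[OF that], of "norm h"] by (simp only: norm_scaleR) (simp add: mult.commute)
      qed (use e in simp)
      then have "norm (\<phi> 1 - \<phi> 0) \<le> e * t\<^sup>2 * norm (1 - 0::real)"
        using deriv by (intro differentiable_bound[of "{0..1::real}"]) auto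
      then show ?thesis by (simp add: \<phi>_def algebra_simps)
    qed
    have "r > 0" using r1(1) r2(1) n(1) by (simp add: r_def)
    with bound show ?thesis by blast
  qed
  have "norm (D2 g x v w - D2 g x w v) \<le> e" if "e > 0" for e
  proof -
    have e2: "e / 2 > 0" using that by simp
    obtain r1 where r1: "r1 > 0" "\<And>t. 0 < t \<Longrightarrow> t < r1 \<Longrightarrow>
      norm ((g (x + t *\<^sub>R v + t *\<^sub>R w) - g (x + t *\<^sub>R w)) - (g (x + t *\<^sub>R v) - g x)
         - t\<^sup>2 *\<^sub>R D2 g x v w) \<le> e / 2 * t\<^sup>2" using key[OF e2] by blast
    obtain r2 where r2: "r2 > 0" "\<And>t. 0 < t \<Longrightarrow> t < r2 \<Longrightarrow>
      norm ((g (x + t *\<^sub>R w + t *\<^sub>R v) - g (x + t *\<^sub>R v)) - (g (x + t *\<^sub>R w) - g x)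
         - t\<^sup>2 *\<^sub>R D2 g x w v) \<le> e / 2 * t\<^sup>2" using key[OF e2] by blast
    define t where "t = min r1 r2 / 2"
    have t: "0 < t" "t < r1" "t < r2" using r1(1) r2(1) by (auto simp: t_def)
    let ?\<Delta> = "(g (x + t *\<^sub>R v + t *\<^sub>R w) - g (x + t *\<^sub>R w)) - (g (x + t *\<^sub>R v) - g x)"
    have "(g (x + t *\<^sub>R w + t *\<^sub>R v) - g (x + t *\<^sub>R v)) - (g (x + t *\<^sub>R w) - g x) = ?\<Delta>"
      by (simp add: algebra_simps)
    then have n1: "norm (?\<Delta> - t\<^sup>2 *\<^sub>R D2 g x w v) \<le> e / 2 * t\<^sup>2" using r2(2)[OF t(1,3)] by (simp only:)
    have n2: "norm (?\<Delta> - t\<^sup>2 *\<^sub>R D2 g x v w) \<le> e / 2 * t\<^sup>2" using r1(2)[OF t(1,2)] by (simp only:)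
    have "t\<^sup>2 *\<^sub>R (D2 g x v w - D2 g x w v) = (?\<Delta> - t\<^sup>2 *\<^sub>R D2 g x w v) - (?\<Delta> - t\<^sup>2 *\<^sub>R D2 g x v w)"
      by (simp add: scaleR_diff_right)
    also have "norm \<dots> \<le> e / 2 * t\<^sup>2 + e / 2 * t\<^sup>2"
      by (rule order_trans[OF norm_triangle_ineq4 add_mono[OF n1 n2]])
    finally have "t\<^sup>2 * norm (D2 g x v w - D2 g x w v) \<le> t\<^sup>2 * e" by (simp add: mult.commute)
    then show ?thesis using t(1) by simp
  qed
  then have "norm (D2 g x v w - D2 g x w v) \<le> 0" by (rule field_le_epsilon[of _ 0, simplified])
  then show ?thesis by simp
qed


section \<open>Local inverses and constrained minimizers\<close>

text \<open>Everything follows from the identity J(z) - J(y) = - J(z) (A(z) - A(y)) J(y). With the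
  uniform bound \<open>B\<close> it yields continuity of \<open>J\<close> at \<open>y\<close>, and
  using this continuity in the same identity yields the derivative.\<close>

lemma has_derivative_blinfun_inverse:
  fixes A :: "'c::real_normed_vector \<Rightarrow> 'a::real_normed_vector \<Rightarrow>\<^sub>L 'a"
  assumes T: "open T" "y \<in> T"
    and inv: "\<And>z. z \<in> T \<Longrightarrow> A z o\<^sub>L J z = id_blinfun" "\<And>z. z \<in> T \<Longrightarrow> J z o\<^sub>L A z = id_blinfun"
    and B: "\<And>z. z \<in> T \<Longrightarrow> norm (J z) \<le> B"
    and A: "(A has_derivative A') (at y)"
  shows "(J has_derivative (\<lambda>h. - (J y o\<^sub>L (A' h o\<^sub>L J y)))) (at y)"
proof -
  interpret A': bounded_linear A' using A by (rule has_derivative_bounded_linear)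
  have JA: "J z (A z v) = v" "A z (J z v) = v" if "z \<in> T" for z v
    using inv[OF that] by (metis blinfun_apply_blinfun_compose blinfun_apply_id_blinfun)+
  have diff: "J z - J y = - (J z o\<^sub>L ((A z - A y) o\<^sub>L J y))" if "z \<in> T" for z
    by (rule blinfun_eqI) (simp add: blinfun.bilinear_simps JA that T)
  have B0: "0 \<le> B" using B[OF T(2)] norm_ge_zero order_trans by blast
  have tri: "norm (X o\<^sub>L (Y o\<^sub>L Z)) \<le> norm X * (norm Y * norm Z)" for X Y Z :: "'a \<Rightarrow>\<^sub>L 'a"
    by (rule order_trans[OF norm_blinfun_compose]) (intro mult_left_mono norm_blinfun_compose norm_ge_zero)
  have ev: "\<forall>\<^sub>F z in at y. z \<in> T" using T by (rule eventually_at_in_open')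
  have "A \<midarrow>y\<rightarrow> A y" using has_derivative_continuous[OF A] by (simp add: isCont_def)
  then have A0: "((\<lambda>z. B * (norm (A z - A y) * B)) \<longlongrightarrow> 0) (at y)"
    by (intro tendsto_mult_right_zero tendsto_mult_left_zero tendsto_norm_zero LIM_zero)
  have "((\<lambda>z. J z - J y) \<longlongrightarrow> 0) (at y)"
  proof (rule Lim_null_comparison[OF _ A0])
    show "\<forall>\<^sub>F z in at y. norm (J z - J y) \<le> B * (norm (A z - A y) * B)"
      using ev
    proof eventually_elim
      case (elim z)
      have "norm (J z - J y) \<le> norm (J z) * (norm (A z - A y) * norm (J y))"
        using tri unfolding diff[OF elim] norm_minus_cancel by blast
      also have "\<dots> \<le> B * (norm (A z - A y) * B)"
        by (intro mult_mono mult_nonneg_nonneg B elim T(2) norm_ge_zero B0 order_refl)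
      finally show ?case .
    qed
  qed
  then have J0: "((\<lambda>z. norm (J z - J y)) \<longlongrightarrow> 0) (at y)"
    by (rule tendsto_norm_zero)
  obtain K where K: "\<And>h. norm (A' h) \<le> norm h * K" using A'.bounded by blast
  have lim: "((\<lambda>z. norm (J z - J y) * (K * B)
      + B * ((norm (A z - A y - A' (z - y)) / norm (z - y)) * B)) \<longlongrightarrow> 0) (at y)"
    using A J0 unfolding has_derivative_iff_norm
    by (intro tendsto_add_zero tendsto_mult_left_zero tendsto_mult_right_zero) auto
  show ?thesis
    unfolding has_derivative_iff_norm
  proof
    show "bounded_linear (\<lambda>h. - (J y o\<^sub>L (A' h o\<^sub>L J y)))"
      by (intro bounded_linear_minus bounded_linear_compose[OF
            bounded_bilinear.bounded_linear_right[OF bounded_bilinear_blinfun_compose]]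
          bounded_linear_compose[OF
            bounded_bilinear.bounded_linear_left[OF bounded_bilinear_blinfun_compose]] A'.bounded_linear_axioms)
    show "((\<lambda>z. norm (J z - J y - - (J y o\<^sub>L (A' (z - y) o\<^sub>L J y))) / norm (z - y)) \<longlongrightarrow> 0) (at y)"
    proof (rule Lim_null_comparison[OF _ lim])
      show "\<forall>\<^sub>F z in at y. norm (norm (J z - J y - - (J y o\<^sub>L (A' (z - y) o\<^sub>L J y))) / norm (z - y))
          \<le> norm (J z - J y) * (K * B) + B * ((norm (A z - A y - A' (z - y)) / norm (z - y)) * B)"
        using ev eventually_neq_at_within[of y y UNIV]
      proof eventually_elim
        case (elim z)
        let ?h = "z - y"
        have h: "norm ?h > 0" using elim by simp
        have "J z - J y - - (J y o\<^sub>L (A' ?h o\<^sub>L J y))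
            = - ((J z - J y) o\<^sub>L (A' ?h o\<^sub>L J y)) - (J z o\<^sub>L ((A z - A y - A' ?h) o\<^sub>L J y))"
          by (subst diff[OF elim(1)]) (rule blinfun_eqI, simp add: blinfun.bilinear_simps)
        also have "norm \<dots> \<le> norm (J z - J y) * (norm (A' ?h) * norm (J y))
            + norm (J z) * (norm (A z - A y - A' ?h) * norm (J y))"
          using norm_triangle_ineq4 add_mono[OF tri tri] norm_minus_cancel by (metis (no_types, lifting) order_trans)
        also have "\<dots> \<le> norm (J z - J y) * ((norm ?h * K) * B) + B * (norm (A z - A y - A' ?h) * B)"
          by (intro add_mono mult_mono mult_nonneg_nonneg K B elim T(2) norm_ge_zero B0 order_refl
              order_trans[OF norm_ge_zero K])
        finally show ?case using h by (simp add: field_simps)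
      qed
    qed
  qed
qed

text \<open>Neumann inversion by successive approximation. The bound 2 does not depend on
  \<open>A\<close>, as is required of \<open>B\<close> in
  \<open>has_derivative_blinfun_inverse\<close>.\<close>

lemma near_identity_invertible:
  fixes A :: "'a::banach \<Rightarrow>\<^sub>L 'a"
  assumes "norm (A - id_blinfun) \<le> 1/2"
  shows "\<exists>J. A o\<^sub>L J = id_blinfun \<and> J o\<^sub>L A = id_blinfun \<and> norm J \<le> 2"
proof -
  have near: "norm (v - A v) \<le> norm v / 2" for v
  proof -
    have "norm (v - A v) = norm ((A - id_blinfun) v)"
      by (simp add: blinfun.diff_left norm_minus_commute)
    also have "\<dots> \<le> norm (A - id_blinfun) * norm v" by (rule norm_blinfun)
    also have "\<dots> \<le> 1/2 * norm v" using assms by (rule mult_right_mono) simp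
    finally show ?thesis by simp
  qed
  have lower: "norm v \<le> 2 * norm (A v)" for v
    using near[of v] norm_triangle_ineq2[of v "A v"] by linarith
  have "\<exists>v. A v = w \<and> norm v \<le> 2 * 1 * norm w" for w
    by (rule solve_by_successive_approximation[where K' = 1]) (use near in auto)
  then obtain j where j: "\<And>w. A (j w) = w" by metis
  have inj: "u = v" if "A u = A v" for u v
    using lower[of "u - v"] that by (simp add: blinfun.diff_right)
  have jb: "norm (j w) \<le> norm w * 2" for w
    using lower[of "j w"] j[of w] by simp
  have "bounded_linear j"
  proof (rule bounded_linear_intro[OF _ _ jb])
    show "j (u + v) = j u + j v" for u v by (rule inj) (simp add: j blinfun.add_right)
    show "j (t *\<^sub>R u) = t *\<^sub>R j u" for t u by (rule inj) (simp add: j blinfun.scaleR_right)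
  qed
  then have J: "blinfun_apply (Blinfun j) = j" by (rule bounded_linear_Blinfun_apply)
  have "norm (Blinfun j) \<le> 2"
    by (rule norm_blinfun_bound) (use J jb in \<open>auto simp: mult.commute\<close>)
  then show ?thesis
    by (intro exI[of _ "Blinfun j"] conjI blinfun_eqI) (simp_all add: J j inj[OF j])
qed

text \<open>Mean value inequality for \<open>h\<close> minus its linear part at \<open>x0\<close>.
  It compares two arbitrary points near \<open>x0\<close>, which is the form that contraction
  arguments need.\<close>

lemma C2_on_near_linear:
  fixes h :: "'a::real_normed_vector \<Rightarrow> 'b::real_normed_vector"
  assumes h: "C2_on S h" and S: "open S" and x0: "x0 \<in> S" and e: "e > 0"
  shows "\<exists>r>0. ball x0 r \<subseteq> S \<and> (\<forall>x\<in>ball x0 r. norm (D h x - D h x0) \<le> e) \<and>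
    (\<forall>x\<in>ball x0 r. \<forall>y\<in>ball x0 r. norm (h x - h y - D h x0 (x - y)) \<le> e * norm (x - y))"
proof -
  obtain r1 where r1: "r1 > 0" "\<And>x. x \<in> S \<Longrightarrow> dist x x0 < r1 \<Longrightarrow> dist (D h x) (D h x0) < e"
    using C2_on_continuous_D[OF h S] x0 e unfolding continuous_on_iff by metis
  obtain r2 where r2: "r2 > 0" "ball x0 r2 \<subseteq> S" using S x0 open_contains_ball by blast
  define r where "r = min r1 r2"
  have sub: "ball x0 r \<subseteq> S" using r2 by (auto simp: r_def)
  have near: "norm (D h x - D h x0) \<le> e" if "x \<in> ball x0 r" for x
    using r1(2)[of x] that sub by (force simp: r_def dist_norm norm_minus_commute)
  have "norm (h x - h y - D h x0 (x - y)) \<le> e * norm (x - y)" if "x \<in> ball x0 r" "y \<in> ball x0 r" for x y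
  proof -
    have "norm ((h x - D h x0 x) - (h y - D h x0 y)) \<le> e * norm (x - y)"
    proof (rule differentiable_bound[OF convex_ball _ _ that])
      fix u assume u: "u \<in> ball x0 r"
      have "(h has_derivative blinfun_apply (D h u)) (at u)"
        using C2_on_has_derivative[OF h] sub u by blast
      from has_derivative_diff[OF this
          bounded_linear_imp_has_derivative[OF blinfun.bounded_linear_right[of "D h x0"]]]
      show "((\<lambda>x. h x - D h x0 x) has_derivative blinfun_apply (D h u - D h x0)) (at u within ball x0 r)"
        by (simp only: minus_blinfun.rep_eq has_derivative_at_withinI)
      show "onorm (blinfun_apply (D h u - D h x0)) \<le> e"
        using near[OF u] by (simp add: norm_blinfun.rep_eq)
    qed
    then show ?thesis by (simp add: blinfun.diff_right algebra_simps)
  qed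
  moreover have "r > 0" using r1(1) r2(1) by (simp add: r_def)
  ultimately show ?thesis using sub near by blast
qed

lemma C2_local_inverse:
  fixes h :: "'a::banach \<Rightarrow> 'a"
  assumes h: "C2_on S h" and S: "open S" and x0: "x0 \<in> S" and id: "D h x0 = id_blinfun"
  shows "\<exists>W. open W \<and> x0 \<in> W \<and> W \<subseteq> S \<and> inj_on h W \<and> open (h ` W) \<and> C2_on (h ` W) (inv_into W h)"
proof -
  obtain r where r: "r > 0" "ball x0 r \<subseteq> S" "\<And>x. x \<in> ball x0 r \<Longrightarrow> norm (D h x - id_blinfun) \<le> 1/2"
    "\<And>x y. x \<in> ball x0 r \<Longrightarrow> y \<in> ball x0 r \<Longrightarrow> norm (h x - h y - (x - y)) \<le> 1/2 * norm (x - y)"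
    using C2_on_near_linear[OF h S x0, of "1/2"] id by auto
  define W where "W = ball x0 r"
  define g where "g = inv_into W h"
  have W: "open W" "x0 \<in> W" "W \<subseteq> S" using r by (auto simp: W_def)
  have lower: "norm (x - y) \<le> 2 * norm (h x - h y)" if "x \<in> W" "y \<in> W" for x y
    using r(4)[of x y] that norm_triangle_ineq2[of "x - y" "h x - h y"] norm_minus_commute[of "h x - h y" "x - y"]
    by (simp add: W_def)
  have inj: "inj_on h W"
    by (rule inj_onI) (use lower in force)
  have openW: "open (h ` W)"
    unfolding open_contains_ball
  proof clarify
    fix x1 assume x1: "x1 \<in> W"
    obtain s where s: "s > 0" "cball x1 s \<subseteq> W" using W(1) x1 open_contains_cball by blast
    have "y \<in> h ` W" if y: "dist (h x1) y < s / 2" for y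
    proof -
      \<comment> \<open>A fixed point is a preimage of \<open>y\<close>. The map contracts by 1/2
        and moves the centre \<open>x1\<close> by less than \<open>s / 2\<close>, so it maps the
        ball into itself.\<close>
      have "\<exists>!x\<in>cball x1 s. x - (h x - y) = x"
      proof (rule Banach_fix[where c = "1/2"])
        show "complete (cball x1 s)" by (simp add: complete_eq_closed)
        show "cball x1 s \<noteq> {}" using s by auto
        show "(\<lambda>x. x - (h x - y)) ` cball x1 s \<subseteq> cball x1 s"
        proof clarify
          fix x assume x: "x \<in> cball x1 s"
          then have "x \<in> ball x0 r" "x1 \<in> ball x0 r" using s(2) x1 unfolding W_def by blast+
          then have "norm (h x - h x1 - (x - x1)) \<le> 1/2 * norm (x - x1)" by (rule r(4))
          moreover have "norm (x - x1) \<le> s" using x by (simp add: dist_norm norm_minus_commute)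
          moreover have "x1 - (x - (h x - y)) = (h x - h x1 - (x - x1)) + (h x1 - y)" by simp
          then have "norm (x1 - (x - (h x - y))) \<le> norm (h x - h x1 - (x - x1)) + norm (h x1 - y)"
            by (metis norm_triangle_ineq)
          ultimately show "x - (h x - y) \<in> cball x1 s" using y by (simp add: dist_norm)
        qed
        fix x x' assume "x \<in> cball x1 s" "x' \<in> cball x1 s"
        then have "x \<in> ball x0 r" "x' \<in> ball x0 r" using s(2) unfolding W_def by blast+
        then have "norm (h x - h x' - (x - x')) \<le> 1/2 * norm (x - x')" by (rule r(4))
        moreover have "(x - (h x - y)) - (x' - (h x' - y)) = - (h x - h x' - (x - x'))" by simp
        ultimately show "dist (x - (h x - y)) (x' - (h x' - y)) \<le> 1/2 * dist x x'"
          unfolding dist_norm by (metis norm_minus_cancel)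
      qed auto
      then obtain x where "x \<in> cball x1 s" "h x = y" by auto
      then show ?thesis using s(2) by blast
    qed
    then have "ball (h x1) (s/2) \<subseteq> h ` W" by auto
    then show "\<exists>e>0. ball (h x1) e \<subseteq> h ` W" using s(1) by (intro exI[of _ "s/2"]) simp
  qed
  have gh: "g y \<in> W" "h (g y) = y" if "y \<in> h ` W" for y
    unfolding g_def using that by (auto intro: inv_into_into f_inv_into_f)
  have contg: "continuous_on (h ` W) g"
  proof (rule lipschitz_on_continuous_on)
    show "2-lipschitz_on (h ` W) g"
    proof (rule lipschitz_onI)
      fix y y' assume y: "y \<in> h ` W" "y' \<in> h ` W"
      show "dist (g y) (g y') \<le> 2 * dist y y'"
        using lower[OF gh(1)[OF y(1)] gh(1)[OF y(2)]] by (simp only: gh(2)[OF y(1)] gh(2)[OF y(2)] dist_norm)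
    qed simp
  qed
  obtain J where J: "\<And>x. x \<in> W \<Longrightarrow> D h x o\<^sub>L J x = id_blinfun" "\<And>x. x \<in> W \<Longrightarrow> J x o\<^sub>L D h x = id_blinfun"
    "\<And>x. x \<in> W \<Longrightarrow> norm (J x) \<le> 2"
  proof -
    have "\<forall>x\<in>W. \<exists>J. D h x o\<^sub>L J = id_blinfun \<and> J o\<^sub>L D h x = id_blinfun \<and> norm J \<le> 2"
      unfolding W_def by (intro ballI near_identity_invertible r(3))
    from bchoice[OF this] show thesis using that by blast
  qed
  have g1: "(g has_derivative blinfun_apply (J (g y))) (at y)" if y: "y \<in> h ` W" for y
  proof (rule has_derivative_inverse_basic[OF _ _ _ _ openW y])
    show "(h has_derivative blinfun_apply (D h (g y))) (at (g y))"
      using C2_on_has_derivative[OF h] gh(1)[OF y] W(3) by blast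
    show "blinfun_apply (J (g y)) \<circ> blinfun_apply (D h (g y)) = id"
      using J(2)[OF gh(1)[OF y]] by (auto simp: fun_eq_iff simp flip: blinfun_apply_blinfun_compose)
    show "continuous (at y) g"
      using contg openW y continuous_on_eq_continuous_at by blast
  qed (use gh in \<open>auto simp: blinfun.bounded_linear_right\<close>)
  let ?A' = "\<lambda>y. D2 h (g y) o\<^sub>L J (g y)"
  \<comment> \<open>The derivative of the inverse operator, which sends \<open>k\<close> to - J
    (h''(J k)) J; composing it from bounded linear maps makes its continuity available to the
    rules.\<close>
  let ?g2 = "\<lambda>y. - (bounded_bilinear.prod_right (o\<^sub>L) (J (g y)) o\<^sub>L (bounded_bilinear.prod_left (o\<^sub>L) (J (g y)) o\<^sub>L ?A' y))"
  have g2: "((\<lambda>y. J (g y)) has_derivative blinfun_apply (?g2 y)) (at y)" if y: "y \<in> h ` W" for y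
  proof -
    have "((\<lambda>y. D h (g y)) has_derivative (\<lambda>k. D2 h (g y) (J (g y) k))) (at y)"
      by (rule has_derivative_compose[OF g1[OF y]])
        (use C2_on_has_derivative_D[OF h S] gh(1)[OF y] W(3) in blast)
    from has_derivative_blinfun_inverse[OF openW y J(1)[OF gh(1)] J(2)[OF gh(1)] J(3)[OF gh(1)] this]
    have "((\<lambda>y. J (g y)) has_derivative (\<lambda>k. - (J (g y) o\<^sub>L (D2 h (g y) (J (g y) k) o\<^sub>L J (g y))))) (at y)" .
    then show ?thesis
      by (rule has_derivative_eq_rhs)
        (simp add: fun_eq_iff compose_prod_left compose_prod_right blinfun.minus_left)
  qed
  have Jc: "continuous_on (h ` W) (\<lambda>y. J (g y))"
    by (rule has_derivative_continuous_on) (rule has_derivative_at_withinI, rule g2)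
  have "continuous_on (h ` W) ?g2"
    by (intro continuous_intros Jc continuous_on_compose2[OF C2_on_continuous_D2[OF h S]] contg)
      (use gh W(3) in auto)
  then have "C2_on (h ` W) g"
    unfolding C2_on_def using g1 g2
    by (intro exI[of _ "\<lambda>y. J (g y)"] exI[of _ ?g2]) auto
  then show ?thesis
    using W inj openW unfolding g_def by blast
qed

section \<open>The first-order condition at a constrained minimizer\<close>

text \<open>For a kernel vector \<open>v\<close> and small \<open>t\<close> the point
  \<open>z + t *\<^sub>R v\<close> misses the constraint by at most \<open>e * (t * norm v)\<close>,
  and a correction \<open>pinv w\<close> of the order \<open>e * t\<close> makes it feasible.
  Comparing values of \<open>f\<close> bounds \<open>- D f z v\<close> by a multiple of
  \<open>e\<close> for every small \<open>e\<close>; the same for \<open>- v\<close> yields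
  equality.\<close>

lemma constrained_minimizer_stationary:
  fixes g :: "'a::{real_inner, banach} \<Rightarrow> 'b::banach" and f :: "'a \<Rightarrow> real"
  assumes g: "C2_on S g" and f: "C2_on S f" and S: "open S" and z: "z \<in> S"
    and surj: "surj (blinfun_apply (D g z))"
    and min: "\<And>d. d \<in> S \<Longrightarrow> g d = g z \<Longrightarrow> f z \<le> f d"
    and v: "D g z v = 0"
  shows "D f z v = 0"
proof -
  have "compatible_scalar_product (inner :: 'a \<Rightarrow> 'a \<Rightarrow> real)"
    unfolding compatible_scalar_product_def
    using bilinear_conv_bounded_bilinear
    by (auto simp: bilinear_def linear_iff inner_simps inner_commute norm_eq_sqrt_inner
        intro!: exI[of _ 1])
  then interpret surjective_constraint inner "D g z"
    by unfold_locales (use surj in auto)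
  obtain q where q: "q > 0" "\<And>w. norm (pinv w) \<le> norm w * q"
    using bounded_linear.pos_bounded[OF bounded_linear_pinv] by blast
  have nonneg: "0 \<le> D f z v" if v: "D g z v = 0" for v
  proof -
    \<comment> \<open>\<open>q\<close> bounds \<open>pinv\<close>. The condition
      \<open>e * q <= 1/2\<close> gives the correction map the contraction factor 1/2 and keeps
      \<open>norm (pinv w)\<close> at most \<open>t * norm v\<close>.\<close>
    have bound: "- D f z v \<le> e * (norm (D f z) * (2 * q) * norm v + 2 * norm v)" if e: "0 < e" "e * q \<le> 1/2" for e
    proof -
      obtain r1 where r1: "r1 > 0" "ball z r1 \<subseteq> S"
        "\<And>x y. x \<in> ball z r1 \<Longrightarrow> y \<in> ball z r1 \<Longrightarrow> norm (g x - g y - D g z (x - y)) \<le> e * norm (x - y)"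
        using C2_on_near_linear[OF g S z e(1)] by blast
      obtain r2 where r2: "r2 > 0"
        "\<And>x y. x \<in> ball z r2 \<Longrightarrow> y \<in> ball z r2 \<Longrightarrow> norm (f x - f y - D f z (x - y)) \<le> e * norm (x - y)"
        using C2_on_near_linear[OF f S z e(1)] by blast
      define s where "s = min r1 r2"
      define n where "n = norm v + 1"
      \<comment> \<open>Small enough that the displacement with its correction, of size at most
        \<open>2 * (t * norm v)\<close>, stays in the ball where the linearisation bounds of both
        \<open>g\<close> and \<open>f\<close> hold.\<close>
      define t where "t = s / (4 * n)"
      have s: "s > 0" using r1(1) r2(1) by (simp add: s_def)
      have nv: "n > 0" by (simp add: n_def add_nonneg_pos)
      have t: "t > 0" using s nv by (simp add: t_def)
      have "t * n = s / 4" using nv by (simp add: t_def)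
      then have tv: "2 * (t * norm v) < s" using s t by (simp add: n_def distrib_left)
      \<comment> \<open>The residual at \<open>z + t *\<^sub>R v\<close> is at most
        \<open>\<rho> / 2\<close> and the correction map contracts by 1/2, so it maps
        \<open>cball 0 \<rho>\<close> into itself.\<close>
      define \<rho> where "\<rho> = 2 * e * (t * norm v)"
      have \<rho>: "\<rho> \<ge> 0" using e t by (simp add: \<rho>_def)
      let ?p = "\<lambda>w. z + t *\<^sub>R v + pinv w"
      have small: "norm (pinv w) \<le> \<rho> * q" "norm (t *\<^sub>R v + pinv w) \<le> 2 * (t * norm v)" if "norm w \<le> \<rho>" for w
      proof -
        show 1: "norm (pinv w) \<le> \<rho> * q"
          by (rule order_trans[OF q(2) mult_right_mono[OF that]]) (use q(1) in simp)
        have "\<rho> * q = 2 * (e * q) * (t * norm v)" by (simp add: \<rho>_def)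
        also have "\<dots> \<le> 1 * (t * norm v)" using e t by (intro mult_right_mono) auto
        finally show "norm (t *\<^sub>R v + pinv w) \<le> 2 * (t * norm v)"
          using 1 norm_triangle_ineq[of "t *\<^sub>R v" "pinv w"] t by simp
      qed
      have p: "?p w \<in> ball z s" if "norm w \<le> \<rho>" for w
      proof -
        have "z - ?p w = - (t *\<^sub>R v + pinv w)" by simp
        then have "dist z (?p w) = norm (t *\<^sub>R v + pinv w)"
          by (simp only: dist_norm norm_minus_cancel)
        then show ?thesis using small(2)[OF that] tv by simp
      qed
      have lin: "norm (g (?p w) - g (?p w') - (w - w')) \<le> 1/2 * norm (w - w')" if "norm w \<le> \<rho>" "norm w' \<le> \<rho>" for w w'
      proof -
        have "norm (g (?p w) - g (?p w') - D g z (?p w - ?p w')) \<le> e * norm (?p w - ?p w')"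
          using p[OF that(1)] p[OF that(2)] by (intro r1(3)) (auto simp: s_def)
        moreover have "?p w - ?p w' = pinv (w - w')"
          by (simp add: linear_diff[OF bounded_linear.linear[OF bounded_linear_pinv]])
        moreover have "e * norm (pinv (w - w')) \<le> 1/2 * norm (w - w')"
        proof -
          have "e * norm (pinv (w - w')) \<le> e * (norm (w - w') * q)"
            using q(2) e(1) by (intro mult_left_mono) auto
          also have "\<dots> = (e * q) * norm (w - w')" by simp
          also have "\<dots> \<le> 1/2 * norm (w - w')" using e(2) by (rule mult_right_mono) simp
          finally show ?thesis .
        qed
        ultimately show ?thesis by simp
      qed
      have lin0: "norm (g (z + t *\<^sub>R v) - g z) \<le> \<rho> / 2"
      proof -
        have "0 \<le> t * norm v" using t by simp
        then have "t * norm v < s" using tv by linarith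
        then have "z + t *\<^sub>R v \<in> ball z s" using t by (simp add: dist_norm)
        then have "norm (g (z + t *\<^sub>R v) - g z - D g z ((z + t *\<^sub>R v) - z)) \<le> e * norm ((z + t *\<^sub>R v) - z)"
          using s by (intro r1(3)) (auto simp: s_def)
        then show ?thesis using v t by (simp add: blinfun.scaleR_right \<rho>_def)
      qed
      have p0: "pinv 0 = 0" using linear_0[OF bounded_linear.linear[OF bounded_linear_pinv]] .
      \<comment> \<open>The unknown is a correction in the range space. A fixed point satisfies
        \<open>g (?p w) = g z\<close>; the map contracts because \<open>pinv\<close> inverts the
        linear part of \<open>g\<close>.\<close>
      have "\<exists>!w\<in>cball 0 \<rho>. w - (g (?p w) - g z) = w"
      proof (rule Banach_fix[where c = "1/2"])
        show "complete (cball (0::'b) \<rho>)" by (simp add: complete_eq_closed)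
        show "cball (0::'b) \<rho> \<noteq> {}" using \<rho> by auto
        show "(\<lambda>w. w - (g (?p w) - g z)) ` cball 0 \<rho> \<subseteq> cball 0 \<rho>"
        proof clarify
          fix w :: 'b assume "w \<in> cball 0 \<rho>"
          then have w: "norm w \<le> \<rho>" by simp
          have "norm (g (?p w) - g (?p 0) - (w - 0)) \<le> 1/2 * norm (w - 0)"
            using lin[OF w, of 0] \<rho> by simp
          moreover have "w - (g (?p w) - g z) = - (g (?p w) - g (?p 0) - (w - 0)) - (g (z + t *\<^sub>R v) - g z)"
            by (simp add: p0)
          then have "norm (w - (g (?p w) - g z)) \<le> norm (g (?p w) - g (?p 0) - (w - 0)) + norm (g (z + t *\<^sub>R v) - g z)"
            by (metis norm_minus_cancel norm_triangle_ineq4)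
          ultimately have "norm (w - (g (?p w) - g z)) \<le> \<rho>" using lin0 w by simp
          then show "w - (g (?p w) - g z) \<in> cball 0 \<rho>" by simp
        qed
        fix w w' :: 'b assume "w \<in> cball 0 \<rho>" "w' \<in> cball 0 \<rho>"
        then have "norm (g (?p w) - g (?p w') - (w - w')) \<le> 1/2 * norm (w - w')" by (intro lin) auto
        moreover have "(w - (g (?p w) - g z)) - (w' - (g (?p w') - g z)) = - (g (?p w) - g (?p w') - (w - w'))" by simp
        ultimately show "dist (w - (g (?p w) - g z)) (w' - (g (?p w') - g z)) \<le> 1/2 * dist w w'"
          unfolding dist_norm by (metis norm_minus_cancel)
      qed auto
      then obtain w where "w \<in> cball 0 \<rho>" "w - (g (?p w) - g z) = w"
        by (elim ex1E conjE)
      then have w: "norm w \<le> \<rho>" "g (?p w) = g z" by simp_all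
      have pS: "?p w \<in> ball z s" by (rule p[OF w(1)])
      then have "f z \<le> f (?p w)" using w(2) r1(2) by (intro min) (auto simp: s_def)
      moreover have "norm (f (?p w) - f z - D f z (?p w - z)) \<le> e * norm (?p w - z)"
        using pS r2(1) s by (intro r2(2)) (auto simp: s_def)
      moreover have "?p w - z = t *\<^sub>R v + pinv w" by simp
      ultimately have "- D f z (t *\<^sub>R v + pinv w) \<le> e * norm (t *\<^sub>R v + pinv w)"
        by (simp add: abs_le_iff)
      also have "\<dots> \<le> e * (2 * (t * norm v))" using small(2)[OF w(1)] e(1) by simp
      finally have "- (t * D f z v) \<le> D f z (pinv w) + e * (2 * (t * norm v))"
        by (simp add: blinfun.add_right blinfun.scaleR_right)
      also have "D f z (pinv w) \<le> norm (D f z) * (\<rho> * q)"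
        using norm_blinfun[of "D f z" "pinv w"] mult_left_mono[OF small(1)[OF w(1)], of "norm (D f z)"] by simp
      finally have "t * (- D f z v) \<le> t * (e * (norm (D f z) * (2 * q) * norm v + 2 * norm v))"
        by (simp add: \<rho>_def algebra_simps)
      then show ?thesis using t by (rule mult_left_le_imp_le)
    qed
    define C where "C = norm (D f z) * (2 * q) * norm v + 2 * norm v"
    have C: "C \<ge> 0" using q(1) by (simp add: C_def)
    have "- D f z v \<le> 0 + e" if e: "e > 0" for e
    proof -
      \<comment> \<open>The first entry yields \<open>d * q <= 1/2\<close>, the second
        \<open>d * C <= e\<close>, where \<open>C + 1\<close> keeps the denominator
        positive.\<close>
      define d where "d = min (1 / (2 * q)) (e / (C + 1))"
      have d: "d > 0" "d * q \<le> 1/2" "d * C \<le> e"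
      proof -
        show "d > 0" using q(1) e C by (simp add: d_def)
        have "d * q \<le> 1 / (2 * q) * q" using q(1) by (intro mult_right_mono) (auto simp: d_def)
        then show "d * q \<le> 1/2" using q(1) by simp
        have "d * C \<le> e / (C + 1) * C" using C by (intro mult_right_mono) (auto simp: d_def)
        also have "\<dots> \<le> e" using C e by (simp add: field_simps)
        finally show "d * C \<le> e" .
      qed
      then show ?thesis using bound[OF d(1,2)] by (simp add: C_def)
    qed
    then have "- D f z v \<le> 0" by (rule field_le_epsilon)
    then show ?thesis by simp
  qed
  have "0 \<le> D f z (- v)" using v by (intro nonneg) (simp add: blinfun.minus_right)
  then show ?thesis using nonneg[OF v] by (simp add: blinfun.minus_right)
qed


section \<open>Maps between manifolds\<close>

lemma C2_manifold_chart:
  assumes "C2_manifold M" "(U, \<phi>) \<in> atlas M"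
  shows "open U" "inj_on \<phi> U" "continuous_on U \<phi>" "continuous_on (\<phi> ` U) (inv_into U \<phi>)"
    and "open A \<Longrightarrow> A \<subseteq> U \<Longrightarrow> open (\<phi> ` A)"
proof -
  have "is_chart (U, \<phi>)" using assms unfolding C2_manifold_def by blast
  then have c: "open U" "open (\<phi> ` U)" "homeomorphism U (\<phi> ` U) \<phi> (inv_into U \<phi>)"
    by (auto simp: is_chart_def)
  show inj: "inj_on \<phi> U"
    by (rule inj_on_inverseI[of U "inv_into U \<phi>"]) (rule homeomorphism_apply1[OF c(3)])
  show "open U" by (rule c(1))
  show "continuous_on U \<phi>" by (rule homeomorphism_cont1[OF c(3)])
  show cont: "continuous_on (\<phi> ` U) (inv_into U \<phi>)" by (rule homeomorphism_cont2[OF c(3)])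
  assume A: "open A" "A \<subseteq> U"
  have "\<phi> ` A = \<phi> ` U \<inter> inv_into U \<phi> -` A"
    using A(2) inj by (auto simp: inv_into_f_f subset_iff)
  then show "open (\<phi> ` A)"
    using continuous_open_preimage[OF cont c(2) A(1)] by simp
qed

lemma C2_manifold_transition:
  assumes "C2_manifold M" "(U, \<phi>) \<in> atlas M" "(V, \<psi>) \<in> atlas M"
  shows "C2_on (\<phi> ` (U \<inter> V)) (\<psi> \<circ> inv_into U \<phi>)"
  using assms unfolding C2_manifold_def by blast

lemma C2_manifold_chart_at:
  assumes "C2_manifold M"
  obtains U \<phi> where "chart_at M x = (U, \<phi>)" "(U, \<phi>) \<in> atlas M" "x \<in> U"
  using assms unfolding C2_manifold_def by (metis prod.collapse)

lemma inv_into_chart: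
  assumes "C2_manifold M" "(U, \<phi>) \<in> atlas M" "x \<in> U"
  shows "inv_into U \<phi> (\<phi> x) = x"
  using C2_manifold_chart(2)[OF assms(1,2)] assms(3) by (rule inv_into_f_f)

lemma atlas_vec_manifold [simp]: "atlas vec_manifold = {(UNIV, id)}"
  and chart_at_vec_manifold [simp]: "chart_at vec_manifold x = (UNIV, id)"
  by (simp_all add: vec_manifold_def)

lemma C2_manifold_vec_manifold: "C2_manifold (vec_manifold :: ('e::{real_inner, banach}, 'e) manifold)"
  unfolding C2_manifold_def
  by (auto simp: is_chart_def homeomorphism_def id_def inv_id[unfolded id_def] o_def C2_on_id)

lemma C2_map_on_vec_iff:
  "C2_map_on vec_manifold vec_manifold S g \<longleftrightarrow> open S \<and> C2_on S g"
  unfolding C2_map_on_def using C2_on_continuous by (auto simp: inv_id)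

lemma C2_map_on_open: "C2_map_on M N S g \<Longrightarrow> open S"
  and C2_map_on_continuous: "C2_map_on M N S g \<Longrightarrow> continuous_on S g"
  by (auto simp: C2_map_on_def)

lemma C2_map_on_charts:
  assumes "C2_map_on M N S g" "(U, \<phi>) \<in> atlas M" "(V, \<psi>) \<in> atlas N"
  shows "C2_on (\<phi> ` {x \<in> U \<inter> S. g x \<in> V}) (\<psi> \<circ> g \<circ> inv_into U \<phi>)"
  using assms unfolding C2_map_on_def by blast

lemma C2_map_onI:
  assumes "open S" "continuous_on S g"
    and "\<And>U \<phi> V \<psi>. (U, \<phi>) \<in> atlas M \<Longrightarrow> (V, \<psi>) \<in> atlas N \<Longrightarrow>
      C2_on (\<phi> ` {x \<in> U \<inter> S. g x \<in> V}) (\<psi> \<circ> g \<circ> inv_into U \<phi>)"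
  shows "C2_map_on M N S g"
  using assms unfolding C2_map_on_def by blast

lemma C2_map_on_open_preimage:
  assumes "C2_map_on M N S g" "open T"
  shows "open {x \<in> S. g x \<in> T}"
  using continuous_open_preimage[OF C2_map_on_continuous[OF assms(1)] C2_map_on_open[OF assms(1)] assms(2)]
  by (simp add: vimage_def Int_def)

lemma C2_map_on_subset:
  assumes "C2_map_on M N S g" "open T" "T \<subseteq> S"
  shows "C2_map_on M N T g"
proof (rule C2_map_onI)
  show "C2_on (\<phi> ` {x \<in> U \<inter> T. g x \<in> V}) (\<psi> \<circ> g \<circ> inv_into U \<phi>)"
    if "(U, \<phi>) \<in> atlas M" "(V, \<psi>) \<in> atlas N" for U \<phi> V \<psi>
    by (rule C2_on_subset[OF C2_map_on_charts[OF assms(1) that]]) (use assms(3) in auto)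
  show "continuous_on T g"
    using C2_map_on_continuous[OF assms(1)] assms(3) by (rule continuous_on_subset)
qed (rule assms(2))

lemma C2_map_on_cong:
  fixes g h :: "'x::t2_space \<Rightarrow> 'y::t2_space"
  assumes "C2_manifold M" "C2_manifold N" "C2_map_on M N S g" "\<And>x. x \<in> S \<Longrightarrow> g x = h x"
  shows "C2_map_on M N S h"
proof (rule C2_map_onI)
  show "continuous_on S h"
    using C2_map_on_continuous[OF assms(3)] assms(4) by (metis continuous_on_cong)
  fix U \<phi> V \<psi> assume kl: "(U, \<phi>) \<in> atlas M" "(V, \<psi>) \<in> atlas N"
  have eq: "{x \<in> U \<inter> S. h x \<in> V} = {x \<in> U \<inter> S. g x \<in> V}" using assms(4) by auto
  have "{x \<in> U \<inter> S. g x \<in> V} = U \<inter> {x \<in> S. g x \<in> V}" by auto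
  then have op: "open (\<phi> ` {x \<in> U \<inter> S. g x \<in> V})"
    using C2_map_on_open_preimage[OF assms(3)] C2_manifold_chart(1)[OF assms(2) kl(2)]
      C2_manifold_chart(1)[OF assms(1) kl(1)]
    by (intro C2_manifold_chart(5)[OF assms(1) kl(1)]) auto
  show "C2_on (\<phi> ` {x \<in> U \<inter> S. h x \<in> V}) (\<psi> \<circ> h \<circ> inv_into U \<phi>)"
    unfolding eq
    by (rule C2_on_cong[OF C2_map_on_charts[OF assms(3) kl] op])
      (auto simp: assms(4) inv_into_chart[OF assms(1) kl(1)])
qed (rule C2_map_on_open[OF assms(3)])

text \<open>The definition tests charts of \<open>M\<close> against charts of \<open>L\<close>,
  while the chart of \<open>N\<close> in between has to change with the point; the resulting pieces
  are glued by \<open>C2_on_locally\<close>.\<close>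

lemma C2_map_on_compose:
  fixes g :: "'x::t2_space \<Rightarrow> 'y::t2_space" and h :: "'y \<Rightarrow> 'z::t2_space"
  assumes M: "C2_manifold M" and N: "C2_manifold N" and L: "C2_manifold L"
    and g: "C2_map_on M N S g" and h: "C2_map_on N L T h" and A: "open A" "A \<subseteq> S" "g ` A \<subseteq> T"
  shows "C2_map_on M L A (\<lambda>x. h (g x))"
proof (rule C2_map_onI)
  show contA: "continuous_on A (\<lambda>x. h (g x))"
    by (rule continuous_on_compose2[OF C2_map_on_continuous[OF h]
          continuous_on_subset[OF C2_map_on_continuous[OF g] A(2)] A(3)])
  fix U \<phi> W \<kappa> assume kl: "(U, \<phi>) \<in> atlas M" "(W, \<kappa>) \<in> atlas L"
  define Z where "Z = {x \<in> U \<inter> A. h (g x) \<in> W}"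
  have "Z = U \<inter> (A \<inter> (\<lambda>x. h (g x)) -` W)" by (auto simp: Z_def)
  then have oZ: "open Z"
    using continuous_open_preimage[OF contA A(1) C2_manifold_chart(1)[OF L kl(2)]]
      C2_manifold_chart(1)[OF M kl(1)] by auto
  have "C2_on (\<phi> ` Z) (\<kappa> \<circ> (\<lambda>x. h (g x)) \<circ> inv_into U \<phi>)"
  proof (rule C2_on_locally)
    fix e assume "e \<in> \<phi> ` Z"
    then obtain x0 where x0: "x0 \<in> Z" "e = \<phi> x0" by blast
    obtain V \<psi> where V: "(V, \<psi>) \<in> atlas N" "g x0 \<in> V"
      using C2_manifold_chart_at[OF N] by metis
    define Z' where "Z' = Z \<inter> {x \<in> S. g x \<in> V}"
    have oZ': "open (\<phi> ` Z')"
      using oZ C2_map_on_open_preimage[OF g C2_manifold_chart(1)[OF N V(1)]]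
      by (intro C2_manifold_chart(5)[OF M kl(1)]) (auto simp: Z'_def Z_def)
    have f: "C2_on (\<phi> ` Z') (\<psi> \<circ> g \<circ> inv_into U \<phi>)"
      by (rule C2_on_subset[OF C2_map_on_charts[OF g kl(1) V(1)]]) (auto simp: Z'_def Z_def)
    have op: "open (\<psi> ` {y \<in> V \<inter> T. h y \<in> W})"
    proof (rule C2_manifold_chart(5)[OF N V(1)])
      have "{y \<in> V \<inter> T. h y \<in> W} = V \<inter> {y \<in> T. h y \<in> W}" by auto
      then show "open {y \<in> V \<inter> T. h y \<in> W}"
        using C2_map_on_open_preimage[OF h C2_manifold_chart(1)[OF L kl(2)]]
          C2_manifold_chart(1)[OF N V(1)] by auto
    qed auto
    have "C2_on (\<phi> ` Z') (\<lambda>e. (\<kappa> \<circ> h \<circ> inv_into V \<psi>) ((\<psi> \<circ> g \<circ> inv_into U \<phi>) e))"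
      by (rule C2_on_compose(1)[OF f C2_map_on_charts[OF h V(1) kl(2)] oZ' op])
        (use A in \<open>auto simp: Z'_def Z_def inv_into_chart[OF M kl(1)]\<close>)
    then have "C2_on (\<phi> ` Z') (\<kappa> \<circ> (\<lambda>x. h (g x)) \<circ> inv_into U \<phi>)"
      by (rule C2_on_cong[OF _ oZ']) (auto simp: Z'_def Z_def inv_into_chart[OF M kl(1)] inv_into_chart[OF N V(1)])
    moreover have "e \<in> \<phi> ` Z'" using x0 V(2) A(2) by (auto simp: Z'_def Z_def)
    ultimately show "\<exists>T. open T \<and> e \<in> T \<and> C2_on T (\<kappa> \<circ> (\<lambda>x. h (g x)) \<circ> inv_into U \<phi>)"
      using oZ' by blast
  qed
  then show "C2_on (\<phi> ` {x \<in> U \<inter> A. h (g x) \<in> W}) (\<kappa> \<circ> (\<lambda>x. h (g x)) \<circ> inv_into U \<phi>)"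
    by (simp add: Z_def)
qed (rule A)

lemma C2_map_on_chart:
  fixes M :: "('x::t2_space, 'e::{real_inner, banach}) manifold"
  assumes "C2_manifold M" "(U, \<phi>) \<in> atlas M"
  shows "C2_map_on M vec_manifold U \<phi>"
proof (rule C2_map_onI)
  fix V :: "'x set" and \<psi> and W :: "'e set" and \<kappa> :: "'e \<Rightarrow> 'e"
  assume "(V, \<psi>) \<in> atlas M" "(W, \<kappa>) \<in> atlas vec_manifold"
  then show "C2_on (\<psi> ` {x \<in> V \<inter> U. \<phi> x \<in> W}) (\<kappa> \<circ> \<phi> \<circ> inv_into V \<psi>)"
    using C2_manifold_transition[OF assms(1) _ assms(2), of V \<psi>] by (simp add: Int_def)
qed (use C2_manifold_chart[OF assms] in auto)

lemma C2_map_on_inv_chart: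
  fixes M :: "('x::t2_space, 'e::{real_inner, banach}) manifold"
  assumes "C2_manifold M" "(U, \<phi>) \<in> atlas M"
  shows "C2_map_on vec_manifold M (\<phi> ` U) (inv_into U \<phi>)"
proof -
  have "{e \<in> \<phi> ` U. inv_into U \<phi> e \<in> V} = \<phi> ` (U \<inter> V)" for V
    by (auto simp: inv_into_chart[OF assms])
  then show ?thesis
    unfolding C2_map_on_def
    using C2_manifold_chart[OF assms] C2_manifold_transition[OF assms] by (auto simp: inv_id)
qed

section \<open>Tangent maps in the distinguished charts\<close>

lemma tangent_map_vec [simp]: "tangent_map vec_manifold vec_manifold f x = D f x"
  by (simp add: tangent_map_def inv_id)

lemma tangent_map_cong:
  fixes M :: "('x::t2_space, 'e::{real_inner, banach}) manifold"
  assumes M: "C2_manifold M" and A: "open A" "x \<in> A" "\<And>y. y \<in> A \<Longrightarrow> g y = h y"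
  shows "tangent_map M N g x = tangent_map M N h x"
proof -
  obtain U \<phi> where U: "chart_at M x = (U, \<phi>)" "(U, \<phi>) \<in> atlas M" "x \<in> U"
    using C2_manifold_chart_at[OF M] by metis
  obtain V \<psi> where V: "chart_at N (g x) = (V, \<psi>)" by (cases "chart_at N (g x)")
  have "open (\<phi> ` (U \<inter> A))"
    using A C2_manifold_chart(1)[OF M U(2)] by (intro C2_manifold_chart(5)[OF M U(2)]) auto
  then have "D (\<psi> \<circ> g \<circ> inv_into U \<phi>) (\<phi> x) = D (\<psi> \<circ> h \<circ> inv_into U \<phi>) (\<phi> x)"
    by (rule D_cong_open) (use U A in \<open>auto simp: inv_into_chart[OF M U(2)]\<close>)
  then show ?thesis using V A(3)[OF A(2)] by (simp add: tangent_map_def U(1))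
qed

lemma tangent_map_compose:
  fixes M :: "('x::t2_space, 'a::{real_inner, banach}) manifold"
    and N :: "('y::t2_space, 'b::{real_inner, banach}) manifold"
    and L :: "('z::t2_space, 'c::{real_inner, banach}) manifold"
  assumes M: "C2_manifold M" and N: "C2_manifold N" and L: "C2_manifold L"
    and g: "C2_map_on M N S g" and h: "C2_map_on N L T h" and x: "x \<in> S" "g x \<in> T"
  shows "tangent_map M L (\<lambda>x. h (g x)) x = tangent_map N L h (g x) o\<^sub>L tangent_map M N g x"
proof -
  obtain U \<phi> where U: "chart_at M x = (U, \<phi>)" "(U, \<phi>) \<in> atlas M" "x \<in> U"
    using C2_manifold_chart_at[OF M] by metis
  obtain V \<psi> where V: "chart_at N (g x) = (V, \<psi>)" "(V, \<psi>) \<in> atlas N" "g x \<in> V"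
    using C2_manifold_chart_at[OF N] by metis
  obtain W \<kappa> where W: "chart_at L (h (g x)) = (W, \<kappa>)" "(W, \<kappa>) \<in> atlas L" "h (g x) \<in> W"
    using C2_manifold_chart_at[OF L] by metis
  have "{y \<in> V \<inter> T. h y \<in> W} = V \<inter> {y \<in> T. h y \<in> W}" by auto
  then have oT: "open {y \<in> V \<inter> T. h y \<in> W}"
    using C2_map_on_open_preimage[OF h C2_manifold_chart(1)[OF L W(2)]]
      C2_manifold_chart(1)[OF N V(2)] by auto
  define Z where "Z = U \<inter> {x \<in> S. g x \<in> {y \<in> V \<inter> T. h y \<in> W}}"
  have oZ: "open (\<phi> ` Z)"
    unfolding Z_def using C2_map_on_open_preimage[OF g oT] C2_manifold_chart(1)[OF M U(2)]
    by (intro C2_manifold_chart(5)[OF M U(2)]) auto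
  have f: "C2_on (\<phi> ` Z) (\<psi> \<circ> g \<circ> inv_into U \<phi>)"
    by (rule C2_on_subset[OF C2_map_on_charts[OF g U(2) V(2)]]) (auto simp: Z_def)
  have op: "open (\<psi> ` {y \<in> V \<inter> T. h y \<in> W})"
    by (rule C2_manifold_chart(5)[OF N V(2) oT]) auto
  have xZ: "\<phi> x \<in> \<phi> ` Z" using x U V W by (auto simp: Z_def)
  have "D (\<lambda>e. (\<kappa> \<circ> h \<circ> inv_into V \<psi>) ((\<psi> \<circ> g \<circ> inv_into U \<phi>) e)) (\<phi> x)
      = D (\<kappa> \<circ> h \<circ> inv_into V \<psi>) ((\<psi> \<circ> g \<circ> inv_into U \<phi>) (\<phi> x)) o\<^sub>L D (\<psi> \<circ> g \<circ> inv_into U \<phi>) (\<phi> x)"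
    by (rule C2_on_compose(2)[OF f C2_map_on_charts[OF h V(2) W(2)] oZ op _ xZ])
      (auto simp: Z_def inv_into_chart[OF M U(2)])
  moreover have "D (\<lambda>e. (\<kappa> \<circ> h \<circ> inv_into V \<psi>) ((\<psi> \<circ> g \<circ> inv_into U \<phi>) e)) (\<phi> x)
      = D (\<kappa> \<circ> (\<lambda>x. h (g x)) \<circ> inv_into U \<phi>) (\<phi> x)"
    by (rule D_cong_open[OF oZ xZ]) (auto simp: Z_def inv_into_chart[OF M U(2)] inv_into_chart[OF N V(2)])
  ultimately show ?thesis
    by (simp add: tangent_map_def U V W inv_into_chart[OF M U(2,3)])
qed

lemma tangent_map_id:
  fixes M :: "('x::t2_space, 'a::{real_inner, banach}) manifold"
  assumes M: "C2_manifold M"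
  shows "tangent_map M M (\<lambda>x. x) x = id_blinfun"
proof -
  obtain U \<phi> where U: "chart_at M x = (U, \<phi>)" "(U, \<phi>) \<in> atlas M" "x \<in> U"
    using C2_manifold_chart_at[OF M] by metis
  have "D (\<phi> \<circ> (\<lambda>x. x) \<circ> inv_into U \<phi>) (\<phi> x) = D (\<lambda>e. e) (\<phi> x)"
    by (rule D_cong_open[OF C2_manifold_chart(5)[OF M U(2), of U]])
      (use U in \<open>auto simp: C2_manifold_chart(1)[OF M U(2)] f_inv_into_f\<close>)
  also have "\<dots> = id_blinfun"
    by (rule D_eqI) (simp add: id_blinfun.rep_eq)
  finally show ?thesis by (simp add: tangent_map_def U(1))
qed

lemma tangent_map_own_chart:
  fixes M :: "('x::t2_space, 'a::{real_inner, banach}) manifold"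
  assumes M: "C2_manifold M" and U: "chart_at M x = (U, \<phi>)"
  shows "tangent_map M vec_manifold \<phi> x = id_blinfun"
  using tangent_map_id[OF M, of x] by (simp add: tangent_map_def U o_def id_def)

lemma tangent_map_chart_inverse:
  fixes M :: "('x::t2_space, 'a::{real_inner, banach}) manifold"
  assumes M: "C2_manifold M" and U: "(U, \<phi>) \<in> atlas M" "x \<in> U"
  shows "tangent_map vec_manifold M (inv_into U \<phi>) (\<phi> x) o\<^sub>L tangent_map M vec_manifold \<phi> x = id_blinfun"
    and "tangent_map M vec_manifold \<phi> x o\<^sub>L tangent_map vec_manifold M (inv_into U \<phi>) (\<phi> x) = id_blinfun"
proof -
  note Mv = M C2_manifold_vec_manifold
  note oU = C2_manifold_chart(1)[OF M U(1)] C2_manifold_chart(5)[OF M U(1) C2_manifold_chart(1)[OF M U(1)] subset_refl]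
  have "tangent_map vec_manifold M (inv_into U \<phi>) (\<phi> x) o\<^sub>L tangent_map M vec_manifold \<phi> x
      = tangent_map M M (\<lambda>x. inv_into U \<phi> (\<phi> x)) x"
    by (rule tangent_map_compose[OF Mv(1,2,1) C2_map_on_chart[OF M U(1)] C2_map_on_inv_chart[OF M U(1)], symmetric])
      (use U in auto)
  also have "\<dots> = tangent_map M M (\<lambda>x. x) x"
    by (rule tangent_map_cong[OF M oU(1) U(2)]) (rule inv_into_chart[OF M U(1)])
  finally show "tangent_map vec_manifold M (inv_into U \<phi>) (\<phi> x) o\<^sub>L tangent_map M vec_manifold \<phi> x = id_blinfun"
    by (simp add: tangent_map_id[OF M])
  have "tangent_map M vec_manifold \<phi> (inv_into U \<phi> (\<phi> x)) o\<^sub>L tangent_map vec_manifold M (inv_into U \<phi>) (\<phi> x)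
      = tangent_map vec_manifold vec_manifold (\<lambda>e. \<phi> (inv_into U \<phi> e)) (\<phi> x)"
    by (rule tangent_map_compose[OF Mv(2,1,2) C2_map_on_inv_chart[OF M U(1)] C2_map_on_chart[OF M U(1)], symmetric])
      (use U in \<open>auto simp: inv_into_chart[OF M U(1)]\<close>)
  also have "\<dots> = tangent_map vec_manifold vec_manifold (\<lambda>e. e) (\<phi> x)"
    by (rule tangent_map_cong[OF Mv(2) oU(2)]) (use U in \<open>auto simp: f_inv_into_f\<close>)
  finally show "tangent_map M vec_manifold \<phi> x o\<^sub>L tangent_map vec_manifold M (inv_into U \<phi>) (\<phi> x) = id_blinfun"
    by (simp add: tangent_map_id[OF Mv(2), simplified] inv_into_chart[OF M U])
qed

text \<open>By \<open>surj_blinfun_perturbation\<close> injectivity is locally constant, and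
  connectedness does the rest. The operators \<open>tangent_map N vec_manifold h y\<close> need not
  depend continuously on \<open>y\<close>, because the distinguished charts are arbitrary. Near a
  given point they are therefore compared with the derivatives \<open>?F\<close> in one fixed chart,
  which are continuous and differ from them by the bijections \<open>?J\<close>.\<close>

lemma injective_tangent_map_along_connected:
  fixes N :: "('y::t2_space, 'f::{real_inner, banach}) manifold" and h :: "'y \<Rightarrow> 'f"
  assumes N: "C2_manifold N" and h: "C2_map_on N vec_manifold UNIV h"
    and I: "connected I" and \<gamma>: "continuous_on I \<gamma>"
    and surj: "\<And>t. t \<in> I \<Longrightarrow> surj (blinfun_apply (tangent_map N vec_manifold h (\<gamma> t)))"
    and t: "t0 \<in> I" "inj (blinfun_apply (tangent_map N vec_manifold h (\<gamma> t0)))" "t1 \<in> I"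
  shows "inj (blinfun_apply (tangent_map N vec_manifold h (\<gamma> t1)))"
proof -
  define Q where "Q t = inj (blinfun_apply (tangent_map N vec_manifold h (\<gamma> t)))" for t
  have "Q constant_on I"
  proof (rule locally_constant_imp_constant[OF I])
    fix t assume tI: "t \<in> I"
    obtain V \<psi> where V: "(V, \<psi>) \<in> atlas N" "\<gamma> t \<in> V"
      using C2_manifold_chart_at[OF N] by metis
    let ?J = "\<lambda>y. tangent_map vec_manifold N (inv_into V \<psi>) (\<psi> y)"
    let ?F = "D (\<lambda>e. h (inv_into V \<psi> e))"
    note Nv = N C2_manifold_vec_manifold
    have oV: "open V" "open (\<psi> ` V)"
      using C2_manifold_chart[OF N V(1)] by auto
    have F: "?F (\<psi> y) = tangent_map N vec_manifold h y o\<^sub>L ?J y" if "y \<in> V" for y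
      using tangent_map_compose[OF Nv(2,1,2) C2_map_on_inv_chart[OF N V(1)] h, of "\<psi> y"] that
      by (simp add: inv_into_chart[OF N V(1)])
    have bij: "bij (blinfun_apply (?J y))" if "y \<in> V" for y
    proof (rule o_bij)
      show "blinfun_apply (tangent_map N vec_manifold \<psi> y) \<circ> blinfun_apply (?J y) = id"
        using tangent_map_chart_inverse(2)[OF N V(1) that]
        by (auto simp: fun_eq_iff simp flip: blinfun_apply_blinfun_compose)
      show "blinfun_apply (?J y) \<circ> blinfun_apply (tangent_map N vec_manifold \<psi> y) = id"
        using tangent_map_chart_inverse(1)[OF N V(1) that]
        by (auto simp: fun_eq_iff simp flip: blinfun_apply_blinfun_compose)
    qed
    have F_apply: "blinfun_apply (?F (\<psi> y)) = blinfun_apply (tangent_map N vec_manifold h y) \<circ> blinfun_apply (?J y)"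
      if "y \<in> V" for y
      by (simp add: F[OF that] blinfun_compose.rep_eq)
    have injF: "inj (blinfun_apply (?F (\<psi> y))) \<longleftrightarrow> inj (blinfun_apply (tangent_map N vec_manifold h y))"
      if "y \<in> V" for y
      unfolding F_apply[OF that] using bij[OF that]
      by (metis bij_is_inj bij_is_surj comp_inj_on inj_on_imageI inj_compose)
    have "surj (blinfun_apply (?F (\<psi> (\<gamma> t))))"
      unfolding F_apply[OF V(2)] by (rule comp_surj[OF bij_is_surj[OF bij[OF V(2)]] surj[OF tI]])
    then obtain e where e: "e > 0" "\<And>B. norm (B - ?F (\<psi> (\<gamma> t))) < e \<Longrightarrow>
        inj (blinfun_apply B) \<longleftrightarrow> inj (blinfun_apply (?F (\<psi> (\<gamma> t))))"
      using surj_blinfun_perturbation by blast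
    define T where "T = {s \<in> I. \<gamma> s \<in> V \<inter> \<psi> -` (\<psi> ` V \<inter> ?F -` ball (?F (\<psi> (\<gamma> t))) e)}"
    have "C2_map_on vec_manifold vec_manifold (\<psi> ` V) (\<lambda>e. h (inv_into V \<psi> e))"
      by (rule C2_map_on_compose[OF Nv(2,1,2) C2_map_on_inv_chart[OF N V(1)] h]) (use oV in auto)
    then have "C2_on (\<psi> ` V) (\<lambda>e. h (inv_into V \<psi> e))"
      by (simp add: C2_map_on_vec_iff)
    then have "continuous_on (\<psi> ` V) ?F"
      by (rule C2_on_continuous_D[OF _ oV(2)])
    then have "open (\<psi> ` V \<inter> ?F -` ball (?F (\<psi> (\<gamma> t))) e)"
      by (rule continuous_open_preimage[OF _ oV(2) open_ball])
    then have "open (V \<inter> \<psi> -` (\<psi> ` V \<inter> ?F -` ball (?F (\<psi> (\<gamma> t))) e))"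
      by (rule continuous_open_preimage[OF C2_manifold_chart(3)[OF N V(1)] oV(1)])
    then have "openin (top_of_set I) T"
      using continuous_openin_preimage_gen[OF \<gamma>, of "V \<inter> \<psi> -` (\<psi> ` V \<inter> ?F -` ball (?F (\<psi> (\<gamma> t))) e)"]
      unfolding T_def by (simp only: vimage_def Int_def mem_Collect_eq)
    moreover have "t \<in> T" using tI V e(1) by (auto simp: T_def)
    moreover have "Q s = Q t" if "s \<in> T" for s
    proof -
      have s: "\<gamma> s \<in> V" "norm (?F (\<psi> (\<gamma> s)) - ?F (\<psi> (\<gamma> t))) < e"
        using that by (auto simp: T_def dist_norm norm_minus_commute)
      show ?thesis using e(2)[OF s(2)] injF[OF s(1)] injF[OF V(2)] by (simp add: Q_def)
    qed
    ultimately show "\<exists>T. openin (top_of_set I) T \<and> t \<in> T \<and> (\<forall>s\<in>T. Q s = Q t)"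
      by blast
  qed
  then show ?thesis using t unfolding constant_on_def Q_def by blast
qed

lemma local_retractionD:
  fixes M :: "('x::t2_space, 'e::{real_inner, banach}) manifold"
  assumes "local_retraction M x V R"
  shows "open V" "0 \<in> V" "C2_map_on vec_manifold M V R" "R 0 = x"
    "tangent_map vec_manifold M R 0 = id_blinfun"
  using assms C2_map_on_open by (auto simp: local_retraction_def)

text \<open>In the distinguished chart at \<open>x\<close> the derivative of \<open>R\<close> at 0
  is the identity, since tangent vectors are identified through that chart; the inverse function
  theorem applies there. This guarantees that the choice made in \<open>transition\<close> finds a
  neighbourhood.\<close>

lemma local_retraction_diffeo_nhd:
  fixes M :: "('x::t2_space, 'e::{real_inner, banach}) manifold"
  assumes M: "C2_manifold M" and R: "local_retraction M x V R"
  shows "\<exists>W. W \<subseteq> V \<and> diffeo_nhd M W R"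
proof -
  note R = local_retractionD[OF R]
  note Mv = M C2_manifold_vec_manifold
  obtain U \<phi> where U: "chart_at M x = (U, \<phi>)" "(U, \<phi>) \<in> atlas M" "x \<in> U"
    using C2_manifold_chart_at[OF M] by metis
  define A where "A = {d \<in> V. R d \<in> U}"
  have A: "open A" "0 \<in> A" "A \<subseteq> V"
    unfolding A_def using C2_map_on_open_preimage[OF R(3) C2_manifold_chart(1)[OF M U(2)]] R U by auto
  let ?h = "\<lambda>d. \<phi> (R d)"
  have "C2_map_on vec_manifold vec_manifold A ?h"
    by (rule C2_map_on_compose[OF Mv(2,1,2) R(3) C2_map_on_chart[OF M U(2)] A(1,3)]) (auto simp: A_def)
  then have h: "C2_on A ?h" by (simp add: C2_map_on_vec_iff)
  have "D ?h 0 = id_blinfun"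
    using R(5) by (simp add: tangent_map_def R(4) U(1) o_def inv_id)
  from C2_local_inverse[OF h A(1,2) this] obtain W where W: "open W" "0 \<in> W" "W \<subseteq> A"
    "inj_on ?h W" "open (?h ` W)" "C2_on (?h ` W) (inv_into W ?h)" by blast
  have inj: "inj_on R W" using W(4) unfolding inj_on_def by auto
  have RW: "R ` W = {x \<in> U. \<phi> x \<in> ?h ` W}"
    using W(3) C2_manifold_chart(2)[OF M U(2)] by (auto simp: A_def inj_on_def)
  have oRW: "open (R ` W)"
    unfolding RW by (rule C2_map_on_open_preimage[OF C2_map_on_chart[OF M U(2)] W(5)])
  have "C2_map_on M vec_manifold (R ` W) (\<lambda>x. inv_into W ?h (\<phi> x))"
    by (rule C2_map_on_compose[OF Mv(1,2,2) C2_map_on_chart[OF M U(2)], of "?h ` W"])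
      (use W oRW in \<open>auto simp: C2_map_on_vec_iff RW\<close>)
  then have "C2_map_on M vec_manifold (R ` W) (inv_into W R)"
    by (rule C2_map_on_cong[OF Mv]) (auto simp: inv_into_f_f[OF W(4)] inv_into_f_f[OF inj])
  moreover have "C2_map_on vec_manifold M W R"
    by (rule C2_map_on_subset[OF R(3) W(1)]) (use W(3) A(3) in auto)
  ultimately have "diffeo_nhd M W R" using W(2) inj by (simp add: diffeo_nhd_def)
  then show ?thesis using W(3) A(3) by blast
qed


section \<open>Pullbacks\<close>

lemma C2_on_diff_const:
  fixes g :: "'a::real_normed_vector \<Rightarrow> 'b::real_normed_vector"
  assumes "C2_on S g" "open S"
  shows "C2_on S (\<lambda>x. g x - k)" and "x \<in> S \<Longrightarrow> D (\<lambda>x. g x - k) x = D g x"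
    and "x \<in> S \<Longrightarrow> D2 (\<lambda>x. g x - k) x = D2 g x"
proof -
  have l: "bounded_linear (\<lambda>x::'a. 0::'b)" by (rule bounded_linear_zero)
  note k = C2_on_affine[OF l, where a = "- k"]
  have 0: "Blinfun (\<lambda>x::'a. 0::'b) = 0"
    by (rule blinfun_eqI) (simp add: bounded_linear_Blinfun_apply[OF l])
  note a = C2_on_add[OF assms(1) k(1) assms(2), unfolded k 0]
  show "C2_on S (\<lambda>x. g x - k)" using a(1) by simp
  show "x \<in> S \<Longrightarrow> D (\<lambda>x. g x - k) x = D g x" using a(2) by simp
  show "x \<in> S \<Longrightarrow> D2 (\<lambda>x. g x - k) x = D2 g x" using a(3) by simp
qed

lemma C2_on_blinfun_compose:
  fixes p :: "'b::real_normed_vector \<Rightarrow>\<^sub>L 'c::real_normed_vector"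
  assumes "C2_on S g" "open S"
  shows "C2_on S (\<lambda>x. p (g x))" and "x \<in> S \<Longrightarrow> D (\<lambda>x. p (g x)) x = p o\<^sub>L D g x"
    and "x \<in> S \<Longrightarrow> D2 (\<lambda>x. p (g x)) x v w = p (D2 g x v w)"
proof -
  note l = C2_on_affine[OF blinfun.bounded_linear_right[of p], where a = 0, unfolded add_0_right]
  have p: "Blinfun (blinfun_apply p) = p" by (rule blinfun_apply_inverse)
  note a = C2_on_compose[OF assms(1) l(1) assms(2) open_UNIV UNIV_I]
  show "C2_on S (\<lambda>x. p (g x))" by (rule a(1))
  show "x \<in> S \<Longrightarrow> D (\<lambda>x. p (g x)) x = p o\<^sub>L D g x" by (simp add: a(2) l(2) p)
  show "x \<in> S \<Longrightarrow> D2 (\<lambda>x. p (g x)) x v w = p (D2 g x v w)" by (simp add: a(3) l p blinfun.zero_left)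
qed

section \<open>The data of the problem in pullback coordinates\<close>

locale sqp_problem =
  fixes P :: "('x::t2_space, 'y::t2_space, 'e::{real_inner, banach}, 'f::{real_inner, banach}) problem"
  assumes setting: "sqp_setting P"
begin

lemma manifold_X: "C2_manifold (mfX P)" and manifold_Y: "C2_manifold (mfY P)"
  and scal_compatible: "compatible_product (scal P x)"
  and obj_C2: "C2_map_on (mfX P) vec_manifold UNIV (obj P)"
  and constr_C2: "C2_map_on (mfX P) (mfY P) UNIV (constr P)"
  and retr: "local_retraction (mfX P) x (retr_dom P x) (retr P x)"
  and retr_inv_dom: "retr_inv_dom P x \<subseteq> retr_dom P x" "diffeo_nhd (mfX P) (retr_inv_dom P x) (retr P x)"
  and retr0: "local_retraction (mfX P) x (retr0_dom P x) (retr0 P x)"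
  and strat: "local_stratification (mfY P) (constr P x) UNIV (strat P (constr P x))"
  and strat0: "local_stratification (mfY P) (constr P x) (strat0_dom P (constr P x)) (strat0 P (constr P x))"
  using setting unfolding sqp_setting_def compatible_product_def by blast+

lemmas vec = C2_manifold_vec_manifold
lemmas retrD = local_retractionD[OF retr]
lemmas retr0D = local_retractionD[OF retr0]

lemma stratD: "C2_map_on (mfY P) vec_manifold UNIV (strat P (constr P x))"
    "tangent_map (mfY P) vec_manifold (strat P (constr P x)) (constr P x) = id_blinfun"
  using strat[of x] by (auto simp: local_stratification_def)

lemma strat0D: "constr P x \<in> strat0_dom P (constr P x)"
    "C2_map_on (mfY P) vec_manifold (strat0_dom P (constr P x)) (strat0 P (constr P x))"
    "tangent_map (mfY P) vec_manifold (strat0 P (constr P x)) (constr P x) = id_blinfun"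
  using strat0[of x] by (auto simp: local_stratification_def)

lemma retr_inv_retr: "d \<in> retr_inv_dom P x \<Longrightarrow> retr_inv P x (retr P x d) = d"
  using retr_inv_dom(2)[of x] unfolding retr_inv_def diffeo_nhd_def by (auto intro: inv_into_f_f)

lemma retr_retr_inv: "y \<in> retr P x ` retr_inv_dom P x \<Longrightarrow> retr P x (retr_inv P x y) = y"
  unfolding retr_inv_def by (rule f_inv_into_f)

lemma retr_inv_self: "retr_inv P x x = 0"
  using retr_inv_retr[of 0 x] retr_inv_dom(2)[of x] retrD(4) by (auto simp: diffeo_nhd_def)

lemma pb_obj_C2: "C2_on (retr_dom P x) (pb_obj P x)"
proof -
  have "C2_map_on vec_manifold vec_manifold (retr_dom P x) (\<lambda>d. obj P (retr P x d))"
    by (rule C2_map_on_compose[OF vec manifold_X vec retrD(3) obj_C2 retrD(1)]) auto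
  then show ?thesis by (simp add: C2_map_on_vec_iff pb_obj_def[abs_def])
qed

lemma constr_retr_C2: "C2_map_on vec_manifold (mfY P) (retr_dom P x) (\<lambda>d. constr P (retr P x d))"
  by (rule C2_map_on_compose[OF vec manifold_X manifold_Y retrD(3) constr_C2 retrD(1)]) auto

lemma strat_constr_C2: "C2_on (retr_dom P x) (\<lambda>d. strat P (constr P x) (constr P (retr P x d)))"
proof -
  have "C2_map_on vec_manifold vec_manifold (retr_dom P x) (\<lambda>d. strat P (constr P x) (constr P (retr P x d)))"
    by (rule C2_map_on_compose[OF vec manifold_Y vec constr_retr_C2 stratD(1) retrD(1)]) auto
  then show ?thesis by (simp add: C2_map_on_vec_iff)
qed

lemma pb_constr_C2: "C2_on (retr_dom P x) (pb_constr P x)"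
  using C2_on_diff_const(1)[OF strat_constr_C2 retrD(1)] by (simp add: pb_constr_def[abs_def])

text \<open>Separates the stratification, which may degenerate away from \<open>constr P x\<close>,
  from the constraint itself, whose tangent map determines the feasible directions.\<close>

lemma D_pb_constr:
  assumes "d \<in> retr_dom P x"
  shows "D (pb_constr P x) d = tangent_map (mfY P) vec_manifold (strat P (constr P x)) (constr P (retr P x d))
    o\<^sub>L tangent_map vec_manifold (mfY P) (\<lambda>d. constr P (retr P x d)) d"
proof -
  have "D (pb_constr P x) d = D (\<lambda>d. strat P (constr P x) (constr P (retr P x d))) d"
    unfolding pb_constr_def[abs_def] by (rule C2_on_diff_const(2)[OF strat_constr_C2 retrD(1) assms])
  also have "\<dots> = tangent_map (mfY P) vec_manifold (strat P (constr P x)) (constr P (retr P x d))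
    o\<^sub>L tangent_map vec_manifold (mfY P) (\<lambda>d. constr P (retr P x d)) d"
    using tangent_map_compose[OF vec manifold_Y vec constr_retr_C2 stratD(1) assms] by simp
  finally show ?thesis .
qed

lemma lagrangian_C2: "C2_on (retr_dom P x) (lagrangian P x p)"
    and D_lagrangian: "d \<in> retr_dom P x \<Longrightarrow> D (lagrangian P x p) d = D (pb_obj P x) d + (p o\<^sub>L D (pb_constr P x) d)"
    and D2_lagrangian: "d \<in> retr_dom P x \<Longrightarrow>
      D2 (lagrangian P x p) d v w = D2 (pb_obj P x) d v w + p (D2 (pb_constr P x) d v w)"
proof -
  note pc = C2_on_blinfun_compose[OF pb_constr_C2 retrD(1), where p = p]
  note s = C2_on_add[OF pb_obj_C2 pc(1) retrD(1), folded lagrangian_def]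
  show "C2_on (retr_dom P x) (lagrangian P x p)" by (rule s(1))
  assume d: "d \<in> retr_dom P x"
  show "D (lagrangian P x p) d = D (pb_obj P x) d + (p o\<^sub>L D (pb_constr P x) d)"
    using s(2)[OF d] by (simp add: pc(2)[OF d])
  show "D2 (lagrangian P x p) d v w = D2 (pb_obj P x) d v w + p (D2 (pb_constr P x) d v w)"
    using s(3)[OF d] by (simp add: blinfun.add_left pc(3)[OF d])
qed

text \<open>At \<open>z\<close>, the derivative of the stratification \<open>strat\<close> might have a kernel, in which case
  \<open>pb_constr\<close> would not describe the feasible set. It is injective because it is so at the other end
  of the path \<open>t \<mapsto> c (R (t * z))\<close>, along which it stays surjective.\<close>

lemma pb_obj_stationary:
  assumes min: "local_minimizer P xs" and zx: "retr P x z = xs"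
    and seg: "\<And>t. t \<in> {0..1} \<Longrightarrow> t *\<^sub>R z \<in> retr_dom P x"
    and surj: "\<And>t. t \<in> {0..1} \<Longrightarrow> surj (blinfun_apply (D (pb_constr P x) (t *\<^sub>R z)))"
    and v: "D (pb_constr P x) z v = 0"
  shows "D (pb_obj P x) z v = 0"
proof -
  let ?T = "\<lambda>y. tangent_map (mfY P) vec_manifold (strat P (constr P x)) y"
  let ?B = "\<lambda>d. tangent_map vec_manifold (mfY P) (\<lambda>d. constr P (retr P x d)) d"
  have zV: "z \<in> retr_dom P x" using seg[of 1] by simp
  have cz: "constr P (retr P x z) = target P" using min zx by (simp add: local_minimizer_def)
  have C: "D (pb_constr P x) d = ?T (constr P (retr P x d)) o\<^sub>L ?B d" if "d \<in> retr_dom P x" for d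
    by (rule D_pb_constr[OF that])
  have "inj (blinfun_apply (?T (constr P (retr P x (1 *\<^sub>R z)))))"
  proof (rule injective_tangent_map_along_connected[where I = "{0..1::real}"
        and \<gamma> = "\<lambda>t. constr P (retr P x (t *\<^sub>R z))" and ?t0.0 = 0, OF manifold_Y stratD(1)])
    show "continuous_on {0..1::real} (\<lambda>t. constr P (retr P x (t *\<^sub>R z)))"
      by (rule continuous_on_compose2[OF C2_map_on_continuous[OF constr_retr_C2]])
        (use seg in \<open>auto intro!: continuous_intros\<close>)
    show "surj (blinfun_apply (?T (constr P (retr P x (t *\<^sub>R z)))))" if t: "t \<in> {0..1}" for t
    proof -
      have "\<exists>u. w = ?T (constr P (retr P x (t *\<^sub>R z))) u" for w
      proof -
        obtain u where "w = D (pb_constr P x) (t *\<^sub>R z) u"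
          using surj[OF t] unfolding surj_def by blast
        then show ?thesis by (auto simp: C[OF seg[OF t]])
      qed
      then show ?thesis unfolding surj_def by blast
    qed
    show "inj (blinfun_apply (?T (constr P (retr P x (0 *\<^sub>R z)))))"
      using retrD(4)[of x] stratD(2)[of x] by (simp add: id_blinfun.rep_eq)
  qed auto
  then have injT: "inj (blinfun_apply (?T (target P)))" by (simp add: cz)
  have Cz: "D (pb_constr P x) z u = ?T (target P) (?B z u)" for u
    using C[OF zV] by (simp add: cz)
  obtain V \<psi> where V: "chart_at (mfY P) (target P) = (V, \<psi>)" "(V, \<psi>) \<in> atlas (mfY P)" "target P \<in> V"
    using C2_manifold_chart_at[OF manifold_Y] by metis
  obtain N where N: "open N" "xs \<in> N" "\<And>x'. x' \<in> N \<Longrightarrow> constr P x' = target P \<Longrightarrow> obj P xs \<le> obj P x'"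
    using min unfolding local_minimizer_def by blast
  define Z where "Z = {d \<in> retr_dom P x. constr P (retr P x d) \<in> V} \<inter> {d \<in> retr_dom P x. retr P x d \<in> N}"
  have oZ: "open Z"
    unfolding Z_def
    using C2_map_on_open_preimage[OF constr_retr_C2 C2_manifold_chart(1)[OF manifold_Y V(2)]]
      C2_map_on_open_preimage[OF retrD(3) N(1)] by auto
  have zZ: "z \<in> Z" using zV cz V(3) N(2) zx by (simp add: Z_def)
  \<comment> \<open>The chart \<open>\<psi>\<close> replaces the stratification. It is injective on
    \<open>V\<close>, so within \<open>Z\<close> the level set of \<open>?g\<close> through
    \<open>z\<close> is exactly the feasible set; its tangent map at \<open>target P\<close> is the
    identity, so \<open>D ?g z\<close> is \<open>?B z\<close>.\<close>
  let ?g = "\<lambda>d. \<psi> (constr P (retr P x d))"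
  have "C2_map_on vec_manifold vec_manifold Z ?g"
    by (rule C2_map_on_compose[OF vec manifold_Y vec constr_retr_C2 C2_map_on_chart[OF manifold_Y V(2)] oZ])
      (auto simp: Z_def)
  then have g: "C2_on Z ?g" by (simp add: C2_map_on_vec_iff)
  have f: "C2_on Z (pb_obj P x)"
    by (rule C2_on_subset[OF pb_obj_C2]) (auto simp: Z_def)
  have Dg: "D ?g z = ?B z"
    using tangent_map_compose[OF vec manifold_Y vec constr_retr_C2 C2_map_on_chart[OF manifold_Y V(2)] zV]
    by (simp add: cz V(3) tangent_map_own_chart[OF manifold_Y V(1)])
      (rule blinfun_eqI, simp add: id_blinfun.rep_eq)
  \<comment> \<open>The composite with \<open>?T (target P)\<close> is surjective and
    \<open>?T (target P)\<close> is injective, so a preimage of \<open>?T (target P) w\<close> under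
    the composite is one of \<open>w\<close> under \<open>?B z\<close>.\<close>
  have surjB: "surj (blinfun_apply (?B z))"
  proof -
    have "\<exists>u. w = ?B z u" for w
    proof -
      obtain u where "?T (target P) w = D (pb_constr P x) z u"
        using surj[of 1] by (auto simp: surj_def)
      then show ?thesis using injT Cz by (metis injD)
    qed
    then show ?thesis by (simp add: surj_def)
  qed
  have "?T (target P) (?B z v) = ?T (target P) 0" using v Cz by (simp add: blinfun.zero_right)
  then have Bv: "?B z v = 0" using injT by (metis injD)
  show ?thesis
  proof (rule constrained_minimizer_stationary[OF g f oZ zZ])
    show "surj (blinfun_apply (D ?g z))" using surjB Dg by simp
    show "D ?g z v = 0" using Bv Dg by simp
    fix d assume d: "d \<in> Z" "?g d = ?g z"
    then have "constr P (retr P x d) = constr P (retr P x z)"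
      using C2_manifold_chart(2)[OF manifold_Y V(2)] zZ by (auto simp: Z_def inj_on_def)
    then show "pb_obj P x z \<le> pb_obj P x d"
      using N(3) d(1) cz by (simp add: pb_obj_def zx Z_def)
  qed
qed

text \<open>Resolves the arbitrary choice in \<open>transition\<close>: near 0 one retraction
  factors through the other. Both have the identity as tangent map at 0, so the chain rule forces
  the same for the transition.\<close>

lemma transition:
  obtains T where "open T" "0 \<in> T" "T \<subseteq> retr_dom P x" "C2_on T (transition P x)"
    "\<And>d. d \<in> T \<Longrightarrow> transition P x d \<in> retr0_dom P x"
    "\<And>d. d \<in> T \<Longrightarrow> retr0 P x (transition P x d) = retr P x d"
    "transition P x 0 = 0" "D (transition P x) 0 = id_blinfun"
proof -
  define W where "W = (SOME W. W \<subseteq> retr0_dom P x \<and> diffeo_nhd (mfX P) W (retr0 P x))"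
  have "W \<subseteq> retr0_dom P x \<and> diffeo_nhd (mfX P) W (retr0 P x)"
    unfolding W_def using local_retraction_diffeo_nhd[OF manifold_X retr0] by (rule someI_ex)
  then have W: "W \<subseteq> retr0_dom P x" "0 \<in> W" "inj_on (retr0 P x) W"
    "C2_map_on (mfX P) vec_manifold (retr0 P x ` W) (inv_into W (retr0 P x))"
    by (auto simp: diffeo_nhd_def)
  have \<Phi>: "transition P x = (\<lambda>d. inv_into W (retr0 P x) (retr P x d))"
    by (simp add: transition_def W_def o_def)
  define T where "T = {d \<in> retr_dom P x. retr P x d \<in> retr0 P x ` W}"
  have T: "open T" "T \<subseteq> retr_dom P x"
    unfolding T_def using C2_map_on_open_preimage[OF retrD(3) C2_map_on_open[OF W(4)]] by auto
  have xW: "x \<in> retr0 P x ` W" using W(2) retr0D(4) by (metis imageI)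
  then have T0: "0 \<in> T" using retrD(2,4) by (simp add: T_def)
  have C2: "C2_map_on vec_manifold vec_manifold T (transition P x)"
    unfolding \<Phi> by (rule C2_map_on_compose[OF vec manifold_X vec retrD(3) W(4) T]) (auto simp: T_def)
  have in_W: "transition P x d \<in> W" "retr0 P x (transition P x d) = retr P x d" if "d \<in> T" for d
    using that unfolding \<Phi> T_def by (auto intro: inv_into_into f_inv_into_f)
  have \<Phi>0: "transition P x 0 = 0"
  proof (rule inj_onD[OF W(3)])
    show "retr0 P x (transition P x 0) = retr0 P x 0"
      using in_W(2)[OF T0] by (simp add: retr0D(4) retrD(4))
  qed (use in_W(1)[OF T0] W(2) in auto)
  have "id_blinfun = tangent_map vec_manifold (mfX P) (retr P x) 0" by (simp add: retrD(5))
  also have "\<dots> = tangent_map vec_manifold (mfX P) (\<lambda>d. retr0 P x (transition P x d)) 0"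
    by (rule tangent_map_cong[OF vec T(1) T0]) (simp add: in_W)
  also have "\<dots> = tangent_map vec_manifold (mfX P) (retr0 P x) 0 o\<^sub>L D (transition P x) 0"
    using tangent_map_compose[OF vec vec manifold_X C2 retr0D(3) T0] in_W(1)[OF T0] W(1)
    by (simp add: \<Phi>0 retr0D(2))
  also have "\<dots> = D (transition P x) 0"
    by (rule blinfun_eqI) (simp add: retr0D(5) id_blinfun.rep_eq)
  finally have "D (transition P x) 0 = id_blinfun" by simp
  moreover have "C2_on T (transition P x)" using C2 by (simp add: C2_map_on_vec_iff)
  ultimately show thesis using that[of T] T T0 in_W W(1) \<Phi>0 by blast
qed

text \<open>The stratifications contribute second-order terms of the form
  \<open>S''(c'(0) v, c'(0) w)\<close> only; these vanish for \<open>w\<close> in the kernel of \<open>c'(0)\<close>.\<close>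

lemma D2_lagrangian_kernel:
  assumes w: "D (pb_constr P x) 0 w = 0"
  shows "D2 (lagrangian P x p) 0 v w =
    D2 (lagrangian0 P x p) 0 v w + D (lagrangian P x p) 0 (D2 (transition P x) 0 v w)"
    and "\<exists>T. open T \<and> 0 \<in> T \<and> C2_on T (lagrangian0 P x p)"
proof -
  let ?y = "constr P x" and ?\<Phi> = "transition P x"
  obtain T where T: "open T" "0 \<in> T" "T \<subseteq> retr_dom P x" "C2_on T ?\<Phi>"
    "\<And>d. d \<in> T \<Longrightarrow> ?\<Phi> d \<in> retr0_dom P x" "\<And>d. d \<in> T \<Longrightarrow> retr0 P x (?\<Phi> d) = retr P x d"
    "?\<Phi> 0 = 0" "D ?\<Phi> 0 = id_blinfun" by (rule transition[of x]) blast
  obtain V \<psi> where V: "chart_at (mfY P) ?y = (V, \<psi>)" "(V, \<psi>) \<in> atlas (mfY P)" "?y \<in> V"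
    using C2_manifold_chart_at[OF manifold_Y] by metis
  let ?co = "\<lambda>d. constr P (retr0 P x d)"
  have c0: "C2_map_on vec_manifold (mfY P) (retr0_dom P x) ?co"
    by (rule C2_map_on_compose[OF vec manifold_X manifold_Y retr0D(3) constr_C2 retr0D(1)]) auto
  define A where "A = {d \<in> retr0_dom P x. ?co d \<in> V \<inter> strat0_dom P ?y}"
  have oV: "open V" "open (\<psi> ` V)" using C2_manifold_chart[OF manifold_Y V(2)] by auto
  have A: "open A" "0 \<in> A" "A \<subseteq> retr0_dom P x"
    unfolding A_def using C2_map_on_open_preimage[OF c0, of "V \<inter> strat0_dom P ?y"]
      oV C2_map_on_open[OF strat0D(2)] retr0D(2,4) V(3) strat0D(1) by auto
  \<comment> \<open>Everything is factored through the chart \<open>\<psi>\<close> of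
    \<open>Y\<close>: \<open>?a\<close> is the constraint in the coordinates of
    \<open>retr0\<close>, the two stratifications become \<open>?s\<close> and \<open>?so\<close>,
    and the other retraction enters through \<open>?\<Phi>\<close> alone. At
    \<open>\<psi> ?y\<close> both \<open>?s\<close> and \<open>?so\<close> have the identity as
    derivative.\<close>
  let ?fo = "\<lambda>d. obj P (retr0 P x d)" and ?a = "\<lambda>d. \<psi> (?co d)"
    and ?s = "\<lambda>e. strat P ?y (inv_into V \<psi> e)" and ?so = "\<lambda>e. strat0 P ?y (inv_into V \<psi> e)"
  have "C2_map_on vec_manifold vec_manifold A ?fo"
    by (rule C2_map_on_compose[OF vec manifold_X vec retr0D(3) obj_C2 A(1,3)]) auto
  then have f0: "C2_on A ?fo" by (simp add: C2_map_on_vec_iff)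
  have "C2_map_on vec_manifold vec_manifold A ?a"
    by (rule C2_map_on_compose[OF vec manifold_Y vec c0 C2_map_on_chart[OF manifold_Y V(2)] A(1,3)])
      (auto simp: A_def)
  then have a: "C2_on A ?a" by (simp add: C2_map_on_vec_iff)
  have "C2_map_on vec_manifold vec_manifold (\<psi> ` V) ?s"
    by (rule C2_map_on_compose[OF vec manifold_Y vec C2_map_on_inv_chart[OF manifold_Y V(2)] stratD(1) oV(2)]) auto
  then have s: "C2_on (\<psi> ` V) ?s" by (simp add: C2_map_on_vec_iff)
  define V' where "V' = \<psi> ` (V \<inter> strat0_dom P ?y)"
  have oV': "open V'"
    unfolding V'_def using oV C2_map_on_open[OF strat0D(2)]
    by (intro C2_manifold_chart(5)[OF manifold_Y V(2)]) auto
  have "C2_map_on vec_manifold vec_manifold V' ?so"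
    by (rule C2_map_on_compose[OF vec manifold_Y vec C2_map_on_inv_chart[OF manifold_Y V(2)] strat0D(2) oV'])
      (auto simp: V'_def inv_into_chart[OF manifold_Y V(2)])
  then have s0: "C2_on V' ?so" by (simp add: C2_map_on_vec_iff)
  have Ds: "D ?s (\<psi> ?y) = id_blinfun"
    using stratD(2)[of x] by (simp add: tangent_map_def V(1) o_def)
  have Ds0: "D ?so (\<psi> ?y) = id_blinfun"
    using strat0D(3)[of x] by (simp add: tangent_map_def V(1) o_def)
  have a0: "?a 0 = \<psi> ?y" by (simp add: retr0D(4))
  have aV': "?a d \<in> V'" if "d \<in> A" for d using that by (auto simp: A_def V'_def)

  define T' where "T' = {d \<in> T. ?\<Phi> d \<in> A}"
  have T': "open T'" "0 \<in> T'" "T' \<subseteq> T"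
    unfolding T'_def using C2_on_open_vimage[OF T(4,1) A(1)] T(2,7) A(2) by auto
  have \<Phi>: "C2_on T' ?\<Phi>" by (rule C2_on_subset[OF T(4) T'(3)])
  have \<Phi>A: "?\<Phi> d \<in> A" if "d \<in> T'" for d using that by (simp add: T'_def)

  have sa0: "C2_on A (\<lambda>d. ?so (?a d) - strat0 P ?y (target P))"
    by (rule C2_on_diff_const(1)[OF C2_on_compose(1)[OF a s0 A(1) oV' aV'] A(1)])
  have L0_eq: "lagrangian0 P x p d = ?fo d + p (?so (?a d) - strat0 P ?y (target P))" if "d \<in> A" for d
    using that by (simp add: lagrangian0_def A_def inv_into_chart[OF manifold_Y V(2)])
  have L0_C2: "C2_on A (\<lambda>d. ?fo d + p (?so (?a d) - strat0 P ?y (target P)))"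
    by (rule C2_on_add(1)[OF f0 C2_on_blinfun_compose(1)[OF sa0 A(1)] A(1)])
  then have "C2_on A (lagrangian0 P x p)"
    by (rule C2_on_cong[OF _ A(1)]) (simp add: L0_eq)
  then show "\<exists>T. open T \<and> 0 \<in> T \<and> C2_on T (lagrangian0 P x p)" using A by blast

  have Dc: "D (pb_constr P x) 0 = D ?a 0"
    and D2c: "D2 (pb_constr P x) 0 v w = D2 ?s (\<psi> ?y) (D ?a 0 v) (D ?a 0 w) + (D2 ?a 0 v w + D ?a 0 (D2 ?\<Phi> 0 v w))"
  proof -
    let ?h = "\<lambda>d. ?s (?a (?\<Phi> d)) - strat P ?y (target P)"
    have eq: "pb_constr P x d = ?h d" if "d \<in> T'" for d
      using that \<Phi>A[OF that] T'(3) T(6)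
      by (auto simp: pb_constr_def A_def inv_into_chart[OF manifold_Y V(2)])
    note b = C2_on_compose[OF \<Phi> a T'(1) A(1) \<Phi>A]
    have aV: "?a (?\<Phi> d) \<in> \<psi> ` V" if "d \<in> T'" for d using \<Phi>A[OF that] by (auto simp: A_def)
    note e = C2_on_compose[OF b(1) s T'(1) oV(2) aV]
    note h = C2_on_diff_const[OF e(1) T'(1), where k = "strat P ?y (target P)"]
    have Db: "D (\<lambda>d. ?a (?\<Phi> d)) 0 = D ?a 0"
      using b(2)[OF _ T'(2)] by (simp add: T(7,8)) (rule blinfun_eqI, simp add: id_blinfun.rep_eq)
    have "D (pb_constr P x) 0 = D ?h 0" by (rule D_cong_open[OF T'(1,2) eq])
    also have "\<dots> = D ?s (\<psi> ?y) o\<^sub>L D ?a 0"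
      using h(2)[OF _ _ T'(2)] e(2)[OF _ _ T'(2)] by (simp add: Db T(7) a0[simplified])
    finally show "D (pb_constr P x) 0 = D ?a 0"
      by (simp add: Ds) (rule blinfun_eqI, simp add: id_blinfun.rep_eq)
    have "D2 (pb_constr P x) 0 v w = D2 ?h 0 v w" by (simp add: D2_cong_open[OF T'(1,2) eq])
    also have "\<dots> = D2 ?s (\<psi> ?y) (D ?a 0 v) (D ?a 0 w) + D2 (\<lambda>d. ?a (?\<Phi> d)) 0 v w"
      using h(3)[OF _ _ T'(2)] e(3)[OF _ _ T'(2), of v w] by (simp add: Db T(7) a0[simplified] Ds)
    also have "D2 (\<lambda>d. ?a (?\<Phi> d)) 0 v w = D2 ?a 0 v w + D ?a 0 (D2 ?\<Phi> 0 v w)"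
      using b(3)[OF _ T'(2), of v w] by (simp add: T(7,8))
    finally show "D2 (pb_constr P x) 0 v w = D2 ?s (\<psi> ?y) (D ?a 0 v) (D ?a 0 w)
        + (D2 ?a 0 v w + D ?a 0 (D2 ?\<Phi> 0 v w))" .
  qed
  have Df: "D (pb_obj P x) 0 = D ?fo 0"
    and D2f: "D2 (pb_obj P x) 0 v w = D2 ?fo 0 v w + D ?fo 0 (D2 ?\<Phi> 0 v w)"
  proof -
    have eq: "pb_obj P x d = ?fo (?\<Phi> d)" if "d \<in> T'" for d
      using that T'(3) T(6) by (auto simp: pb_obj_def)
    note b = C2_on_compose[OF \<Phi> f0 T'(1) A(1) \<Phi>A]
    have "D (pb_obj P x) 0 = D (\<lambda>d. ?fo (?\<Phi> d)) 0" by (rule D_cong_open[OF T'(1,2) eq])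
    then show "D (pb_obj P x) 0 = D ?fo 0"
      using b(2)[OF _ T'(2)] by (simp add: T(7,8)) (rule blinfun_eqI, simp add: id_blinfun.rep_eq)
    show "D2 (pb_obj P x) 0 v w = D2 ?fo 0 v w + D ?fo 0 (D2 ?\<Phi> 0 v w)"
      using D2_cong_open[OF T'(1,2) eq] b(3)[OF _ T'(2), of v w] by (simp add: T(7,8))
  qed
  have aw: "D ?a 0 w = 0" using w Dc by simp
  have D2L0: "D2 (lagrangian0 P x p) 0 v w = D2 ?fo 0 v w + p (D2 ?a 0 v w)"
  proof -
    note e = C2_on_compose[OF a s0 A(1) oV' aV']
    have "D2 (lagrangian0 P x p) 0 v w = D2 (\<lambda>d. ?fo d + p (?so (?a d) - strat0 P ?y (target P))) 0 v w"
      by (simp add: D2_cong_open[OF A(1,2) L0_eq])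
    also have "\<dots> = D2 ?fo 0 v w + p (D2 (\<lambda>d. ?so (?a d) - strat0 P ?y (target P)) 0 v w)"
      using C2_on_add(3)[OF f0 C2_on_blinfun_compose(1)[OF sa0 A(1)] A(1,2), of p]
        C2_on_blinfun_compose(3)[OF sa0 A(1,2), of p v w] by (simp add: blinfun.add_left)
    also have "D2 (\<lambda>d. ?so (?a d) - strat0 P ?y (target P)) 0 v w = D2 (\<lambda>d. ?so (?a d)) 0 v w"
      using C2_on_diff_const(3)[OF e(1) A(1,2)] by simp
    also have "\<dots> = D2 ?a 0 v w"
      using e(3)[OF _ A(2), of v w] by (simp add: aw[simplified] a0[simplified] Ds0 blinfun.zero_right)
    finally show ?thesis .
  qed
  show "D2 (lagrangian P x p) 0 v w =
    D2 (lagrangian0 P x p) 0 v w + D (lagrangian P x p) 0 (D2 ?\<Phi> 0 v w)"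
    by (simp add: D2_lagrangian D_lagrangian retrD(2) D2f D2c D2L0 Df Dc aw[simplified] blinfun.bilinear_simps
        algebra_simps)
qed

end


section \<open>One Lagrange-Newton step\<close>

text \<open>The estimates of (A) and (B) at one iterate, with constants made nonnegative, so that a
  bound expressed in these constants is uniform in \<open>x\<close>. The bound \<open>K\<close> on
  f'(0) is extra and is supplied by \<open>pb_obj_derivative_bounded\<close>. The requirement
  \<open>\<omega>c * ip_norm (scal P x) z <= 1/2\<close> is what keeps c' surjective between 0 and
  \<open>z\<close>.\<close>

locale sqp_step = sqp_problem P
  for P :: "('x::t2_space, 'y::t2_space, 'e::{real_inner, banach}, 'f::{real_inner, banach}) problem" +
  fixes x :: 'x and xs :: 'x and z :: 'e and \<rho> :: real and \<rho>0 :: real and K :: real and \<omega>f :: real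
    and \<omega>c :: real and \<omega>c' :: real and \<omega>L :: real and \<alpha> :: real and \<mu>L :: real and \<mu>\<Phi> :: real
  assumes minimizer: "local_minimizer P xs" and z_xs: "retr P x z = xs"
    and dom: "\<And>d. ip_norm (scal P x) d < \<rho> \<Longrightarrow> d \<in> retr_dom P x"
    and z_small: "ip_norm (scal P x) z < \<rho>" "ip_norm (scal P x) z \<le> \<rho>0" "\<omega>c * ip_norm (scal P x) z \<le> 1/2"
    and constants: "0 \<le> K" "0 \<le> \<omega>f" "0 \<le> \<omega>c" "0 \<le> \<omega>c'" "0 \<le> \<omega>L" "0 < \<alpha>" "0 \<le> \<mu>L" "0 \<le> \<mu>\<Phi>"
    and D_obj_bound: "\<And>v. \<bar>D (pb_obj P x) 0 v\<bar> \<le> K * ip_norm (scal P x) v"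
    and D_obj_lipschitz: "\<And>d. d \<in> retr_dom P x \<Longrightarrow> ip_norm (scal P x) d \<le> \<rho>0 \<Longrightarrow>
      dual_norm (scal P x) (D (pb_obj P x) d - D (pb_obj P x) 0) \<le> \<omega>f * ip_norm (scal P x) d"
    and surj0: "surj (blinfun_apply (D (pb_constr P x) 0))"
    and D_constr_lipschitz: "\<And>d v. d \<in> retr_dom P x \<Longrightarrow> ip_norm (scal P x) d \<le> \<rho>0 \<Longrightarrow>
      ip_norm (scal P x) (pseudo_inverse (scal P x) (D (pb_constr P x) 0) ((D (pb_constr P x) d - D (pb_constr P x) 0) v))
      \<le> \<omega>c * ip_norm (scal P x) d * ip_norm (scal P x) v"
    and surjz: "surj (blinfun_apply (D (pb_constr P x) z))"
    and D_constr_lipschitz': "\<And>v.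
      ip_norm (scal P x) (pseudo_inverse (scal P x) (D (pb_constr P x) z) ((D (pb_constr P x) z - D (pb_constr P x) 0) v))
      \<le> \<omega>c' * ip_norm (scal P x) z * ip_norm (scal P x) v"
    and D2_lipschitz: "\<And>d v w. d \<in> retr_dom P x \<Longrightarrow> ip_norm (scal P x) d \<le> \<rho>0 \<Longrightarrow>
      \<bar>(D2 (lagrangian P x (multiplier P x)) d - D2 (lagrangian P x (multiplier P x)) 0) v w\<bar>
      \<le> \<omega>L * ip_norm (scal P x) d * ip_norm (scal P x) v * ip_norm (scal P x) w"
    and coercive: "\<And>v. D (pb_constr P x) 0 v = 0 \<Longrightarrow>
      \<alpha> * (ip_norm (scal P x) v)\<^sup>2 \<le> D2 (lagrangian0 P x (multiplier P x)) 0 v v"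
    and D2_bound: "\<And>v w. \<bar>D2 (lagrangian0 P x (multiplier P x)) 0 v w\<bar>
      \<le> \<mu>L * ip_norm (scal P x) v * ip_norm (scal P x) w"
    and transition_bound: "\<And>v w. ip_norm (scal P x) (D2 (transition P x) 0 v w)
      \<le> \<mu>\<Phi> * ip_norm (scal P x) v * ip_norm (scal P x) w"
begin

abbreviation "N \<equiv> ip_norm (scal P x)"
abbreviation "C \<equiv> D (pb_constr P x)"
abbreviation "F \<equiv> D (pb_obj P x)"
abbreviation "p \<equiv> multiplier P x"
abbreviation "L \<equiv> D (lagrangian P x p)"
abbreviation "a \<equiv> D2 (lagrangian0 P x p) 0"

sublocale c0: surjective_constraint "scal P x" "C 0"
  using scal_compatible[of x] surj0 by (simp add: surjective_constraint_def surjective_constraint_axioms_def)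

sublocale cz: surjective_constraint "scal P x" "C z"
  using scal_compatible[of x] surjz by (simp add: surjective_constraint_def surjective_constraint_axioms_def)

lemma z_dom: "z \<in> retr_dom P x"
  by (rule dom) (rule z_small)

lemma segment:
  assumes "t \<in> {0..1}"
  shows "N (t *\<^sub>R z) \<le> N z" "t *\<^sub>R z \<in> retr_dom P x"
proof -
  show "N (t *\<^sub>R z) \<le> N z"
    using assms mult_right_mono[of t 1 "N z"] by (simp add: c0.ip_norm_scaleR)
  then show "t *\<^sub>R z \<in> retr_dom P x" using z_small by (intro dom) linarith
qed

text \<open>\<open>c0.pinv\<close> is a right inverse of c'(t z) up to a relative error of at most
  1/2, provided that residuals are measured by \<open>N (c0.pinv w)\<close>, the only quantity that
  the Lipschitz condition on c' controls. Successive approximation with this gauge produces exact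
  solutions.\<close>

lemma surj_segment:
  assumes t: "t \<in> {0..1}"
  shows "surj (blinfun_apply (C (t *\<^sub>R z)))"
proof -
  obtain m M where m: "m > 0" "M > 0" "\<And>v. m * norm v \<le> N v" "\<And>v. N v \<le> M * norm v"
    by (rule c0.norm_equiv) blast
  have le: "norm v \<le> 1 / m * N v" for v using m(1) m(3)[of v] by (simp add: field_simps)
  have "\<exists>v. C (t *\<^sub>R z) v = w \<and> norm v \<le> 2 * (1 / m) * N (c0.pinv w)" for w
  proof (rule solve_by_successive_approximation[where K' = "norm (C 0) * (1 / m)"])
    fix w
    have "N (c0.pinv (w - C (t *\<^sub>R z) (c0.pinv w))) \<le> N (c0.pinv w) / 2"
    proof -
      have "c0.pinv (w - C (t *\<^sub>R z) (c0.pinv w)) = - c0.pinv ((C (t *\<^sub>R z) - C 0) (c0.pinv w))"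
        using linear_diff[OF bounded_linear.linear[OF c0.bounded_linear_pinv]]
        by (simp add: blinfun.diff_left)
      then have "N (c0.pinv (w - C (t *\<^sub>R z) (c0.pinv w))) = N (c0.pinv ((C (t *\<^sub>R z) - C 0) (c0.pinv w)))"
        by simp
      also have "\<dots> \<le> \<omega>c * N (t *\<^sub>R z) * N (c0.pinv w)"
        using segment[OF t] z_small by (intro D_constr_lipschitz) auto
      also have "\<dots> \<le> 1/2 * N (c0.pinv w)"
        using mult_left_mono[OF segment(1)[OF t] constants(3)] z_small(3) by (intro mult_right_mono) auto
      finally show ?thesis by simp
    qed
    then show "\<exists>v. norm v \<le> 1 / m * N (c0.pinv w) \<and> N (c0.pinv (w - C (t *\<^sub>R z) v)) \<le> N (c0.pinv w) / 2"
      using le by blast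
    have "norm (C 0 (c0.pinv w)) \<le> norm (C 0) * norm (c0.pinv w)" by (rule norm_blinfun)
    also have "\<dots> \<le> norm (C 0) * (1 / m * N (c0.pinv w))" by (intro mult_left_mono le norm_ge_zero)
    finally show "norm w \<le> norm (C 0) * (1 / m) * N (c0.pinv w)" by simp
  qed (use m in auto)
  then show ?thesis by (metis surj_def)
qed

lemma stationary: "C z v = 0 \<Longrightarrow> F z v = 0"
  by (rule pb_obj_stationary[OF minimizer z_xs segment(2) surj_segment])

section \<open>First-order estimates at 0 and at the minimizer\<close>

text \<open>\<open>Blinfun\<close> returns the intended map only for a bounded linear argument;
  boundedness of the pseudo-inverse ensures this.\<close>

lemma multiplier_apply: "p w = - F 0 (c0.pinv w)"
proof -
  have "bounded_linear (\<lambda>w. - F 0 (c0.pinv w))"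
    by (intro bounded_linear_minus bounded_linear_compose[OF blinfun.bounded_linear_right c0.bounded_linear_pinv])
  then show ?thesis by (simp add: multiplier_def bounded_linear_Blinfun_apply)
qed

lemma L_apply: "d \<in> retr_dom P x \<Longrightarrow> L d v = F d v - F 0 (c0.pinv (C d v))"
  by (simp add: D_lagrangian blinfun.add_left multiplier_apply)

lemma L0_apply: "L 0 v = F 0 (v - c0.pinv (C 0 v))"
  by (simp add: L_apply retrD(2) blinfun.diff_right)

lemma F_diff: "d \<in> retr_dom P x \<Longrightarrow> N d \<le> \<rho>0 \<Longrightarrow> \<bar>F d v - F 0 v\<bar> \<le> \<omega>f * N d * N v"
  using c0.abs_blinfun_le_dual_norm[of "F d - F 0" v]
    mult_right_mono[OF D_obj_lipschitz c0.ip_norm_nonneg, of d v] by (simp add: blinfun.diff_left)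

text \<open>\<open>K1\<close> bounds f'(z); \<open>K2 * N z\<close> bounds f'(0) on the kernel of
  c'(0), and hence L'(0); \<open>K3 * N z\<close> bounds L'(z); \<open>K4\<close> times the square
  of \<open>N z\<close> bounds L'(z) on the kernel of c'(0). None of the four involves
  \<open>x\<close>.\<close>

definition "K1 = K + \<omega>f * \<rho>0"
definition "K2 = \<omega>f + K1 * \<omega>c'"
definition "K3 = K2 + \<omega>f + K * \<omega>c"
definition "K4 = K3 * \<omega>c'"

lemma K_nonneg: "0 \<le> \<rho>0" "0 \<le> K1" "0 \<le> K2" "0 \<le> K3" "0 \<le> K4"
proof -
  show "0 \<le> \<rho>0" using z_small(2) c0.ip_norm_nonneg[of z] by linarith
  then show "0 \<le> K1" using constants by (simp add: K1_def)
  then show "0 \<le> K2" using constants by (simp add: K2_def)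
  then show "0 \<le> K3" using constants by (simp add: K3_def)
  then show "0 \<le> K4" using constants by (simp add: K4_def)
qed

lemma F_z_bound: "\<bar>F z v\<bar> \<le> K1 * N v"
proof -
  have "\<bar>F z v\<bar> \<le> \<omega>f * N z * N v + K * N v"
    using F_diff[OF z_dom z_small(2), of v] D_obj_bound[of v] by linarith
  also have "\<omega>f * N z * N v \<le> \<omega>f * \<rho>0 * N v"
    using z_small(2) constants by (intro mult_right_mono mult_left_mono) auto
  finally show ?thesis by (simp add: K1_def distrib_right)
qed

lemma pinv_z_kernel: "C 0 w = 0 \<Longrightarrow> N (cz.pinv (C z w)) \<le> \<omega>c' * N z * N w"
  using D_constr_lipschitz'[of w] by (simp add: blinfun.diff_left)

text \<open>f'(z) vanishes on the kernel of c'(z), so for \<open>w\<close> in the kernel of c'(0)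
  only the component \<open>cz.pinv (C z w)\<close> counts, which is of order \<open>N z\<close>.
  The Lipschitz condition on f' then leads from \<open>z\<close> back to 0.\<close>

lemma F_0_kernel:
  assumes w: "C 0 w = 0"
  shows "\<bar>F 0 w\<bar> \<le> K2 * N z * N w"
proof -
  have "F z w = F z (cz.pinv (C z w))"
    using stationary[OF cz.pinv_projection[of w]] by (simp add: blinfun.diff_right)
  then have "\<bar>F z w\<bar> \<le> K1 * N (cz.pinv (C z w))" using F_z_bound by simp
  also have "\<dots> \<le> K1 * (\<omega>c' * N z * N w)"
    using pinv_z_kernel[OF w] K_nonneg by (intro mult_left_mono) auto
  finally have "\<bar>F 0 w\<bar> \<le> \<omega>f * N z * N w + K1 * (\<omega>c' * N z * N w)"
    using F_diff[OF z_dom z_small(2), of w] by linarith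
  then show ?thesis by (simp add: K2_def algebra_simps)
qed

text \<open>The multiplier cancels f'(0) on the normal component, so \<open>L 0 v\<close> sees only
  the projection of \<open>v\<close> to the kernel.\<close>

lemma L_0_bound: "\<bar>L 0 v\<bar> \<le> K2 * N z * N v"
proof -
  have "\<bar>L 0 v\<bar> \<le> K2 * N z * N (v - c0.pinv (C 0 v))"
    unfolding L0_apply by (rule F_0_kernel) (rule c0.pinv_projection)
  also have "\<dots> \<le> K2 * N z * N v"
    using c0.ip_norm_projection_le[of v] K_nonneg by (intro mult_left_mono) auto
  finally show ?thesis .
qed

text \<open>\<open>L z\<close> differs from \<open>L 0\<close> by the variation of f' and by the
  variation of c' passed through the multiplier. The latter is \<open>F 0\<close> after
  \<open>c0.pinv\<close>, which is why \<open>K\<close> enters \<open>K3\<close>.\<close>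

lemma L_z_bound: "\<bar>L z v\<bar> \<le> K3 * N z * N v"
proof -
  have "L z v = L 0 v + (F z v - F 0 v) - F 0 (c0.pinv ((C z - C 0) v))"
    using linear_diff[OF bounded_linear.linear[OF c0.bounded_linear_pinv]]
    by (simp add: L_apply[OF z_dom] L0_apply blinfun.diff_left blinfun.diff_right)
  moreover have "\<bar>F 0 (c0.pinv ((C z - C 0) v))\<bar> \<le> K * (\<omega>c * N z * N v)"
    by (rule order_trans[OF D_obj_bound mult_left_mono[OF D_constr_lipschitz]])
      (use z_dom z_small constants in auto)
  ultimately have "\<bar>L z v\<bar> \<le> K2 * N z * N v + \<omega>f * N z * N v + K * (\<omega>c * N z * N v)"
    using L_0_bound[of v] F_diff[OF z_dom z_small(2), of v] by linarith
  then show ?thesis by (simp add: K3_def algebra_simps)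
qed

text \<open>The second power of \<open>N z\<close> comes from the vanishing of \<open>L z\<close> on the kernel of \<open>C z\<close>.\<close>

lemma L_z_kernel:
  assumes w: "C 0 w = 0"
  shows "\<bar>L z w\<bar> \<le> K4 * (N z)\<^sup>2 * N w"
proof -
  have "L z (w - cz.pinv (C z w)) = 0"
    using stationary[OF cz.pinv_projection[of w]] cz.pinv_projection[of w]
      linear_0[OF bounded_linear.linear[OF c0.bounded_linear_pinv]]
    by (simp only: L_apply[OF z_dom]) simp
  then have "L z w = L z (cz.pinv (C z w))" by (simp add: blinfun.diff_right)
  then have "\<bar>L z w\<bar> \<le> K3 * N z * N (cz.pinv (C z w))" using L_z_bound by simp
  also have "\<dots> \<le> K3 * N z * (\<omega>c' * N z * N w)"
    using pinv_z_kernel[OF w] K_nonneg by (intro mult_left_mono) auto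
  finally show ?thesis by (simp add: K4_def power2_eq_square algebra_simps)
qed

section \<open>Second-order remainders along the segment\<close>

text \<open>Mean value inequality on the unit interval for \<open>L\<close> along the segment minus
  its linear part. Bounding the derivative by its estimate at the far end gives the factor 1 rather
  than 1/2.\<close>

lemma L_Taylor: "\<bar>L z w - L 0 w - D2 (lagrangian P x p) 0 z w\<bar> \<le> \<omega>L * (N z)\<^sup>2 * N w"
proof -
  let ?L2 = "D2 (lagrangian P x p)"
  let ?\<phi> = "\<lambda>s. L (0 + s *\<^sub>R z) w - s *\<^sub>R ?L2 0 z w"
  have "norm (?\<phi> 1 - ?\<phi> 0) \<le> \<omega>L * (N z)\<^sup>2 * N w * norm (1 - 0 :: real)"
  proof (rule differentiable_bound[where S = "{0..1::real}"])
    fix s :: real assume s: "s \<in> {0..1}"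
    have "(L has_derivative blinfun_apply (?L2 (0 + s *\<^sub>R z))) (at (0 + s *\<^sub>R z))"
      using C2_on_has_derivative_D[OF lagrangian_C2 retrD(1) segment(2)[OF s]] by simp
    then have "((\<lambda>d. L d w) has_derivative (\<lambda>h. ?L2 (0 + s *\<^sub>R z) h w)) (at (0 + s *\<^sub>R z))"
      by (rule bounded_linear.has_derivative[OF blinfun.bounded_linear_left])
    then have "(?\<phi> has_derivative (\<lambda>h. h *\<^sub>R ?L2 (0 + s *\<^sub>R z) z w - h *\<^sub>R ?L2 0 z w)) (at s within {0..1})"
      by (intro has_derivative_diff has_derivative_ray has_derivative_scaleR_left has_derivative_ident)
    then show "(?\<phi> has_derivative (\<lambda>h. h *\<^sub>R (?L2 (s *\<^sub>R z) - ?L2 0) z w)) (at s within {0..1})"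
      by (rule has_derivative_eq_rhs) (simp add: fun_eq_iff blinfun.diff_left algebra_simps)
    have "\<bar>(?L2 (s *\<^sub>R z) - ?L2 0) z w\<bar> \<le> \<omega>L * N (s *\<^sub>R z) * N z * N w"
      using segment[OF s] z_small by (intro D2_lipschitz) auto
    also have "\<dots> \<le> \<omega>L * N z * N z * N w"
      using segment(1)[OF s] constants by (intro mult_right_mono mult_left_mono) auto
    finally have b: "\<bar>(?L2 (s *\<^sub>R z) - ?L2 0) z w\<bar> \<le> \<omega>L * (N z)\<^sup>2 * N w"
      by (simp add: power2_eq_square mult.assoc)
    show "onorm (\<lambda>h. h *\<^sub>R (?L2 (s *\<^sub>R z) - ?L2 0) z w) \<le> \<omega>L * (N z)\<^sup>2 * N w"
    proof (rule onorm_bound)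
      show "norm (h *\<^sub>R (?L2 (s *\<^sub>R z) - ?L2 0) z w) \<le> \<omega>L * (N z)\<^sup>2 * N w * norm h" for h
        using mult_left_mono[OF b abs_ge_zero[of h]] by (simp add: abs_mult mult.commute)
    qed (use constants in simp)
  qed auto
  then show ?thesis by simp
qed

text \<open>\<open>N\<close> is not the norm of the type \<open>'e\<close>, and passing between the
  two would introduce constants that depend on \<open>x\<close>. The remainder is therefore paired
  with the vector \<open>n\<close> that is to be bounded; the scalar mean value inequality and
  Cauchy-Schwarz give a bound with a factor \<open>N n\<close>, which is cancelled at the
  end.\<close>

lemma constr_Taylor: "N (c0.pinv (pb_constr P x z - pb_constr P x 0 - C 0 z)) \<le> \<omega>c * (N z)\<^sup>2"
proof -
  define n where "n = c0.pinv (pb_constr P x z - pb_constr P x 0 - C 0 z)"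
  interpret b: bounded_bilinear "scal P x" by (rule c0.bounded_bilinear)
  let ?l = "\<lambda>u. scal P x n (c0.pinv u)"
  have l: "bounded_linear ?l"
    by (rule bounded_linear_compose[OF b.bounded_linear_right c0.bounded_linear_pinv])
  let ?\<phi> = "\<lambda>s. ?l (pb_constr P x (0 + s *\<^sub>R z)) - s *\<^sub>R ?l (C 0 z)"
  have "norm (?\<phi> 1 - ?\<phi> 0) \<le> N n * (\<omega>c * (N z)\<^sup>2) * norm (1 - 0 :: real)"
  proof (rule differentiable_bound[where S = "{0..1::real}"])
    fix s :: real assume s: "s \<in> {0..1}"
    have "(pb_constr P x has_derivative blinfun_apply (C (0 + s *\<^sub>R z))) (at (0 + s *\<^sub>R z))"
      using C2_on_has_derivative[OF pb_constr_C2 segment(2)[OF s]] by simp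
    then have "((\<lambda>d. ?l (pb_constr P x d)) has_derivative (\<lambda>h. ?l (C (0 + s *\<^sub>R z) h))) (at (0 + s *\<^sub>R z))"
      by (rule bounded_linear.has_derivative[OF l])
    then have "(?\<phi> has_derivative (\<lambda>h. h *\<^sub>R ?l (C (0 + s *\<^sub>R z) z) - h *\<^sub>R ?l (C 0 z))) (at s within {0..1})"
      by (intro has_derivative_diff has_derivative_ray has_derivative_scaleR_left has_derivative_ident)
    then show "(?\<phi> has_derivative (\<lambda>h. h *\<^sub>R ?l ((C (s *\<^sub>R z) - C 0) z))) (at s within {0..1})"
      by (rule has_derivative_eq_rhs)
        (simp add: fun_eq_iff blinfun.diff_left linear_diff[OF bounded_linear.linear[OF l]] algebra_simps)
    have "\<bar>?l ((C (s *\<^sub>R z) - C 0) z)\<bar> \<le> N n * N (c0.pinv ((C (s *\<^sub>R z) - C 0) z))"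
      by (rule c0.Cauchy_Schwarz)
    also have "\<dots> \<le> N n * (\<omega>c * N (s *\<^sub>R z) * N z)"
      using segment[OF s] z_small by (intro mult_left_mono D_constr_lipschitz) auto
    also have "\<dots> \<le> N n * (\<omega>c * N z * N z)"
      using segment(1)[OF s] constants by (intro mult_right_mono mult_left_mono) auto
    finally have b: "\<bar>?l ((C (s *\<^sub>R z) - C 0) z)\<bar> \<le> N n * (\<omega>c * (N z)\<^sup>2)"
      by (simp add: power2_eq_square mult.assoc)
    show "onorm (\<lambda>h. h *\<^sub>R ?l ((C (s *\<^sub>R z) - C 0) z)) \<le> N n * (\<omega>c * (N z)\<^sup>2)"
    proof (rule onorm_bound)
      show "norm (h *\<^sub>R ?l ((C (s *\<^sub>R z) - C 0) z)) \<le> N n * (\<omega>c * (N z)\<^sup>2) * norm h" for h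
        using mult_left_mono[OF b abs_ge_zero[of h]] by (simp add: abs_mult mult.commute)
    qed (use constants in simp)
  qed auto
  moreover have "?\<phi> 1 - ?\<phi> 0 = scal P x n n"
    unfolding n_def by (simp add: linear_diff[OF bounded_linear.linear[OF c0.bounded_linear_pinv]] b.diff_right)
  ultimately have "N n * N n \<le> N n * (\<omega>c * (N z)\<^sup>2)"
    using c0.nonneg[of n] c0.ip_norm_power2[of n] by (simp add: power2_eq_square)
  then show ?thesis
    unfolding n_def[symmetric] using constants c0.ip_norm_nonneg[of n]
    by (cases "N n = 0") (auto simp: mult_le_cancel_left)
qed

section \<open>Solvability of the Lagrange-Newton system and the error of its solution\<close>

lemma a_bilinear: "bounded_bilinear (\<lambda>v w. a v w)"
  and a_symmetric: "a v w = a w v"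
proof -
  show "bounded_bilinear (\<lambda>v w. a v w)"
    by (rule blinfun.comp[OF blinfun.bounded_linear_right bounded_linear_ident])
  \<comment> \<open>The vector 0 lies in every kernel, so it can serve as the \<open>w\<close> of
    \<open>D2_lagrangian_kernel\<close>; only the regularity of \<open>lagrangian0\<close> is
    wanted.\<close>
  obtain T where "open T" "0 \<in> T" "C2_on T (lagrangian0 P x p)"
    using D2_lagrangian_kernel(2)[of x 0] by (auto simp: blinfun.zero_right)
  then show "a v w = a w v" by (intro symmetric_D2) auto
qed

lemma lagrange_newton_iff:
  "lagrange_newton P x (dx, dp) \<longleftrightarrow> (\<forall>w. a dx w + dp (C 0 w) + L 0 w = 0) \<and> C 0 dx + pb_constr P x 0 = 0"
proof -
  have "a dx + (dp o\<^sub>L C 0) + L 0 = 0 \<longleftrightarrow> (\<forall>w. a dx w + dp (C 0 w) + L 0 w = 0)"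
    (is "?l = 0 \<longleftrightarrow> _")
  proof -
    have "?l = 0 \<longleftrightarrow> (\<forall>w. ?l w = (0 :: 'e \<Rightarrow>\<^sub>L real) w)"
      by (metis blinfun_eqI)
    then show ?thesis by (simp add: blinfun.add_left)
  qed
  then show ?thesis by (simp add: lagrange_newton_def)
qed

text \<open>The difference \<open>e\<close> of two steps lies in the kernel, where the multiplier
  term disappears; testing with \<open>e\<close> itself and coercivity give \<open>e = 0\<close>.
  Testing with \<open>c0.pinv u\<close> then isolates the multiplier.\<close>

lemma lagrange_newton_unique:
  assumes "lagrange_newton P x (dx, dp)" "lagrange_newton P x (dx', dp')"
  shows "dx = dx' \<and> dp = dp'"
proof -
  have 1: "a dx w + dp (C 0 w) + L 0 w = 0" "a dx' w + dp' (C 0 w) + L 0 w = 0"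
    and 2: "C 0 dx + pb_constr P x 0 = 0" "C 0 dx' + pb_constr P x 0 = 0" for w
    using assms by (auto simp: lagrange_newton_iff)
  define e where "e = dx - dx'"
  have e: "C 0 e = 0" using 2 by (simp add: e_def blinfun.diff_right eq_neg_iff_add_eq_0[symmetric])
  have "a e = a dx - a dx'" by (simp add: e_def blinfun.diff_right)
  then have "a e e = 0"
    using 1[of e] by (simp add: e blinfun.zero_right blinfun.diff_left)
  then have "\<alpha> * (N e)\<^sup>2 \<le> 0" using coercive[OF e] by simp
  then have "N e = 0" using constants(6) by (simp add: mult_le_0_iff)
  then have dx: "dx = dx'" by (simp add: e_def)
  have "dp u = dp' u" for u
    using 1[of "c0.pinv u"] by (simp add: dx)
  then show ?thesis using dx by (simp add: blinfun_eqI)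
qed

text \<open>Null-space method: the second equation fixes the normal part \<open>n\<close>, the first
  equation tested on the kernel fixes the tangential part \<open>k\<close>, and on the complement it
  can be met by the choice of the multiplier.\<close>

lemma lagrange_newton_exists: "\<exists>dx dp. lagrange_newton P x (dx, dp)"
proof -
  define n where "n = - c0.pinv (pb_constr P x 0)"
  obtain m M where m: "m > 0" "M > 0" "\<And>v. m * norm v \<le> N v" "\<And>v. N v \<le> M * norm v"
    by (rule c0.norm_equiv) blast
  have "(\<alpha> * m\<^sup>2) * (norm v)\<^sup>2 \<le> a v v" if "v \<in> {u. C 0 u = 0}" for v
  proof -
    have "\<alpha> * (m * norm v)\<^sup>2 \<le> \<alpha> * (N v)\<^sup>2"
      using m constants(6) by (intro mult_left_mono power_mono) auto
    then show ?thesis using coercive[of v] that by (simp add: power_mult_distrib mult.assoc)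
  qed
  moreover have "bounded_linear (\<lambda>w. - L 0 w - a n w)"
    by (intro bounded_linear_sub bounded_linear_minus blinfun.bounded_linear_right)
  ultimately have "\<exists>k\<in>{u. C 0 u = 0}. \<forall>w\<in>{u. C 0 u = 0}. a k w = - L 0 w - a n w"
    using m(1) constants(6)
    by (intro symmetric_coercive_solution[OF a_bilinear a_symmetric c0.subspace_kernel c0.closed_kernel, of "\<alpha> * m\<^sup>2"])
      simp_all
  then obtain k where k: "C 0 k = 0" "\<And>w. C 0 w = 0 \<Longrightarrow> a k w = - L 0 w - a n w"
    by blast
  let ?dx = "n + k"
  \<comment> \<open>The multiplier forced by testing the first equation with
    \<open>c0.pinv u\<close>; an arbitrary \<open>w\<close> splits into
    \<open>c0.pinv (C 0 w)\<close> and a kernel vector, for which the equation already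
    holds.\<close>
  let ?l = "\<lambda>u. - a ?dx (c0.pinv u) - L 0 (c0.pinv u)"
  have "bounded_linear ?l"
    by (intro bounded_linear_sub bounded_linear_minus
        bounded_linear_compose[OF blinfun.bounded_linear_right c0.bounded_linear_pinv])
  then have l: "blinfun_apply (Blinfun ?l) = ?l" by (rule bounded_linear_Blinfun_apply)
  have "a ?dx w + Blinfun ?l (C 0 w) + L 0 w = 0" for w
  proof -
    have "a k (w - c0.pinv (C 0 w)) = - L 0 (w - c0.pinv (C 0 w)) - a n (w - c0.pinv (C 0 w))"
      by (rule k(2)[OF c0.pinv_projection])
    then show ?thesis unfolding l by (simp add: blinfun.diff_right blinfun.add_right blinfun.add_left)
  qed
  moreover have "C 0 ?dx + pb_constr P x 0 = 0"
    by (simp add: n_def k(1) blinfun.diff_right)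
  ultimately show ?thesis unfolding lagrange_newton_iff by blast
qed

text \<open>The error is split into a normal part \<open>n\<close>, which the constraint equation
  makes a Taylor remainder, and a tangential part \<open>t\<close>, for which the Lagrangian
  equation is tested with \<open>t\<close>. The first contributes \<open>\<omega>c\<close>, the
  second the quotient by \<open>\<alpha>\<close>.\<close>

theorem lagrange_newton_step:
  "\<exists>!s. lagrange_newton P x s"
  "lagrange_newton P x (dx, dp) \<Longrightarrow>
    N (dx - z) \<le> (\<omega>c + (K4 + \<omega>L + K2 * \<mu>\<Phi> + \<mu>L * \<omega>c) / \<alpha>) * (N z)\<^sup>2"
proof -
  show "\<exists>!s. lagrange_newton P x s"
    using lagrange_newton_exists lagrange_newton_unique by (metis (no_types, lifting) surj_pair)
  assume ln: "lagrange_newton P x (dx, dp)"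
  define e where "e = dx - z"
  define n where "n = c0.pinv (C 0 e)"
  define t where "t = e - n"
  have ln1: "a dx w + dp (C 0 w) + L 0 w = 0" and ln2: "C 0 dx = - pb_constr P x 0" for w
    using ln by (auto simp: lagrange_newton_iff add_eq_0_iff2)
  have "pb_constr P x z = 0"
    using minimizer by (simp add: pb_constr_def z_xs local_minimizer_def)
  then have "C 0 e = pb_constr P x z - pb_constr P x 0 - C 0 z"
    using ln2 by (simp add: e_def blinfun.diff_right)
  then have Nn: "N n \<le> \<omega>c * (N z)\<^sup>2" using constr_Taylor by (simp add: n_def)
  have t: "C 0 t = 0" unfolding t_def n_def by (rule c0.pinv_projection)
  have "a dx t = - L 0 t" using ln1[of t] t by (simp add: blinfun.zero_right)
  moreover have "D2 (lagrangian P x p) 0 z t = a z t + L 0 (D2 (transition P x) 0 z t)"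
    by (rule D2_lagrangian_kernel(1)[OF t])
  moreover have "a t = a dx - a z - a n"
    by (simp add: t_def e_def blinfun.diff_right)
  then have "a t t = a dx t - a z t - a n t"
    by (simp add: blinfun.diff_left)
  \<comment> \<open>The unknown \<open>dx\<close> has disappeared: \<open>a dx t\<close> is
    \<open>- L 0 t\<close> by the equation, and \<open>a z t\<close> is expressed by the second
    derivative in the other coordinates. Each of the four terms is at most a constant times the
    square of \<open>N z\<close> times \<open>N t\<close>.\<close>
  ultimately have att: "a t t = - L z t + (L z t - L 0 t - D2 (lagrangian P x p) 0 z t)
      + L 0 (D2 (transition P x) 0 z t) - a n t" by simp
  have "\<bar>L 0 (D2 (transition P x) 0 z t)\<bar> \<le> K2 * N z * (\<mu>\<Phi> * N z * N t)"
    by (rule order_trans[OF L_0_bound mult_left_mono[OF transition_bound]]) (use K_nonneg in simp)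
  moreover have "\<bar>a n t\<bar> \<le> \<mu>L * (\<omega>c * (N z)\<^sup>2) * N t"
    by (rule order_trans[OF D2_bound mult_right_mono[OF mult_left_mono[OF Nn]]]) (use constants in simp_all)
  ultimately have "a t t \<le> K4 * (N z)\<^sup>2 * N t + \<omega>L * (N z)\<^sup>2 * N t + K2 * N z * (\<mu>\<Phi> * N z * N t)
      + \<mu>L * (\<omega>c * (N z)\<^sup>2) * N t"
    using att L_z_kernel[OF t] L_Taylor[of t] by linarith
  also have "\<dots> = (K4 + \<omega>L + K2 * \<mu>\<Phi> + \<mu>L * \<omega>c) * (N z)\<^sup>2 * N t"
    by (simp add: power2_eq_square algebra_simps)
  finally have att2: "\<alpha> * (N t)\<^sup>2 \<le> (K4 + \<omega>L + K2 * \<mu>\<Phi> + \<mu>L * \<omega>c) * (N z)\<^sup>2 * N t"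
    using coercive[OF t] by linarith
  have Nt: "N t \<le> (K4 + \<omega>L + K2 * \<mu>\<Phi> + \<mu>L * \<omega>c) / \<alpha> * (N z)\<^sup>2"
  proof (cases "t = 0")
    case True
    then show ?thesis using K_nonneg constants by simp
  next
    case False
    then have "N t > 0" by (rule c0.ip_norm_pos)
    then have "\<alpha> * N t \<le> (K4 + \<omega>L + K2 * \<mu>\<Phi> + \<mu>L * \<omega>c) * (N z)\<^sup>2"
      using att2 by (simp add: power2_eq_square mult.assoc[symmetric])
    then show ?thesis using constants(6) by (simp add: field_simps)
  qed
  have "e = n + t" by (simp add: t_def)
  then have "N e \<le> N n + N t" using c0.ip_norm_triangle by metis
  also have "\<dots> \<le> \<omega>c * (N z)\<^sup>2 + (K4 + \<omega>L + K2 * \<mu>\<Phi> + \<mu>L * \<omega>c) / \<alpha> * (N z)\<^sup>2"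
    using Nn Nt by simp
  finally show "N (dx - z) \<le> (\<omega>c + (K4 + \<omega>L + K2 * \<mu>\<Phi> + \<mu>L * \<omega>c) / \<alpha>) * (N z)\<^sup>2"
    by (simp add: e_def distrib_right)
qed

end


section \<open>Local convergence\<close>

text \<open>\<open>M\<close> may be any positively homogeneous gauge, so the bound comes out in the
  scalar-product norm at the point without norm equivalence constants. The difference quotient is
  taken from the right because homogeneity is available for positive \<open>t\<close>.\<close>

lemma derivative_le_of_lipschitz_at:
  fixes f :: "'a::real_normed_vector \<Rightarrow> real"
  assumes f: "(f has_derivative f') (at 0)" and T: "open T" "0 \<in> T"
    and le: "\<And>d. d \<in> T \<Longrightarrow> \<bar>f d - f 0\<bar> \<le> M d" and M: "\<And>t. t > 0 \<Longrightarrow> M (t *\<^sub>R v) = t * M v"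
  shows "\<bar>f' v\<bar> \<le> M v"
proof -
  have "(f has_derivative f') (at (0 + (0::real) *\<^sub>R v))" using f by simp
  from has_derivative_ray[OF this, where T = UNIV]
  have "((\<lambda>s. f (0 + s *\<^sub>R v)) has_real_derivative f' v) (at 0)"
    by (simp add: has_field_derivative_def mult_commute_abs)
  then have "((\<lambda>t. (f (t *\<^sub>R v) - f 0) / t) \<longlongrightarrow> f' v) (at 0)"
    by (simp add: DERIV_def)
  then have "((\<lambda>t. \<bar>(f (t *\<^sub>R v) - f 0) / t\<bar>) \<longlongrightarrow> \<bar>f' v\<bar>) (at 0)"
    by (rule tendsto_rabs)
  then have lim: "((\<lambda>t. \<bar>(f (t *\<^sub>R v) - f 0) / t\<bar>) \<longlongrightarrow> \<bar>f' v\<bar>) (at_right 0)"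
    by (rule tendsto_mono[OF at_le[OF subset_UNIV]])
  have "((\<lambda>t. t *\<^sub>R v) \<longlongrightarrow> 0 *\<^sub>R v) (at_right 0)"
    by (intro tendsto_intros)
  then have "\<forall>\<^sub>F t in at_right 0. t *\<^sub>R v \<in> T"
    using T by (auto dest: topological_tendstoD)
  then have "\<forall>\<^sub>F t in at_right (0::real). \<bar>(f (t *\<^sub>R v) - f 0) / t\<bar> \<le> M v"
    using eventually_at_right_less[of 0]
  proof eventually_elim
    case (elim t)
    then have "\<bar>f (t *\<^sub>R v) - f 0\<bar> \<le> t * M v" using le M by metis
    then show ?case using elim(2) by (simp add: field_simps)
  qed
  then show ?thesis
    by (rule tendsto_upperbound[OF lim]) simp
qed

context sqp_problem
begin

text \<open>The pullback at \<open>x\<close> is the pullback at \<open>xs\<close> after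
  \<open>trans_map P x xs\<close>. The former inherits a Lipschitz constant at 0 from those of the
  latter two maps, and this bounds its derivative; the transition itself is never
  differentiated.\<close>

lemma pb_obj_derivative_bounded:
  assumes nd: "open O'" "U \<subseteq> O'" "invertible_over P O'" "\<rho> > 0"
    "\<And>x v. x \<in> U \<Longrightarrow> tnorm P x v < \<rho> \<Longrightarrow> v \<in> retr_dom P x \<and> retr P x v \<in> O'"
    "\<And>x1 x2 v w. x1 \<in> U \<Longrightarrow> x2 \<in> U \<Longrightarrow> tnorm P x1 v < \<rho> \<Longrightarrow> tnorm P x1 w < \<rho> \<Longrightarrow>
      tnorm P x2 (trans_map P x1 x2 v - trans_map P x1 x2 w) \<le> \<gamma> * tnorm P x1 (v - w)"
    and \<gamma>: "\<gamma> \<ge> 1" and xs: "xs \<in> U"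
  shows "\<exists>r>0. \<exists>K\<ge>0. \<forall>x\<in>U. tnorm P xs (retr_inv P xs x) < r \<longrightarrow> (\<forall>v. \<bar>D (pb_obj P x) 0 v\<bar> \<le> K * tnorm P x v)"
proof -
  interpret s: compatible_product "scal P xs" by (rule scal_compatible)
  obtain m M where m: "m > 0" "M > 0" "\<And>v. m * norm v \<le> tnorm P xs v" "\<And>v. tnorm P xs v \<le> M * norm v"
    by (rule s.norm_equiv) (simp add: tnorm_def)
  obtain r where r: "r > 0" "\<And>u u'. u \<in> ball 0 r \<Longrightarrow> u' \<in> ball 0 r \<Longrightarrow>
      norm (pb_obj P xs u - pb_obj P xs u' - D (pb_obj P xs) 0 (u - u')) \<le> 1 * norm (u - u')"
    using C2_on_near_linear[OF pb_obj_C2 retrD(1,2), of 1 xs] by auto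
  \<comment> \<open>The Lipschitz constant of the pullback at \<open>xs\<close> near 0: the summand
    1 is the linearisation error allowed above, and division by \<open>m\<close> passes to the norm
    of the scalar product at \<open>xs\<close>.\<close>
  define K where "K = (norm (D (pb_obj P xs) 0) + 1) / m"
  have K: "K \<ge> 0" using m by (simp add: K_def)
  have lip: "\<bar>pb_obj P xs u - pb_obj P xs u'\<bar> \<le> K * tnorm P xs (u - u')"
    if "tnorm P xs u < m * r" "tnorm P xs u' < m * r" for u u'
  proof -
    have "u \<in> ball 0 r" "u' \<in> ball 0 r"
      using m(3)[of u] m(3)[of u'] that m(1) by (auto dest: le_less_trans simp: mult_less_cancel_left)
    then have "\<bar>pb_obj P xs u - pb_obj P xs u'\<bar> \<le> norm (u - u') + norm (D (pb_obj P xs) 0 (u - u'))"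
      using r(2)[of u u'] by simp
    also have "\<dots> \<le> (norm (D (pb_obj P xs) 0) + 1) * norm (u - u')"
      using norm_blinfun[of "D (pb_obj P xs) 0" "u - u'"] by (simp add: distrib_right)
    also have "\<dots> \<le> (norm (D (pb_obj P xs) 0) + 1) * (tnorm P xs (u - u') / m)"
      using m(1) m(3)[of "u - u'"] by (intro mult_left_mono) (auto simp: field_simps)
    finally show ?thesis by (simp add: K_def)
  qed
  have "\<bar>D (pb_obj P x) 0 v\<bar> \<le> K * \<gamma> * tnorm P x v"
    if x: "x \<in> U" and near: "tnorm P xs (retr_inv P xs x) < m * r / 2" for x v
  proof -
    interpret x: compatible_product "scal P x" by (rule scal_compatible)
    \<comment> \<open>Half of the radius \<open>m * r\<close> is used up by the image of 0, which is
      \<open>retr_inv P xs x\<close>; the second entry keeps the displacement under the transition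
      below the other half.\<close>
    define r' where "r' = min \<rho> (m * r / (2 * \<gamma>))"
    have r': "r' > 0" using nd(4) m(1) r(1) \<gamma> by (simp add: r'_def)
    have \<theta>0: "trans_map P x xs 0 = retr_inv P xs x" by (simp add: trans_map_def retrD(4))
    have f_eq: "pb_obj P x d = pb_obj P xs (trans_map P x xs d)" if "tnorm P x d < r'" for d
    proof -
      have "retr P x d \<in> O'" using nd(5)[OF x, of d] that by (simp add: r'_def)
      then have "retr P x d \<in> retr P xs ` retr_inv_dom P xs"
        using nd(2,3) xs unfolding invertible_over_def by blast
      then show ?thesis by (simp add: pb_obj_def trans_map_def retr_retr_inv)
    qed
    have \<theta>: "tnorm P xs (trans_map P x xs d - trans_map P x xs 0) \<le> \<gamma> * tnorm P x d" if "tnorm P x d < r'" for d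
      using nd(6)[OF x xs, of d 0] that nd(4) by (simp add: r'_def tnorm_def)
    have \<theta>_small: "tnorm P xs (trans_map P x xs d) < m * r" if d: "tnorm P x d < r'" for d
    proof -
      have "tnorm P xs (trans_map P x xs d)
          \<le> tnorm P xs (trans_map P x xs 0) + tnorm P xs (trans_map P x xs d - trans_map P x xs 0)"
        using s.ip_norm_triangle[of "trans_map P x xs 0" "trans_map P x xs d - trans_map P x xs 0"]
        by (simp add: tnorm_def)
      also have "\<dots> < m * r / 2 + m * r / 2"
      proof (rule add_strict_mono)
        show "tnorm P xs (trans_map P x xs 0) < m * r / 2" using near by (simp add: \<theta>0)
        have "tnorm P x d < m * r / (2 * \<gamma>)" using d by (simp add: r'_def)
        then have "\<gamma> * tnorm P x d < m * r / 2" using \<gamma> by (simp add: field_simps)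
        then show "tnorm P xs (trans_map P x xs d - trans_map P x xs 0) < m * r / 2" using \<theta>[OF d] by simp
      qed
      finally show ?thesis by simp
    qed
    have 0: "tnorm P x 0 < r'" using r' by (simp add: tnorm_def)
    show ?thesis
    proof (rule derivative_le_of_lipschitz_at[where M = "\<lambda>d. K * \<gamma> * tnorm P x d"])
      show "(pb_obj P x has_derivative blinfun_apply (D (pb_obj P x) 0)) (at 0)"
        by (rule C2_on_has_derivative[OF pb_obj_C2 retrD(2)])
      show "open {d. tnorm P x d < r'}" by (simp add: tnorm_def x.ip_norm_less_open)
      show "0 \<in> {d. tnorm P x d < r'}" using 0 by simp
      fix d assume "d \<in> {d. tnorm P x d < r'}"
      then have d: "tnorm P x d < r'" by simp
      have "\<bar>pb_obj P x d - pb_obj P x 0\<bar> \<le> K * tnorm P xs (trans_map P x xs d - trans_map P x xs 0)"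
        unfolding f_eq[OF d] f_eq[OF 0] by (rule lip[OF \<theta>_small[OF d] \<theta>_small[OF 0]])
      also have "\<dots> \<le> K * (\<gamma> * tnorm P x d)" by (rule mult_left_mono[OF \<theta>[OF d] K])
      finally show "\<bar>pb_obj P x d - pb_obj P x 0\<bar> \<le> K * \<gamma> * tnorm P x d" by simp
    qed (simp add: tnorm_def x.ip_norm_scaleR)
  qed
  then show ?thesis
    using m(1) r(1) K \<gamma> by (intro exI[of _ "m * r / 2"] conjI exI[of _ "K * \<gamma>"]) auto
qed

section \<open>One step near the minimizer, seen in the chart at the minimizer\<close>

lemma local_step:
  assumes min: "local_minimizer P xs" and xs: "xs \<in> interior U"
    and A: "assumption_A P xs U" and B: "assumption_B P U"
  shows "\<exists>\<delta>>0. \<exists>\<beta>\<ge>0. \<beta> * \<delta> \<le> 1/2 \<and> (\<forall>x \<in> retr P xs ` retr_inv_dom P xs. tnorm P xs (retr_inv P xs x) < \<delta> \<longrightarrow>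
    surj (blinfun_apply (D (pb_constr P x) 0)) \<and> (\<exists>!s. lagrange_newton P x s) \<and>
    (\<forall>dx dp. lagrange_newton P x (dx, dp) \<longrightarrow> dx \<in> retr_dom P x \<and> retr P x dx \<in> retr P xs ` retr_inv_dom P xs \<and>
      tnorm P xs (retr_inv P xs (retr P x dx)) \<le> \<beta> * (tnorm P xs (retr_inv P xs x))\<^sup>2))"
proof -
  have xsU: "xs \<in> U" using xs interior_subset by blast
  have "nondegenerate P U" using A unfolding assumption_A_def by (rule conjunct1)
  then obtain O' \<rho> \<gamma>' where nd0: "open O' \<and> U \<subseteq> O' \<and> invertible_over P O' \<and> \<rho> > 0 \<and>
        (\<forall>x\<in>U. \<forall>v. tnorm P x v < \<rho> \<longrightarrow> v \<in> retr_dom P x \<and> retr P x v \<in> O') \<and>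
        (\<forall>x1\<in>U. \<forall>x2\<in>U. \<forall>v w. tnorm P x1 v < \<rho> \<longrightarrow> tnorm P x1 w < \<rho> \<longrightarrow>
           tnorm P x2 (trans_map P x1 x2 v - trans_map P x1 x2 w) \<le> \<gamma>' * tnorm P x1 (v - w))"
    unfolding nondegenerate_def by (elim exE) (rule that)
  have nd: "open O'" "U \<subseteq> O'" "invertible_over P O'" "\<rho> > 0"
    "\<And>x v. x \<in> U \<Longrightarrow> tnorm P x v < \<rho> \<Longrightarrow> v \<in> retr_dom P x \<and> retr P x v \<in> O'"
    "\<And>x1 x2 v w. x1 \<in> U \<Longrightarrow> x2 \<in> U \<Longrightarrow> tnorm P x1 v < \<rho> \<Longrightarrow> tnorm P x1 w < \<rho> \<Longrightarrow>
      tnorm P x2 (trans_map P x1 x2 v - trans_map P x1 x2 w) \<le> \<gamma>' * tnorm P x1 (v - w)"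
    using nd0 by simp_all
  \<comment> \<open>Non-degeneracy allows any real constant; at least 1 is wanted for divisions and
    for \<open>\<delta> <= \<gamma> * \<delta>\<close>.\<close>
  define \<gamma> where "\<gamma> = max \<gamma>' 1"
  have \<gamma>: "\<gamma> \<ge> 1" by (simp add: \<gamma>_def)
  have tn: "0 \<le> tnorm P x v" for x v
    using compatible_product.ip_norm_nonneg[OF scal_compatible] by (simp add: tnorm_def)
  have trans: "tnorm P x2 (trans_map P x1 x2 v - trans_map P x1 x2 w) \<le> \<gamma> * tnorm P x1 (v - w)"
    if "x1 \<in> U" "x2 \<in> U" "tnorm P x1 v < \<rho>" "tnorm P x1 w < \<rho>" for x1 x2 v w
    using nd(6)[OF that] mult_right_mono[OF _ tn, of \<gamma>' \<gamma>] by (fastforce simp: \<gamma>_def intro: order_trans)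
  obtain r K where K: "r > 0" "K \<ge> 0" "\<And>x v. x \<in> U \<Longrightarrow> tnorm P xs (retr_inv P xs x) < r \<Longrightarrow>
      \<bar>D (pb_obj P x) 0 v\<bar> \<le> K * tnorm P x v"
    using pb_obj_derivative_bounded[OF nd(1-5) trans \<gamma> xsU] by blast
  obtain \<rho>A f c c' where \<rho>A: "\<rho>A > 0" and A': "\<And>x. x \<in> U \<Longrightarrow>
          (\<forall>d\<in>retr_dom P x. tnorm P x d \<le> \<rho>A \<longrightarrow>
             dual_norm (scal P x) (D (pb_obj P x) d - D (pb_obj P x) 0) \<le> f * tnorm P x d) \<and>
          surj (blinfun_apply (D (pb_constr P x) 0)) \<and>
          (\<forall>d\<in>retr_dom P x. \<forall>v. tnorm P x d \<le> \<rho>A \<longrightarrow>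
             tnorm P x (pseudo_inverse (scal P x) (D (pb_constr P x) 0)
                          ((D (pb_constr P x) d - D (pb_constr P x) 0) v))
               \<le> c * tnorm P x d * tnorm P x v) \<and>
             surj (blinfun_apply (D (pb_constr P x) (retr_inv P x xs))) \<and>
             (\<forall>v. tnorm P x (pseudo_inverse (scal P x) (D (pb_constr P x) (retr_inv P x xs))
                               ((D (pb_constr P x) (retr_inv P x xs) - D (pb_constr P x) 0) v))
                    \<le> c' * tnorm P x (retr_inv P x xs) * tnorm P x v)"
    using A unfolding assumption_A_def Let_def
    by (elim exE conjE) (rule that, assumption, drule (1) bspec, assumption)
  obtain \<rho>B l \<alpha> q1 q2 where \<rho>B: "\<rho>B > 0" "\<alpha> > 0" and B': "\<And>x. x \<in> U \<Longrightarrow>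
          (\<forall>d\<in>retr_dom P x. \<forall>v w. tnorm P x d \<le> \<rho>B \<longrightarrow>
             \<bar>(D2 (lagrangian P x (multiplier P x)) d - D2 (lagrangian P x (multiplier P x)) 0) v w\<bar>
               \<le> l * tnorm P x d * tnorm P x v * tnorm P x w) \<and>
          (\<forall>v. D (pb_constr P x) 0 v = 0 \<longrightarrow>
             D2 (lagrangian0 P x (multiplier P x)) 0 v v \<ge> \<alpha> * (tnorm P x v)\<^sup>2) \<and>
          (\<forall>v w. \<bar>D2 (lagrangian0 P x (multiplier P x)) 0 v w\<bar> \<le> q1 * tnorm P x v * tnorm P x w) \<and>
          (\<forall>v w. tnorm P x (D2 (transition P x) 0 v w) \<le> q2 * tnorm P x v * tnorm P x w)"
    using B unfolding assumption_B_def
    by (elim exE conjE) (rule that, assumption, assumption, drule (1) bspec, assumption)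
  define \<rho>0 where "\<rho>0 = min \<rho>A \<rho>B"
  \<comment> \<open>The constants of (A) and (B) come without a sign; raising them to 0 preserves
    the estimates, since the factors are nonnegative.\<close>
  define \<omega>f \<omega>c \<omega>c' \<omega>L \<mu>L \<mu>\<Phi> where \<omega>: "\<omega>f = max f 0" "\<omega>c = max c 0" "\<omega>c' = max c' 0" "\<omega>L = max l 0"
    "\<mu>L = max q1 0" "\<mu>\<Phi> = max q2 0"
  have up1: "y \<le> k * a \<Longrightarrow> 0 \<le> a \<Longrightarrow> y \<le> max k 0 * a" for y k a :: real
    using mult_right_mono[of k "max k 0" a] by simp
  have up: "y \<le> k * a * b \<Longrightarrow> 0 \<le> a \<Longrightarrow> 0 \<le> b \<Longrightarrow> y \<le> max k 0 * a * b" for y k a b :: real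
    using up1[of y k "a * b"] by (simp add: mult.assoc)
  have up3: "y \<le> k * a * b * d \<Longrightarrow> 0 \<le> a \<Longrightarrow> 0 \<le> b \<Longrightarrow> 0 \<le> d \<Longrightarrow> y \<le> max k 0 * a * b * d" for y k a b d :: real
    using up1[of y k "a * b * d"] by (simp add: mult.assoc)
  \<comment> \<open>The exported constants take only these numbers as arguments, so \<open>C\<close>
    can be fixed before the iterate \<open>x\<close> is chosen.\<close>
  let ?K2 = "sqp_step.K2 \<rho>0 K \<omega>f \<omega>c'" and ?K4 = "sqp_step.K4 \<rho>0 K \<omega>f \<omega>c \<omega>c'"
  define C where "C = max (\<omega>c + (?K4 + \<omega>L + ?K2 * \<mu>\<Phi> + \<mu>L * \<omega>c) / \<alpha>) 0"
  \<comment> \<open>Non-degeneracy is used in both directions: the square of the norm of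
    \<open>z\<close> costs \<open>\<gamma>\<^sup>2\<close>, and returning from the chart at
    \<open>x\<close> to the chart at \<open>xs\<close> costs one more
    \<open>\<gamma>\<close>.\<close>
  define \<beta> where "\<beta> = \<gamma> * (C * \<gamma>\<^sup>2)"
  have C: "C \<ge> 0" by (simp add: C_def)
  have \<beta>: "\<beta> \<ge> 0" using C \<gamma> by (simp add: \<beta>_def)

  interpret s: compatible_product "scal P xs" by (rule scal_compatible)
  obtain m M where m: "m > 0" "M > 0" "\<And>v. m * norm v \<le> tnorm P xs v" "\<And>v. tnorm P xs v \<le> M * norm v"
    by (rule s.norm_equiv) (simp add: tnorm_def)
  have "open {d \<in> retr_dom P xs. retr P xs d \<in> interior U}"
    by (rule C2_map_on_open_preimage[OF retrD(3)]) simp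
  moreover have "0 \<in> {d \<in> retr_dom P xs. retr P xs d \<in> interior U}" using xs by (simp add: retrD)
  ultimately obtain r2 where r2: "r2 > 0" "ball 0 r2 \<subseteq> {d \<in> retr_dom P xs. retr P xs d \<in> interior U}"
    unfolding open_contains_ball by blast
  have in_U: "retr P xs u \<in> U" if "tnorm P xs u < m * r2" for u
  proof -
    have "m * norm u < m * r2" using m(3)[of u] that by linarith
    then have "u \<in> ball 0 r2" using m(1) by simp
    then show ?thesis using r2(2) interior_subset by blast
  qed
  define k where "k = \<gamma> + C * \<gamma>\<^sup>2"
  have k: "k > 0" using \<gamma> C by (simp add: k_def add_pos_nonneg)
  \<comment> \<open>In order, the entries ensure: the square of the norm of \<open>u\<close> is at
    most that norm; the bound on f'(0) holds; \<open>x\<close> lies in \<open>U\<close>; the step,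
    and then \<open>z\<close>, lie in the ball of radius \<open>\<rho>\<close>; the Lipschitz
    estimates reach \<open>z\<close>; c' stays surjective on the segment; and the quadratic bound
    becomes a contraction.\<close>
  define \<delta> where "\<delta> = Min {1, r, m * r2, \<rho> / (2 * k), \<rho> / (2 * \<gamma>), \<rho>0 / \<gamma>, 1 / (2 * (\<omega>c * \<gamma> + 1)), 1 / (2 * (\<beta> + 1))}"
  have \<rho>0: "\<rho>0 > 0" using \<rho>A \<rho>B by (simp add: \<rho>0_def)
  have \<omega>c: "\<omega>c \<ge> 0" by (simp add: \<omega>)
  have \<omega>c\<gamma>: "\<omega>c * \<gamma> \<ge> 0" using \<omega>c \<gamma> by simp
  have "0 < m * r2" "0 < \<rho> / (2 * k)" "0 < \<rho> / (2 * \<gamma>)" "0 < \<rho>0 / \<gamma>"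
    "0 < 1 / (2 * (\<omega>c * \<gamma> + 1))" "0 < 1 / (2 * (\<beta> + 1))"
    using m(1) r2(1) k \<gamma> \<rho>0 nd(4) \<omega>c\<gamma> \<beta> by simp_all
  then have \<delta>_pos: "\<delta> > 0"
    using K(1) unfolding \<delta>_def by (subst Min_gr_iff) simp_all
  have \<delta>: "\<delta> > 0" "\<delta> \<le> 1" "\<delta> \<le> r" "\<delta> \<le> m * r2" "\<delta> \<le> \<rho> / (2 * k)" "\<delta> \<le> \<rho> / (2 * \<gamma>)" "\<delta> \<le> \<rho>0 / \<gamma>"
    "\<delta> \<le> 1 / (2 * (\<omega>c * \<gamma> + 1))" "\<delta> \<le> 1 / (2 * (\<beta> + 1))"
    by (rule \<delta>_pos) (unfold \<delta>_def, (rule Min_le; simp)+)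
  have "2 * (\<beta> + 1) * \<delta> \<le> 1" using \<delta>(9) \<beta> by (simp add: field_simps)
  then have \<beta>\<delta>: "\<beta> * \<delta> \<le> 1/2" using \<delta>(1) by (simp add: algebra_simps)
  have k\<delta>: "k * \<delta> \<le> \<rho> / 2" using \<delta>(5) k by (simp add: field_simps)
  have \<gamma>\<delta>: "\<gamma> * \<delta> \<le> \<rho> / 2" "\<gamma> * \<delta> \<le> \<rho>0" using \<delta>(6,7) \<gamma> by (simp_all add: field_simps)
  have "2 * (\<omega>c * \<gamma> + 1) * \<delta> \<le> 1" using \<delta>(8) \<omega>c\<gamma> by (simp add: field_simps)
  then have \<omega>\<gamma>\<delta>: "\<omega>c * (\<gamma> * \<delta>) \<le> 1/2" using \<delta>(1) by (simp add: algebra_simps)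

  have step: "surj (blinfun_apply (D (pb_constr P x) 0)) \<and> (\<exists>!s. lagrange_newton P x s) \<and>
    (\<forall>dx dp. lagrange_newton P x (dx, dp) \<longrightarrow> dx \<in> retr_dom P x \<and> retr P x dx \<in> retr P xs ` retr_inv_dom P xs \<and>
      tnorm P xs (retr_inv P xs (retr P x dx)) \<le> \<beta> * (tnorm P xs (retr_inv P xs x))\<^sup>2)"
    if xR: "x \<in> retr P xs ` retr_inv_dom P xs" and near: "tnorm P xs (retr_inv P xs x) < \<delta>" for x
  proof -
    define u where "u = retr_inv P xs x"
    define z where "z = retr_inv P x xs"
    have u: "retr P xs u = x" "tnorm P xs u < \<delta>" using xR near by (simp_all add: u_def retr_retr_inv)
    have xU: "x \<in> U" using in_U[of u] u \<delta>(4) by simp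
    have "\<delta> \<le> \<gamma> * \<delta>" using mult_right_mono[OF \<gamma>, of \<delta>] \<delta>(1) by simp
    then have \<delta>\<rho>: "\<delta> \<le> \<rho> / 2" using \<gamma>\<delta> by linarith
    have uP: "tnorm P xs u < \<rho>" using u(2) \<delta>\<rho> nd(4) by linarith
    have "xs \<in> retr P x ` retr_inv_dom P x"
      using nd(2,3) xsU xU unfolding invertible_over_def by blast
    then have z_xs: "retr P x z = xs" unfolding z_def by (rule retr_retr_inv)
    have 0: "tnorm P y 0 < \<rho>" for y
      using nd(4) compatible_product.ip_norm_0[OF scal_compatible] by (simp add: tnorm_def)
    have "trans_map P xs x 0 = z" "trans_map P xs x u = 0"
      \<comment> \<open>In the chart at \<open>xs\<close> the minimizer is 0 and the iterate is
        \<open>u\<close>; in the chart at \<open>x\<close> they are \<open>z\<close> and 0. The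
        Lipschitz bound for this pair compares \<open>z\<close> with \<open>u\<close>.\<close>
      by (simp_all add: trans_map_def z_def u retrD(4) retr_inv_self)
    then have z_u: "tnorm P x z \<le> \<gamma> * tnorm P xs u"
      using trans[OF xsU xU 0 uP] s.ip_norm_minus[of u] by (simp add: tnorm_def)
    also have "\<dots> \<le> \<gamma> * \<delta>" using u(2) \<gamma> by simp
    finally have z_\<delta>: "tnorm P x z \<le> \<gamma> * \<delta>" .
    have z_small: "tnorm P x z < \<rho>" "tnorm P x z \<le> \<rho>0" "\<omega>c * tnorm P x z \<le> 1/2"
      using z_\<delta> \<gamma>\<delta> \<omega>\<gamma>\<delta> nd(4) mult_left_mono[OF z_\<delta> \<omega>c] by linarith+
    note A'x = A'[OF xU, folded z_def] and B'x = B'[OF xU]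
    have "sqp_step P x xs z \<rho> \<rho>0 K \<omega>f \<omega>c \<omega>c' \<omega>L \<alpha> \<mu>L \<mu>\<Phi>"
    proof (unfold_locales, fold tnorm_def)
      show "local_minimizer P xs" by (rule min)
      show "retr P x z = xs" by (rule z_xs)
      show "d \<in> retr_dom P x" if "tnorm P x d < \<rho>" for d using nd(5)[OF xU that] by blast
      show "tnorm P x z < \<rho>" "tnorm P x z \<le> \<rho>0" "\<omega>c * tnorm P x z \<le> 1/2" by (rule z_small)+
      show "0 \<le> K" by (rule K(2))
      show "0 \<le> \<omega>f" "0 \<le> \<omega>c" "0 \<le> \<omega>c'" "0 \<le> \<omega>L" "0 \<le> \<mu>L" "0 \<le> \<mu>\<Phi>" by (simp_all add: \<omega>)
      show "0 < \<alpha>" by (rule \<rho>B(2))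
      show "\<bar>D (pb_obj P x) 0 v\<bar> \<le> K * tnorm P x v" for v
        using K(3)[OF xU] near \<delta>(3) by simp
      show "dual_norm (scal P x) (D (pb_obj P x) d - D (pb_obj P x) 0) \<le> \<omega>f * tnorm P x d"
        if "d \<in> retr_dom P x" "tnorm P x d \<le> \<rho>0" for d
        unfolding \<omega> by (rule up1[OF _ tn]) (use A'x that in \<open>auto simp: \<rho>0_def\<close>)
      show "surj (blinfun_apply (D (pb_constr P x) 0))" "surj (blinfun_apply (D (pb_constr P x) z))"
        using A'x by blast+
      show "tnorm P x (pseudo_inverse (scal P x) (D (pb_constr P x) 0) ((D (pb_constr P x) d - D (pb_constr P x) 0) v))
          \<le> \<omega>c * tnorm P x d * tnorm P x v" if "d \<in> retr_dom P x" "tnorm P x d \<le> \<rho>0" for d v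
        unfolding \<omega> by (rule up[OF _ tn tn]) (use A'x that in \<open>auto simp: \<rho>0_def\<close>)
      show "tnorm P x (pseudo_inverse (scal P x) (D (pb_constr P x) z) ((D (pb_constr P x) z - D (pb_constr P x) 0) v))
          \<le> \<omega>c' * tnorm P x z * tnorm P x v" for v
        unfolding \<omega> by (rule up[OF _ tn tn]) (use A'x in blast)
      show "\<bar>(D2 (lagrangian P x (multiplier P x)) d - D2 (lagrangian P x (multiplier P x)) 0) v w\<bar>
          \<le> \<omega>L * tnorm P x d * tnorm P x v * tnorm P x w" if "d \<in> retr_dom P x" "tnorm P x d \<le> \<rho>0" for d v w
        unfolding \<omega> by (rule up3[OF _ tn tn tn]) (use B'x that in \<open>auto simp: \<rho>0_def\<close>)
      show "\<alpha> * (tnorm P x v)\<^sup>2 \<le> D2 (lagrangian0 P x (multiplier P x)) 0 v v"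
        if "D (pb_constr P x) 0 v = 0" for v using B'x that by blast
      show "\<bar>D2 (lagrangian0 P x (multiplier P x)) 0 v w\<bar> \<le> \<mu>L * tnorm P x v * tnorm P x w" for v w
        unfolding \<omega> by (rule up[OF _ tn tn]) (use B'x in blast)
      show "tnorm P x (D2 (transition P x) 0 v w) \<le> \<mu>\<Phi> * tnorm P x v * tnorm P x w" for v w
        unfolding \<omega> by (rule up[OF _ tn tn]) (use B'x in blast)
    qed
    then interpret st: sqp_step P x xs z \<rho> \<rho>0 K \<omega>f \<omega>c \<omega>c' \<omega>L \<alpha> \<mu>L \<mu>\<Phi> .
    have "dx \<in> retr_dom P x \<and> retr P x dx \<in> retr P xs ` retr_inv_dom P xs \<and>
      tnorm P xs (retr_inv P xs (retr P x dx)) \<le> \<beta> * (tnorm P xs (retr_inv P xs x))\<^sup>2"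
      if ln: "lagrange_newton P x (dx, dp)" for dx dp
    proof -
      have "tnorm P x (dx - z) \<le> (\<omega>c + (?K4 + \<omega>L + ?K2 * \<mu>\<Phi> + \<mu>L * \<omega>c) / \<alpha>) * (tnorm P x z)\<^sup>2"
        using st.lagrange_newton_step(2)[OF ln] by (simp add: tnorm_def)
      also have "\<dots> \<le> C * (tnorm P x z)\<^sup>2"
        unfolding C_def by (intro mult_right_mono) auto
      finally have e: "tnorm P x (dx - z) \<le> C * (tnorm P x z)\<^sup>2" .
      have "(tnorm P x z)\<^sup>2 \<le> (\<gamma> * tnorm P xs u)\<^sup>2"
        using z_u tn by (intro power_mono)
      then have "C * (tnorm P x z)\<^sup>2 \<le> C * (\<gamma> * tnorm P xs u)\<^sup>2"
        using C by (intro mult_left_mono)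
      with e have e2: "tnorm P x (dx - z) \<le> C * \<gamma>\<^sup>2 * (tnorm P xs u)\<^sup>2"
        by (simp add: power_mult_distrib mult.assoc)
      have "(tnorm P xs u)\<^sup>2 \<le> 1 * tnorm P xs u"
        unfolding power2_eq_square using u(2) \<delta>(2) tn by (intro mult_right_mono) auto
      then have "C * \<gamma>\<^sup>2 * (tnorm P xs u)\<^sup>2 \<le> C * \<gamma>\<^sup>2 * tnorm P xs u"
        using C by (intro mult_left_mono) auto
      moreover have "tnorm P x dx \<le> tnorm P x z + tnorm P x (dx - z)"
        using st.c0.ip_norm_triangle[of z "dx - z"] by (simp add: tnorm_def)
      ultimately have "tnorm P x dx \<le> k * tnorm P xs u"
        using e2 z_u by (simp add: k_def distrib_right)
      also have "\<dots> \<le> k * \<delta>" using u(2) k by simp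
      finally have dx\<rho>: "tnorm P x dx < \<rho>" using k\<delta> nd(4) by linarith
      have dx: "dx \<in> retr_dom P x" "retr P x dx \<in> O'" using nd(5)[OF xU dx\<rho>] by auto
      then have "retr P x dx \<in> retr P xs ` retr_inv_dom P xs"
        using nd(2,3) xsU unfolding invertible_over_def by blast
      moreover have "tnorm P xs (retr_inv P xs (retr P x dx)) \<le> \<beta> * (tnorm P xs u)\<^sup>2"
      proof -
        \<comment> \<open>The way back: \<open>dx\<close> and \<open>z\<close> go to the new iterate
          and to 0 in the chart at \<open>xs\<close>, so the new error is at most
          \<open>\<gamma>\<close> times the error of the step.\<close>
        have "trans_map P x xs z = 0" by (simp add: trans_map_def z_xs retr_inv_self)
        then have "tnorm P xs (retr_inv P xs (retr P x dx)) \<le> \<gamma> * tnorm P x (dx - z)"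
          using trans[OF xU xsU dx\<rho> z_small(1)] by (simp add: trans_map_def)
        also have "\<dots> \<le> \<gamma> * (C * \<gamma>\<^sup>2 * (tnorm P xs u)\<^sup>2)"
          using e2 \<gamma> by (intro mult_left_mono) auto
        finally show ?thesis by (simp add: \<beta>_def mult.assoc)
      qed
      ultimately show ?thesis using dx(1) by (simp add: u_def)
    qed
    then show ?thesis using st.surj0 st.lagrange_newton_step(1) by blast
  qed
  show ?thesis
    using \<delta>(1) \<beta> \<beta>\<delta> step by (intro exI[of _ \<delta>] exI[of _ \<beta>] conjI) auto
qed

end

section \<open>The run of the method and its convergence\<close>

theorem theorem3p9:
  fixes P :: "('x::t2_space, 'y::t2_space, 'e::{real_inner, banach}, 'f::{real_inner, banach}) problem"
    and xs :: 'x and U :: "'x set"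
  assumes "sqp_setting P"
    and "local_minimizer P xs"
    and "xs \<in> interior U"
    and "assumption_A P xs U"
    and "assumption_B P U"
  shows "\<exists>\<delta>>0. \<exists>\<beta>. \<forall>x0 \<in> retr P xs ` retr_inv_dom P xs.
           tnorm P xs (retr_inv P xs x0) < \<delta> \<longrightarrow>
           (\<exists>x dx. sqp_run P x0 x dx \<and>
              x \<longlonglongrightarrow> xs \<and>
              (\<forall>k. x k \<in> retr P xs ` retr_inv_dom P xs) \<and>
              (\<forall>k. tnorm P xs (retr_inv P xs (x (Suc k)))
                     \<le> \<beta> * (tnorm P xs (retr_inv P xs (x k)))\<^sup>2))"
proof -
  interpret sqp_problem P by unfold_locales (rule assms(1))
  interpret s: compatible_product "scal P xs" by (rule scal_compatible)
  let ?R = "retr P xs ` retr_inv_dom P xs" and ?n = "\<lambda>x. tnorm P xs (retr_inv P xs x)"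
  obtain \<delta> \<beta> where \<delta>: "\<delta> > 0" "\<beta> \<ge> 0" "\<beta> * \<delta> \<le> 1/2" and
    step0: "\<forall>x\<in>?R. ?n x < \<delta> \<longrightarrow> surj (blinfun_apply (D (pb_constr P x) 0)) \<and> (\<exists>!s. lagrange_newton P x s) \<and>
    (\<forall>dx dp. lagrange_newton P x (dx, dp) \<longrightarrow> dx \<in> retr_dom P x \<and> retr P x dx \<in> ?R \<and>
      ?n (retr P x dx) \<le> \<beta> * (?n x)\<^sup>2)"
    using local_step[OF assms(2-5)] by (elim exE conjE) (rule that)
  note step = mp[OF bspec[OF step0]]
  define dir where "dir x = fst (THE s. lagrange_newton P x s)" for x
  have dir: "\<exists>dp. lagrange_newton P x (dir x, dp)" if "x \<in> ?R" "?n x < \<delta>" for x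
  proof -
    have "\<exists>!s. lagrange_newton P x s" using step[OF that] by (elim conjE)
    then have "lagrange_newton P x (THE s. lagrange_newton P x s)" by (rule theI')
    then have "lagrange_newton P x (dir x, snd (THE s. lagrange_newton P x s))"
      by (simp add: dir_def)
    then show ?thesis by (rule exI)
  qed
  have "\<exists>x dx. sqp_run P x0 x dx \<and> x \<longlonglongrightarrow> xs \<and> (\<forall>k. x k \<in> ?R) \<and> (\<forall>k. ?n (x (Suc k)) \<le> \<beta> * (?n (x k))\<^sup>2)"
    if x0: "x0 \<in> ?R" "?n x0 < \<delta>" for x0
  proof -
    define x where "x k = ((\<lambda>x. retr P x (dir x)) ^^ k) x0" for k
    have x_Suc: "x (Suc k) = retr P (x k) (dir (x k))" for k by (simp add: x_def)
    have n0: "0 \<le> ?n y" for y by (simp add: tnorm_def)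
    \<comment> \<open>Since \<open>\<beta> * \<delta> <= 1/2\<close>, the quadratic bound halves the
      error inside the ball of radius \<open>\<delta>\<close>. The decay keeps the iterates in that
      ball, where the next step is defined, so membership and decay are proved together.\<close>
    have inv: "x k \<in> ?R \<and> ?n (x k) \<le> ?n x0 * (1/2) ^ k" for k
    proof (induction k)
      case 0
      then show ?case using x0 by (simp add: x_def)
    next
      case (Suc k)
      have "?n x0 * (1/2) ^ k \<le> ?n x0 * 1" using n0 by (intro mult_left_mono) (auto intro: power_le_one)
      then have small: "?n (x k) < \<delta>" using Suc x0(2) by linarith
      then have s: "x (Suc k) \<in> ?R" "?n (x (Suc k)) \<le> \<beta> * (?n (x k))\<^sup>2"
        using step[of "x k"] dir[of "x k"] Suc by (auto simp: x_Suc)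
      have "\<beta> * (?n (x k))\<^sup>2 \<le> \<beta> * \<delta> * ?n (x k)"
        unfolding power2_eq_square mult.assoc using small \<delta>(2) n0 by (intro mult_left_mono mult_right_mono) auto
      also have "\<dots> \<le> 1/2 * ?n (x k)" using \<delta>(3) n0 by (rule mult_right_mono)
      finally show ?case using s Suc by simp
    qed
    have small: "?n (x k) < \<delta>" for k
    proof -
      have "?n x0 * (1/2) ^ k \<le> ?n x0 * 1" using n0 by (intro mult_left_mono) (auto intro: power_le_one)
      then show ?thesis using inv[of k] x0(2) by linarith
    qed
    have run: "sqp_run P x0 x (\<lambda>k. dir (x k))"
      unfolding sqp_run_def
    proof (intro conjI allI)
      fix k
      have s: "surj (blinfun_apply (D (pb_constr P (x k)) 0))" "\<exists>!s. lagrange_newton P (x k) s"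
        "\<And>dx dp. lagrange_newton P (x k) (dx, dp) \<Longrightarrow> dx \<in> retr_dom P (x k)"
        using step[OF conjunct1[OF inv] small, of k] by blast+
      obtain dp where dp: "lagrange_newton P (x k) (dir (x k), dp)"
        using dir[OF conjunct1[OF inv] small] by blast
      show "surj (blinfun_apply (D (pb_constr P (x k)) 0))" "\<exists>!s. lagrange_newton P (x k) s" by (rule s)+
      show "\<exists>dp. lagrange_newton P (x k) (dir (x k), dp)" "dir (x k) \<in> retr_dom P (x k)"
        using dp s(3) by blast+
      show "x (Suc k) = retr P (x k) (dir (x k))" by (rule x_Suc)
    qed (simp add: x_def)
    have conv: "x \<longlonglongrightarrow> xs"
    proof -
      obtain m M where m: "m > 0" "M > 0" "\<And>v. m * norm v \<le> tnorm P xs v" "\<And>v. tnorm P xs v \<le> M * norm v"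
        by (rule s.norm_equiv) (simp add: tnorm_def)
      \<comment> \<open>Convergence in the topology of \<open>X\<close> is obtained in coordinates:
        the norm at \<open>xs\<close> is equivalent to that of \<open>'e\<close>, and the retraction
        is continuous at 0.\<close>
      have "(\<lambda>k. retr_inv P xs (x k)) \<longlonglongrightarrow> 0"
      proof (rule Lim_null_comparison)
        have "norm (retr_inv P xs (x k)) \<le> ?n x0 / m * (1/2) ^ k" for k
        proof -
          have "m * norm (retr_inv P xs (x k)) \<le> ?n x0 * (1/2) ^ k"
            using m(3)[of "retr_inv P xs (x k)"] inv[of k] by linarith
          then show ?thesis using m(1) by (simp add: field_simps)
        qed
        then show "\<forall>\<^sub>F k in sequentially. norm (retr_inv P xs (x k)) \<le> ?n x0 / m * (1/2) ^ k" by simp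
        show "(\<lambda>k. ?n x0 / m * (1/2) ^ k) \<longlonglongrightarrow> 0"
          by (intro tendsto_mult_right_zero LIMSEQ_realpow_zero) auto
      qed
      moreover have "isCont (retr P xs) 0"
        using C2_map_on_continuous[OF retrD(3)] retrD(1,2) continuous_on_eq_continuous_at by blast
      ultimately have "(\<lambda>k. retr P xs (retr_inv P xs (x k))) \<longlonglongrightarrow> retr P xs 0"
        using isCont_tendsto_compose by blast
      then show ?thesis using inv by (simp add: retr_retr_inv retrD(4))
    qed
    have "?n (x (Suc k)) \<le> \<beta> * (?n (x k))\<^sup>2" for k
      using step[OF conjunct1[OF inv] small, of k] dir[OF conjunct1[OF inv] small, of k] by (auto simp: x_Suc)
    then show ?thesis using run conv inv by blast
  qed
  then show ?thesis using \<delta>(1) by (intro exI[of _ \<delta>] conjI exI[of _ \<beta>]) auto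
qed

end
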